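(* Let $D$ be a self-adjoint regular operator on $E$ and let $\mu$ be an invertible adjointable operator on $E$. Let $a$ and $b$ be adjointable operators on $E$ such that $X\operatorname{dom}D\subseteq\operatorname{dom}D$ for each $X\in\{\mu^*a,\ \mu^{-1}a,\ a,\ b\mu,\ b\mu^{-1*}\}$. Suppose further that, for some $0\le\alpha<1$, the operators $$\langle D\rangle^{-\alpha}[D,a\mu],\quad \langle D\rangle^{-\alpha}[D,a\mu^{-1*}],\quad \langle D\rangle^{-\alpha}[D,a],\quad [D,b\mu]\langle D\rangle^{-\alpha},\quad [\mu D\mu^*,a^*b]\mu^{-1*}\langle D\rangle^{-\alpha}$$ are bounded. Then, with $D_1=\mu D\mu^*$, the operator $(F_{D_1}-F_D)a^*b\mu\langle D\rangle^{\beta}$ is bounded for every $\beta<1-\alpha$. If $c$ is an adjointable operator such that $c\mu^{-1*}\operatorname{dom}D\subseteq\operatorname{dom}D$, then $(F_{D_1}-F_D)a^*bc^*\langle D\rangle^\beta$ is bounded for $\beta<1-\alpha$. If, moreover, $d$ is an adjointable operator such that $(1+D^2)^{-1}d$ is compact, then $(F_{D_1}-F_D)a^*bc^*d$ is compact.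
   Context: $E$ is a fixed countably generated right Hilbert $B$-module over a C*-algebra $B$. For a self-adjoint regular operator $D$ on $E$: $\langle D\rangle=(1+D^2)^{1/2}$ and $F_D=D(1+D^2)^{-1/2}$. For invertible adjointable $\mu$, $\mu^{-1*}=(\mu^{-1})^*$, and $\mu D\mu^*$ has domain $\mu^{-1*}\operatorname{dom}D$, on which it is self-adjoint and regular. A densely defined operator is called bounded if it extends to a bounded (adjointable) operator on $E$. Compact means compact in the Hilbert-module sense (element of $\operatorname{End}^0(E)$).
   Formalization: The commutators [D,aμ] and [D,aμ^{-1*}] are taken on all of dom D, so aμ and aμ^{-1*} are additionally required to map dom D into dom D (likewise a*b on dom μDμ*, which then follows); the listed inclusions alone do not suffice. *)

theory Defs
  imports "HOL-Analysis.Analysis" "HOL-Computational_Algebra.Polynomial"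
begin

section \<open>C*-algebras and Hilbert modules\<close>

class complex_banach = banach +
  fixes scaleC :: "complex \<Rightarrow> 'a \<Rightarrow> 'a"  (infixr "*\<^sub>C" 75)
  assumes scaleC_add_right: "c *\<^sub>C (x + y) = c *\<^sub>C x + c *\<^sub>C y"
    and scaleC_add_left: "(c + c') *\<^sub>C x = c *\<^sub>C x + c' *\<^sub>C x"
    and scaleC_scaleC: "c *\<^sub>C (c' *\<^sub>C x) = (c * c') *\<^sub>C x"
    and scaleC_of_real: "complex_of_real r *\<^sub>C x = r *\<^sub>R x"
    and norm_scaleC: "norm (c *\<^sub>C x) = cmod c * norm x"

text \<open>Not necessarily unital.\<close>

class cstar_algebra = complex_banach + real_normed_algebra +
  fixes star :: "'a \<Rightarrow> 'a"
  assumes scaleC_mult_left: "(c *\<^sub>C x) * y = c *\<^sub>C (x * y)"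
    and scaleC_mult_right: "x * (c *\<^sub>C y) = c *\<^sub>C (x * y)"
    and star_star: "star (star x) = x"
    and star_add: "star (x + y) = star x + star y"
    and star_scaleC: "star (c *\<^sub>C x) = cnj c *\<^sub>C star x"
    and star_mult: "star (x * y) = star y * star x"
    and cstar_identity: "norm (star x * x) = (norm x)\<^sup>2"

definition positive_element :: "'b::cstar_algebra \<Rightarrow> bool" where
  "positive_element p \<longleftrightarrow> (\<exists>q. p = star q * q)"

record ('b, 'e) hilbert_structure =
  act :: "'e \<Rightarrow> 'b \<Rightarrow> 'e"
  ip :: "'e \<Rightarrow> 'e \<Rightarrow> 'b"

text \<open>
  Right Hilbert modules. The inner product is linear in its second argument.
  Completeness is part of the type class of \<open>'e\<close>, whose norm is required to be the one
  induced by the inner product; definiteness of the inner product follows.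
\<close>

locale hilbert_module =
  fixes E :: "('b::cstar_algebra, 'e::complex_banach) hilbert_structure"
  assumes act_add_left: "act E (x + y) b = act E x b + act E y b"
    and act_add_right: "act E x (b + b') = act E x b + act E x b'"
    and act_mult: "act E (act E x b) b' = act E x (b * b')"
    and act_scaleC_left: "act E (c *\<^sub>C x) b = c *\<^sub>C act E x b"
    and act_scaleC_right: "act E x (c *\<^sub>C b) = c *\<^sub>C act E x b"
    and ip_add_right: "ip E x (y + z) = ip E x y + ip E x z"
    and ip_scaleC_right: "ip E x (c *\<^sub>C y) = c *\<^sub>C ip E x y"
    and ip_act_right: "ip E x (act E y b) = ip E x y * b"
    and star_ip: "star (ip E x y) = ip E y x"
    and ip_positive: "positive_element (ip E x x)"
    and norm_eq_sqrt_ip: "norm x = sqrt (norm (ip E x x))"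

definition submodule :: "('b::cstar_algebra, 'e::complex_banach) hilbert_structure \<Rightarrow> 'e set \<Rightarrow> bool" where
  "submodule E M \<longleftrightarrow> 0 \<in> M \<and> (\<forall>x\<in>M. \<forall>y\<in>M. x + y \<in> M) \<and>
     (\<forall>x\<in>M. \<forall>c. c *\<^sub>C x \<in> M) \<and> (\<forall>x\<in>M. \<forall>b. act E x b \<in> M)"

definition countably_generated :: "('b::cstar_algebra, 'e::complex_banach) hilbert_structure \<Rightarrow> bool" where
  "countably_generated E \<longleftrightarrow>
     (\<exists>S. countable S \<and> (\<forall>M. submodule E M \<and> closed M \<and> S \<subseteq> M \<longrightarrow> M = UNIV))"

section \<open>Adjointable and compact operators\<close>

definition is_adjoint :: "('b, 'e) hilbert_structure \<Rightarrow> ('e \<Rightarrow> 'e) \<Rightarrow> ('e \<Rightarrow> 'e) \<Rightarrow> bool" where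
  "is_adjoint E T S \<longleftrightarrow> (\<forall>x y. ip E (T x) y = ip E x (S y))"

definition adjointable :: "('b, 'e) hilbert_structure \<Rightarrow> ('e \<Rightarrow> 'e) \<Rightarrow> bool" where
  "adjointable E T \<longleftrightarrow> (\<exists>S. is_adjoint E T S)"

definition adj :: "('b, 'e) hilbert_structure \<Rightarrow> ('e \<Rightarrow> 'e) \<Rightarrow> 'e \<Rightarrow> 'e" where
  "adj E T = (THE S. is_adjoint E T S)"

definition invertible_adjointable :: "('b, 'e) hilbert_structure \<Rightarrow> ('e \<Rightarrow> 'e) \<Rightarrow> bool" where
  "invertible_adjointable E T \<longleftrightarrow> adjointable E T \<and> bij T \<and> adjointable E (inv T)"

text \<open>
  \<open>End\<^sup>0(E)\<close>: the operator-norm closure of the span of the rank-one operators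
  \<open>z \<mapsto> x\<langle>y, z\<rangle>\<close>; complex coefficients are absorbed into \<open>x\<close>.
\<close>

definition compact_operator ::
  "('b::cstar_algebra, 'e::complex_banach) hilbert_structure \<Rightarrow> ('e \<Rightarrow> 'e) \<Rightarrow> bool" where
  "compact_operator E K \<longleftrightarrow> adjointable E K \<and>
     (\<forall>\<epsilon>>0. \<exists>(n::nat) x y. \<forall>z. norm (K z - (\<Sum>i<n. act E (x i) (ip E (y i) z))) \<le> \<epsilon> * norm z)"

section \<open>Partially defined operators\<close>

text \<open>
  An operator \<open>T\<close> with domain \<open>dom T\<close> is a map \<open>'e \<rightharpoonup> 'e\<close>; the library composition
  \<open>S \<circ>\<^sub>m T\<close> has the usual domain \<open>{x \<in> dom T. T x \<in> dom S}\<close>.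
\<close>

definition total_op :: "('e \<Rightarrow> 'e) \<Rightarrow> 'e \<rightharpoonup> 'e" where
  "total_op T = (\<lambda>x. Some (T x))"

definition op_diff :: "('e::minus \<rightharpoonup> 'e) \<Rightarrow> ('e \<rightharpoonup> 'e) \<Rightarrow> 'e \<rightharpoonup> 'e"  (infixl "-\<^sub>m" 65) where
  "S -\<^sub>m T = (\<lambda>x. if x \<in> dom S \<inter> dom T then Some (the (S x) - the (T x)) else None)"

definition one_plus :: "('e::plus \<rightharpoonup> 'e) \<Rightarrow> 'e \<rightharpoonup> 'e" where
  "one_plus T = (\<lambda>x. if x \<in> dom T then Some (x + the (T x)) else None)"

text \<open>The inverse of an injective operator, with domain \<open>ran T\<close>.\<close>

definition op_inverse :: "('e \<rightharpoonup> 'e) \<Rightarrow> 'e \<rightharpoonup> 'e" where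
  "op_inverse T = (\<lambda>y. if y \<in> ran T then Some (THE x. T x = Some y) else None)"

text \<open>
  The commutator of \<open>D\<close> with an everywhere defined \<open>T\<close> is an operator with domain \<open>dom D\<close>.
  It only makes sense when \<open>T\<close> maps \<open>dom D\<close> into itself; otherwise it is given
  empty domain here, so that it is not densely defined. (Being densely defined and bounded on
  \<open>{x \<in> dom D. T x \<in> dom D}\<close> alone would not even determine how \<open>T\<^sup>*\<close> acts on \<open>dom D\<close>.)
\<close>

definition commutator :: "('e::minus \<rightharpoonup> 'e) \<Rightarrow> ('e \<Rightarrow> 'e) \<Rightarrow> 'e \<rightharpoonup> 'e" where
  "commutator D T =
     (if T ` dom D \<subseteq> dom D then (D \<circ>\<^sub>m total_op T) -\<^sub>m (total_op T \<circ>\<^sub>m D) else Map.empty)"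

definition densely_defined :: "('e::topological_space \<rightharpoonup> 'e) \<Rightarrow> bool" where
  "densely_defined T \<longleftrightarrow> closure (dom T) = UNIV"

definition bounded_operator :: "('b, 'e::topological_space) hilbert_structure \<Rightarrow> ('e \<rightharpoonup> 'e) \<Rightarrow> bool" where
  "bounded_operator E T \<longleftrightarrow> densely_defined T \<and> (\<exists>S. adjointable E S \<and> T \<subseteq>\<^sub>m total_op S)"

definition is_compact :: "('b::cstar_algebra, 'e::complex_banach) hilbert_structure \<Rightarrow> ('e \<rightharpoonup> 'e) \<Rightarrow> bool" where
  "is_compact E T \<longleftrightarrow> (\<exists>K. compact_operator E K \<and> T = total_op K)"

definition module_operator ::
  "('b::cstar_algebra, 'e::complex_banach) hilbert_structure \<Rightarrow> ('e \<rightharpoonup> 'e) \<Rightarrow> bool" where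
  "module_operator E T \<longleftrightarrow> submodule E (dom T) \<and>
     (\<forall>x\<in>dom T. \<forall>y\<in>dom T. the (T (x + y)) = the (T x) + the (T y)) \<and>
     (\<forall>x\<in>dom T. \<forall>c. the (T (c *\<^sub>C x)) = c *\<^sub>C the (T x)) \<and>
     (\<forall>x\<in>dom T. \<forall>b. the (T (act E x b)) = act E (the (T x)) b)"

text \<open>The adjoint of a densely defined operator.\<close>

definition op_adjoint :: "('b, 'e) hilbert_structure \<Rightarrow> ('e \<rightharpoonup> 'e) \<Rightarrow> 'e \<rightharpoonup> 'e" where
  "op_adjoint E T = (\<lambda>y.
     if \<exists>z. \<forall>x\<in>dom T. ip E (the (T x)) y = ip E x z
     then Some (THE z. \<forall>x\<in>dom T. ip E (the (T x)) y = ip E x z) else None)"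

definition regular_operator ::
  "('b::cstar_algebra, 'e::complex_banach) hilbert_structure \<Rightarrow> ('e \<rightharpoonup> 'e) \<Rightarrow> bool" where
  "regular_operator E T \<longleftrightarrow> module_operator E T \<and> densely_defined T \<and>
     closed {(x, y). T x = Some y} \<and> densely_defined (op_adjoint E T) \<and>
     closure (ran (one_plus (op_adjoint E T \<circ>\<^sub>m T))) = UNIV"

definition selfadjoint_regular ::
  "('b::cstar_algebra, 'e::complex_banach) hilbert_structure \<Rightarrow> ('e \<rightharpoonup> 'e) \<Rightarrow> bool" where
  "selfadjoint_regular E D \<longleftrightarrow> regular_operator E D \<and> op_adjoint E D = D"

section \<open>Functional calculus\<close>

definition poly_op :: "real poly \<Rightarrow> ('e::real_vector \<Rightarrow> 'e) \<Rightarrow> 'e \<Rightarrow> 'e" where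
  "poly_op p T x = (\<Sum>i\<le>degree p. coeff p i *\<^sub>R (T ^^ i) x)"

text \<open>
  Continuous functional calculus of a positive adjointable operator \<open>T\<close>, whose spectrum lies in
  \<open>[0, \<parallel>T\<parallel>]\<close>: for \<open>f\<close> continuous on this interval, \<open>f(T)\<close> is the norm limit of \<open>p\<^sub>n(T)\<close> for all
  polynomials \<open>p\<^sub>n\<close> that converge to \<open>f\<close> uniformly on it.
\<close>

definition fun_calc ::
  "('b::cstar_algebra, 'e::complex_banach) hilbert_structure \<Rightarrow> (real \<Rightarrow> real) \<Rightarrow> ('e \<Rightarrow> 'e) \<Rightarrow> 'e \<Rightarrow> 'e" where
  "fun_calc E f T = (THE S. adjointable E S \<and>
     (\<forall>p :: nat \<Rightarrow> real poly.
        uniform_limit {0..onorm T} (\<lambda>n. poly (p n)) f sequentially \<longrightarrow>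
        (\<lambda>n. onorm (\<lambda>x. poly_op (p n) T x - S x)) \<longlonglongrightarrow> 0))"

text \<open>\<open>t\<^sup>r\<close> for \<open>t, r \<ge> 0\<close>; \<open>powr\<close> has the value 0 at \<open>t = r = 0\<close>, where continuity requires 1.\<close>

definition rpow :: "real \<Rightarrow> real \<Rightarrow> real" where
  "rpow r t = (if r = 0 then 1 else t powr r)"

text \<open>\<open>(1 + D\<^sup>2)\<^sup>-\<^sup>1\<close>, which is everywhere defined for self-adjoint regular \<open>D\<close>.\<close>

definition inv_one_plus_sq :: "('e::plus \<rightharpoonup> 'e) \<Rightarrow> 'e \<Rightarrow> 'e" where
  "inv_one_plus_sq D = (\<lambda>y. the (op_inverse (one_plus (D \<circ>\<^sub>m D)) y))"

text \<open>
  \<open>\<langle>D\<rangle>\<^sup>s = (1 + D\<^sup>2)\<^sup>s\<^sup>/\<^sup>2\<close>. For \<open>s \<le> 0\<close> this is the power with exponent \<open>-s/2 \<ge> 0\<close> of the positive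
  contraction \<open>(1 + D\<^sup>2)\<^sup>-\<^sup>1\<close>; for \<open>s > 0\<close> it is the inverse of \<open>\<langle>D\<rangle>\<^sup>-\<^sup>s\<close>.
\<close>

definition bracket_power ::
  "('b::cstar_algebra, 'e::complex_banach) hilbert_structure \<Rightarrow> ('e \<rightharpoonup> 'e) \<Rightarrow> real \<Rightarrow> 'e \<rightharpoonup> 'e" where
  "bracket_power E D s =
     (if s \<le> 0 then total_op (fun_calc E (rpow (- s / 2)) (inv_one_plus_sq D))
      else op_inverse (total_op (fun_calc E (rpow (s / 2)) (inv_one_plus_sq D))))"

definition bounded_transform ::
  "('b::cstar_algebra, 'e::complex_banach) hilbert_structure \<Rightarrow> ('e \<rightharpoonup> 'e) \<Rightarrow> 'e \<rightharpoonup> 'e" where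
  "bounded_transform E D = D \<circ>\<^sub>m bracket_power E D (- 1)"

text \<open>\<open>\<mu>D\<mu>\<^sup>*\<close>, with domain \<open>{x. \<mu>\<^sup>*x \<in> dom D}\<close>.\<close>

definition conformal :: "('b, 'e) hilbert_structure \<Rightarrow> ('e \<Rightarrow> 'e) \<Rightarrow> ('e \<rightharpoonup> 'e) \<Rightarrow> 'e \<rightharpoonup> 'e" where
  "conformal E \<mu> D = total_op \<mu> \<circ>\<^sub>m D \<circ>\<^sub>m total_op (adj E \<mu>)"

end

theory Submission
  imports Defs "HOL-Complex_Analysis.Cauchy_Integral_Formula"
begin

text \<open>
  Write \<open>h = \<langle>D\<rangle>\<^sup>-\<^sup>1\<close>, \<open>F = D h\<close>, and \<open>h\<^sub>1\<close>, \<open>F\<^sub>1\<close> for the same operators of \<open>D\<^sub>1 = \<mu> D \<mu>\<^sup>*\<close>. All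
  hypotheses and conclusions are turned into statements about bounded operators: a bound on
  \<open>J \<langle>D\<rangle>\<^sup>r\<close> becomes \<open>\<parallel>J x\<parallel> \<le> C \<parallel>h\<^sup>r x\<parallel>\<close>, written \<open>dominated J h\<^sup>r\<close>, and a bound on \<open>[D, T] \<langle>D\<rangle>\<^sup>-\<^sup>\<alpha>\<close>
  becomes \<open>F T h - h T F = h C h\<^sup>1\<^sup>-\<^sup>\<alpha>\<close> with \<open>C\<close> bounded.

  The operator \<open>D\<^sub>1\<close> is compared with \<open>D\<close> through the two conjugates \<open>S = \<mu> F \<mu>\<^sup>-\<^sup>1\<close> and
  \<open>S' = \<mu>\<^sup>-\<^sup>1\<^sup>* F \<mu>\<^sup>*\<close> of \<open>F\<close>. Applied to \<open>a\<^sup>*\<close>, both differ from \<open>a\<^sup>* F\<close> and from \<open>F a\<^sup>*\<close> by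
  commutators of \<open>F\<close> with \<open>\<mu>\<^sup>-\<^sup>1 a\<^sup>*\<close>, \<open>\<mu>\<^sup>* a\<^sup>*\<close> and \<open>a\<^sup>*\<close>, which are dominated by \<open>h\<^sup>r\<close> for every
  \<open>r < 1 - \<alpha>\<close>. The remaining difference \<open>G = F\<^sub>1 - S'\<close> would be negligible if \<open>S\<close> and \<open>S'\<close> were
  equal, since \<open>S\<close> would then essentially be the phase in the polar decomposition \<open>D\<^sub>1 \<approx> S A\<close>,
  where \<open>A = \<mu> \<langle>D\<rangle> \<mu>\<^sup>*\<close>. In general \<open>G\<close> solves the Sylvester equation
  \<open>\<langle>D\<^sub>1\<rangle> G + G A \<approx> (S - S') A\<close>. As \<open>a\<^sup>* b\<close> almost commutes with \<open>A\<close>, the product \<open>G a\<^sup>* b\<close> solves an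
  equation of the same kind, now with a right-hand side of order at most \<open>1 - r\<close> for each such
  \<open>r\<close>. Its solution has order at most \<open>-r\<close>, up to an arbitrarily small loss, because \<open>\<langle>D\<^sub>1\<rangle>\<close> and \<open>A\<close>
  are positive. The commutators of \<open>F\<close> are estimated by the same argument, applied to
  \<open>\<langle>D\<rangle> [F, T] + [F, T] \<langle>D\<rangle> \<approx> [D, T] - F [D, T] F\<close>.

  The theorem \<open>sylvester_dominated\<close> cuts the spectrum of the right-hand operator into geometric
  bands. On the band around \<open>\<sigma>\<close> the Cayley transform of that operator at \<open>\<sigma>\<close> is small, while that of
  the left-hand operator is bounded, and the equation bounds the solution by its right-hand side.
  Summing over the bands costs an arbitrarily small part of the exponent, as does the interpolation
  theorem \<open>dominated_interpolation\<close> that transports powers through \<open>\<mu>\<close>, \<open>b \<mu>\<close> and \<open>c\<close>. This loss is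
  harmless since \<open>\<beta> < 1 - \<alpha>\<close> is an open condition. The same room in the exponent makes the
  extension adjointable, as a norm limit of adjointable cut-offs. Compactness follows since
  \<open>\<langle>D\<rangle>\<^sup>-\<^sup>\<beta> d\<close> is, for \<open>\<beta> > 0\<close>, a norm limit of operators \<open>q(R) R d\<close>, where \<open>R = (1 + D\<^sup>2)\<^sup>-\<^sup>1\<close> and
  \<open>q\<close> is a polynomial.

  What this needs from operator theory is a continuous functional calculus for positive
  operators on a Hilbert module, up to a constant in the norm estimate, and the positivity of
  operators \<open>V V\<^sup>*\<close>, which is applied to \<open>R\<close> and to \<open>A\<^sup>-\<^sup>1\<close>. The calculus rests on the unitary
  dilation of a self-adjoint contraction (\<open>norm_poly_op_le_contraction\<close>), positivity on the
  argument of Kelley and Vaught (\<open>spectral_bound_self_mult_adjoint\<close>). All lower bounds come from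
  the identity \<open>\<parallel>(D + i) x\<parallel> = \<parallel>(D - i) x\<parallel>\<close> and the triangle inequality.
\<close>

section \<open>Inner products and adjointable operators\<close>

lemma scaleC_one [simp]: "1 *\<^sub>C (x::'a::complex_banach) = x"
  using scaleC_of_real[of 1 x] by simp

lemma scaleC_zero_right [simp]: "c *\<^sub>C (0::'a::complex_banach) = 0"
  using norm_scaleC[of c "0::'a"] by simp

lemma scaleC_zero_left [simp]: "0 *\<^sub>C (x::'a::complex_banach) = 0"
  using norm_scaleC[of 0 x] by simp

lemma scaleC_minus_right: "c *\<^sub>C (- x) = - (c *\<^sub>C (x::'a::complex_banach))"
  using scaleC_add_right[of c x "- x"] by (metis add.right_inverse neg_eq_iff_add_eq_0 scaleC_zero_right)

lemma scaleC_minus_left: "(- c) *\<^sub>C x = - (c *\<^sub>C (x::'a::complex_banach))"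
  using scaleC_add_left[of c "- c" x] by (metis add.right_inverse neg_eq_iff_add_eq_0 scaleC_zero_left)

lemma scaleC_diff_right: "c *\<^sub>C (x - y) = c *\<^sub>C x - c *\<^sub>C (y::'a::complex_banach)"
  using scaleC_add_right[of c x "- y"] by (simp add: scaleC_minus_right)

lemma scaleC_scaleR: "c *\<^sub>C (r *\<^sub>R x) = r *\<^sub>R (c *\<^sub>C (x::'a::complex_banach))"
  by (metis scaleC_of_real scaleC_scaleC mult.commute)

lemma bounded_linear_scaleC: "bounded_linear (\<lambda>x::'a::complex_banach. c *\<^sub>C x)"
  by (rule bounded_linear_intro[where K="cmod c"])
    (auto simp: scaleC_add_right scaleC_scaleR norm_scaleC)

lemma scaleC_ii_ii: "\<i> *\<^sub>C (\<i> *\<^sub>C x) = - (x::'a::complex_banach)"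
  using scaleC_minus_left[of 1 x] by (simp add: scaleC_scaleC)

text \<open>Limits under bounds \<open>\<epsilon> c\<close> with a fixed \<open>c\<close>, which will be the norm of a vector.\<close>

lemma ex_smaller_factor: "0 < (e::real) \<Longrightarrow> \<exists>d>0. d * c < e"
  by (rule exI[of _ "e / (\<bar>c\<bar> + 1)"]) (auto simp: divide_less_eq add_nonneg_pos abs_if algebra_simps)

lemma tendsto_if_le_mult:
  assumes "\<And>e. e > 0 \<Longrightarrow> \<exists>N. \<forall>n\<ge>N. norm (f n - a) \<le> e * c"
  shows "f \<longlonglongrightarrow> (a::'a::real_normed_vector)"
  by (rule LIMSEQ_I) (meson assms ex_smaller_factor le_less_trans)

lemma Cauchy_if_le_mult:
  assumes "\<And>e. e > 0 \<Longrightarrow> \<exists>N. \<forall>m\<ge>N. \<forall>n\<ge>N. norm (f m - f n) \<le> e * c"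
  shows "Cauchy (f :: nat \<Rightarrow> 'a::real_normed_vector)"
  by (rule CauchyI) (meson assms ex_smaller_factor le_less_trans)

lemma Cauchy_if_le_Cauchy:
  fixes f s :: "nat \<Rightarrow> 'a::real_normed_vector"
  assumes "Cauchy s" and "\<And>m n. norm (f m - f n) \<le> c * norm (s m - s n)"
  shows "Cauchy f"
proof (rule Cauchy_if_le_mult[of _ "\<bar>c\<bar>"])
  fix e :: real assume "e > 0"
  then obtain N where N: "\<And>m n. m \<ge> N \<Longrightarrow> n \<ge> N \<Longrightarrow> norm (s m - s n) < e" using CauchyD[OF assms(1)] by blast
  have "norm (f m - f n) \<le> e * \<bar>c\<bar>" if "m \<ge> N" "n \<ge> N" for m n
    using order_trans[OF assms(2) mult_mono[OF abs_ge_self less_imp_le[OF N[OF that]]]] by (simp add: mult.commute)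
  then show "\<exists>N. \<forall>m\<ge>N. \<forall>n\<ge>N. norm (f m - f n) \<le> e * \<bar>c\<bar>" by blast
qed

lemma le_if_le_add_mult:
  fixes a b c :: real
  assumes "\<And>e. e > 0 \<Longrightarrow> a \<le> b + e * c"
  shows "a \<le> b"
  by (rule field_le_epsilon) (meson assms ex_smaller_factor add_left_mono less_imp_le order_trans)

context hilbert_module
begin

lemma ip_add_left: "ip E (x + y) z = ip E x z + ip E y z"
  by (metis ip_add_right star_add star_ip)

lemma ip_scaleC_left: "ip E (c *\<^sub>C x) y = cnj c *\<^sub>C ip E x y"
  by (metis ip_scaleC_right star_scaleC star_ip)

lemma ip_scaleR_right: "ip E x (r *\<^sub>R y) = r *\<^sub>R ip E x y"
  using ip_scaleC_right[of x "complex_of_real r" y] by (simp add: scaleC_of_real)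

lemma ip_scaleR_left: "ip E (r *\<^sub>R x) y = r *\<^sub>R ip E x y"
  using ip_scaleC_left[of "complex_of_real r" x y] by (simp add: scaleC_of_real)

lemma norm_ip_self: "norm (ip E x x) = (norm x)\<^sup>2"
  by (simp add: norm_eq_sqrt_ip)

text \<open>
  Polarisation writes \<open>4 \<langle>x, y\<rangle>\<close> as a combination of inner squares of \<open>x \<plusminus> y\<close> and \<open>x \<plusminus> i y\<close>, so
  the triangle inequality of the module norm gives the Cauchy--Schwarz inequality up to a constant.
\<close>

lemma norm_ip_le: "norm (ip E x y) \<le> 4 * norm x * norm y"
proof (cases "x = 0 \<or> y = 0")
  case True
  then show ?thesis
    using ip_scaleR_left[of 0 x y] ip_scaleR_right[of x 0 y] by auto
next
  case False
  have unit: "norm (ip E u v) \<le> 4" if u: "norm u = 1" and v: "norm v = 1" for u v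
  proof -
    have re: "norm (ip E u w + ip E w u) \<le> 4" if w: "norm w = 1" for w
    proof -
      have e: "2 *\<^sub>R (ip E u w + ip E w u) = ip E (u + w) (u + w) - ip E (u + (-1) *\<^sub>R w) (u + (-1) *\<^sub>R w)"
        by (simp only: ip_add_left ip_add_right ip_scaleR_left ip_scaleR_right)
          (simp add: scaleR_2)
      have "norm (u + w) \<le> 2" "norm (u + (-1) *\<^sub>R w) \<le> 2"
        using norm_triangle_ineq[of u w] norm_triangle_ineq[of u "(-1) *\<^sub>R w"] u w by auto
      then have "(norm (u + w))\<^sup>2 \<le> 2\<^sup>2" "(norm (u + (-1) *\<^sub>R w))\<^sup>2 \<le> 2\<^sup>2"
        using power_mono[of _ 2 2] norm_ge_zero by blast+
      then have "norm (ip E (u + w) (u + w)) \<le> 4" "norm (ip E (u + (-1) *\<^sub>R w) (u + (-1) *\<^sub>R w)) \<le> 4"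
        unfolding norm_ip_self by auto
      then have "norm (2 *\<^sub>R (ip E u w + ip E w u)) \<le> 8"
        unfolding e using norm_triangle_ineq4[of "ip E (u + w) (u + w)" "ip E (u + (-1) *\<^sub>R w) (u + (-1) *\<^sub>R w)"]
        by linarith
      then show ?thesis by simp
    qed
    have 1: "norm (ip E u v + ip E v u) \<le> 4" by (rule re[OF v])
    have "norm (ip E u (\<i> *\<^sub>C v) + ip E (\<i> *\<^sub>C v) u) \<le> 4" by (rule re) (simp add: norm_scaleC v)
    moreover have "ip E u (\<i> *\<^sub>C v) + ip E (\<i> *\<^sub>C v) u = \<i> *\<^sub>C (ip E u v - ip E v u)"
      by (simp add: ip_scaleC_left ip_scaleC_right scaleC_diff_right scaleC_minus_left)
    ultimately have 2: "norm (ip E u v - ip E v u) \<le> 4" by (simp add: norm_scaleC)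
    have "2 *\<^sub>R ip E u v = (ip E u v + ip E v u) + (ip E u v - ip E v u)" by (simp add: scaleR_2)
    then have "norm (2 *\<^sub>R ip E u v) \<le> 8"
      using norm_triangle_ineq[of "ip E u v + ip E v u" "ip E u v - ip E v u"] 1 2 by simp
    then show ?thesis by simp
  qed
  let ?u = "inverse (norm x) *\<^sub>R x" and ?v = "inverse (norm y) *\<^sub>R y"
  have "norm (ip E ?u ?v) \<le> 4" using False by (intro unit) auto
  then show ?thesis using False by (simp add: ip_scaleR_left ip_scaleR_right field_simps)
qed

lemma bounded_bilinear_ip: "bounded_bilinear (ip E)"
proof
  show "\<exists>K. \<forall>a b. norm (ip E a b) \<le> norm a * norm b * K"
    by (rule exI[of _ 4]) (metis norm_ip_le mult.assoc mult.commute)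
qed (simp_all add: ip_add_left ip_add_right ip_scaleR_left ip_scaleR_right)

lemmas ip_zero_left [simp] = bounded_bilinear.zero_left[OF bounded_bilinear_ip]
  and ip_zero_right [simp] = bounded_bilinear.zero_right[OF bounded_bilinear_ip]
  and ip_diff_left = bounded_bilinear.diff_left[OF bounded_bilinear_ip]
  and ip_diff_right = bounded_bilinear.diff_right[OF bounded_bilinear_ip]
  and ip_minus_left = bounded_bilinear.minus_left[OF bounded_bilinear_ip]
  and ip_minus_right = bounded_bilinear.minus_right[OF bounded_bilinear_ip]
  and tendsto_ip = bounded_bilinear.tendsto[OF bounded_bilinear_ip]

lemma ip_self_eq_zero: "ip E x x = 0 \<Longrightarrow> x = 0"
  using norm_ip_self[of x] by simp

lemma ip_eqI: "(\<And>z. ip E z x = ip E z y) \<Longrightarrow> x = y"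
  using ip_self_eq_zero[of "x - y"] by (simp add: ip_diff_right)

lemma ip_eqI_left: "(\<And>z. ip E x z = ip E y z) \<Longrightarrow> x = y"
  by (metis ip_eqI star_ip)

lemma ip_dense_eqI:
  assumes "closure S = UNIV" and "\<And>z. z \<in> S \<Longrightarrow> ip E z x = ip E z y"
  shows "x = y"
proof (rule ip_eqI)
  fix z
  have "z \<in> closure S" using assms(1) by simp
  then obtain s where s: "\<And>n. s n \<in> S" "s \<longlonglongrightarrow> z" unfolding closure_sequential by blast
  have "(\<lambda>n. ip E (s n) x) \<longlonglongrightarrow> ip E z x" "(\<lambda>n. ip E (s n) y) \<longlonglongrightarrow> ip E z y"
    by (intro tendsto_ip s tendsto_const)+
  then show "ip E z x = ip E z y" using s(1) assms(2) by (simp add: LIMSEQ_unique)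
qed

lemma is_adjoint_sym: "is_adjoint E T S \<Longrightarrow> is_adjoint E S T"
  unfolding is_adjoint_def by (metis star_ip)

lemma is_adjointD: "is_adjoint E T S \<Longrightarrow> ip E (T x) y = ip E x (S y)"
  unfolding is_adjoint_def by blast

lemma is_adjoint_unique: "is_adjoint E T S \<Longrightarrow> is_adjoint E T S' \<Longrightarrow> S = S'"
  unfolding is_adjoint_def by (intro ext ip_eqI) metis

lemma adj_eq: "is_adjoint E T S \<Longrightarrow> adj E T = S"
  unfolding adj_def by (rule the_equality) (auto intro: is_adjoint_unique)

lemma adjoint_adj: "adjointable E T \<Longrightarrow> is_adjoint E T (adj E T)"
  unfolding adjointable_def using adj_eq by metis

lemma adjointableI: "is_adjoint E T S \<Longrightarrow> adjointable E T"
  unfolding adjointable_def by blast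

text \<open>
  Uniform boundedness in the only form in which it is used: weakly bounded sets are bounded.
  It makes adjointable operators continuous, and later controls operators that preserve \<open>dom D\<close>.
\<close>

lemma weakly_bounded_imp_bounded:
  assumes "\<And>w. \<exists>K. \<forall>v\<in>V. norm (ip E v w) \<le> K"
  shows "\<exists>C. \<forall>v\<in>V. norm v \<le> C"
proof -
  define A where "A n = {w. \<forall>v\<in>V. norm (ip E v w) \<le> real n}" for n :: nat
  have clA: "closed (A n)" for n
  proof -
    have "closed {w. norm (ip E v w) \<le> real n}" for v
      by (intro closed_Collect_le continuous_intros bounded_bilinear.continuous_on[OF bounded_bilinear_ip])
    moreover have "A n = (\<Inter>v\<in>V. {w. norm (ip E v w) \<le> real n})" by (auto simp: A_def)
    ultimately show ?thesis by auto
  qed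
  have UA: "\<Union>(range A) = UNIV"
  proof -
    have "w \<in> \<Union>(range A)" for w
    proof -
      obtain K where K: "\<forall>v\<in>V. norm (ip E v w) \<le> K" using assms by blast
      obtain n where "K \<le> real n" using real_arch_simple by blast
      then have "w \<in> A n" using K by (force simp: A_def)
      then show ?thesis by blast
    qed
    then show ?thesis by blast
  qed
  have "\<exists>n. interior (A n) \<noteq> {}"
  proof (rule ccontr)
    assume "\<not> ?thesis"
    then have "Met_TC.mtopology interior_of \<Union>(range A) = {}"
      using clA by (intro Met_TC.metric_Baire_category_alt) (auto simp: complete_UNIV)
    then show False unfolding UA by simp
  qed
  then obtain n w0 where "w0 \<in> interior (A n)" by blast
  then obtain r where r: "r > 0" "ball w0 r \<subseteq> A n" unfolding mem_interior by blast
  have "norm v \<le> 4 * real n / r" if v: "v \<in> V" for v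
  proof (cases "v = 0")
    case False
    define z where "z = (r / (2 * norm v)) *\<^sub>R v"
    have nz: "norm z = r / 2" using False r by (simp add: z_def)
    have "w0 + z \<in> A n" "w0 \<in> A n" using r nz by (auto simp: subset_iff dist_norm)
    then have "norm (ip E v (w0 + z)) \<le> n" "norm (ip E v w0) \<le> n" using v by (auto simp: A_def)
    then have "norm (ip E v z) \<le> 2 * n"
      using norm_triangle_ineq4[of "ip E v (w0 + z)" "ip E v w0"] by (simp add: ip_add_right)
    then have "(r / (2 * norm v)) * (norm v)\<^sup>2 \<le> 2 * n"
      using r by (simp add: z_def ip_scaleR_right norm_ip_self)
    then show ?thesis using r False by (simp add: field_simps power2_eq_square)
  qed (use r in auto)
  then show ?thesis by blast
qed

lemma adjoint_bounded_linear:
  assumes "is_adjoint E T S"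
  shows "bounded_linear T"
proof -
  have "\<exists>C. \<forall>v\<in>T ` {x. norm x \<le> 1}. norm v \<le> C"
  proof (rule weakly_bounded_imp_bounded)
    fix w
    have "norm (ip E (T x) w) \<le> 4 * norm (S w)" if "norm x \<le> 1" for x
      using norm_ip_le[of x "S w"] is_adjointD[OF assms, of x w] mult_right_mono[OF that, of "4 * norm (S w)"]
      by simp
    then show "\<exists>K. \<forall>v\<in>T ` {x. norm x \<le> 1}. norm (ip E v w) \<le> K" by blast
  qed
  then obtain C where C: "\<And>x. norm x \<le> 1 \<Longrightarrow> norm (T x) \<le> C" by blast
  have add: "T (x + y) = T x + T y" for x y
    by (rule ip_eqI_left) (simp add: is_adjointD[OF assms] ip_add_left)
  have scale: "T (r *\<^sub>R x) = r *\<^sub>R T x" for r x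
    by (rule ip_eqI_left) (simp add: is_adjointD[OF assms] ip_scaleR_left)
  have "norm (T x) \<le> norm x * C" for x
  proof (cases "x = 0")
    case True
    then show ?thesis using scale[of 0 0] by simp
  next
    case False
    have "norm (T (inverse (norm x) *\<^sub>R x)) \<le> C" using False by (intro C) simp
    then show ?thesis using False by (simp add: scale field_simps)
  qed
  then show ?thesis using add scale by (intro bounded_linear_intro) auto
qed

lemma adjoint_scaleC: "is_adjoint E T S \<Longrightarrow> T (c *\<^sub>C x) = c *\<^sub>C T x"
  by (rule ip_eqI_left) (simp add: is_adjointD ip_scaleC_left)

lemma adjoint_act: "is_adjoint E T S \<Longrightarrow> T (act E x b) = act E (T x) b"
  by (rule ip_eqI) (metis is_adjointD is_adjoint_sym ip_act_right)

lemma adjointable_bounded_linear: "adjointable E T \<Longrightarrow> bounded_linear T"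
  unfolding adjointable_def using adjoint_bounded_linear by blast

lemma adjoint_comp: "is_adjoint E T T' \<Longrightarrow> is_adjoint E S S' \<Longrightarrow> is_adjoint E (\<lambda>x. T (S x)) (\<lambda>x. S' (T' x))"
  unfolding is_adjoint_def by simp

lemma adjoint_add: "is_adjoint E T T' \<Longrightarrow> is_adjoint E S S' \<Longrightarrow> is_adjoint E (\<lambda>x. T x + S x) (\<lambda>x. T' x + S' x)"
  unfolding is_adjoint_def by (simp add: ip_add_left ip_add_right)

lemma adjoint_diff: "is_adjoint E T T' \<Longrightarrow> is_adjoint E S S' \<Longrightarrow> is_adjoint E (\<lambda>x. T x - S x) (\<lambda>x. T' x - S' x)"
  unfolding is_adjoint_def by (simp add: ip_diff_left ip_diff_right)

lemma adjoint_minus: "is_adjoint E T T' \<Longrightarrow> is_adjoint E (\<lambda>x. - T x) (\<lambda>x. - T' x)"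
  unfolding is_adjoint_def by (simp add: ip_minus_left ip_minus_right)

lemma adjoint_scaleR: "is_adjoint E T T' \<Longrightarrow> is_adjoint E (\<lambda>x. r *\<^sub>R T x) (\<lambda>x. r *\<^sub>R T' x)"
  unfolding is_adjoint_def by (simp add: ip_scaleR_left ip_scaleR_right)

lemma adjoint_scaleC_op: "is_adjoint E T T' \<Longrightarrow> is_adjoint E (\<lambda>x. c *\<^sub>C T x) (\<lambda>x. cnj c *\<^sub>C T' x)"
  unfolding is_adjoint_def by (simp add: ip_scaleC_left ip_scaleC_right)

lemma adjoint_zero: "is_adjoint E (\<lambda>x. 0) (\<lambda>x. 0)"
  unfolding is_adjoint_def by simp

lemma adjoint_limit:
  assumes "\<And>n. is_adjoint E (T n) (T' n)"
    and "\<And>x. (\<lambda>n. T n x) \<longlonglongrightarrow> S x" and "\<And>x. (\<lambda>n. T' n x) \<longlonglongrightarrow> S' x"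
  shows "is_adjoint E S S'"
  unfolding is_adjoint_def
proof (intro allI)
  fix x y
  have "(\<lambda>n. ip E (T n x) y) \<longlonglongrightarrow> ip E (S x) y" "(\<lambda>n. ip E x (T' n y)) \<longlonglongrightarrow> ip E x (S' y)"
    by (intro tendsto_ip assms tendsto_const)+
  then show "ip E (S x) y = ip E x (S' y)"
    using is_adjointD[OF assms(1)] by (simp add: LIMSEQ_unique)
qed

lemma norm_sq_le_adjoint: "is_adjoint E T S \<Longrightarrow> (norm (T x))\<^sup>2 \<le> 4 * norm x * norm (S (T x))"
  by (metis norm_ip_self is_adjointD norm_ip_le)

lemma norm_add_ii_eq:
  assumes "ip E u v = ip E v u"
  shows "norm (u + \<i> *\<^sub>C v) = norm (u - \<i> *\<^sub>C v)"
    and "ip E (u + \<i> *\<^sub>C v) (u + \<i> *\<^sub>C v) = ip E u u + ip E v v"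
proof -
  show 1: "ip E (u + \<i> *\<^sub>C v) (u + \<i> *\<^sub>C v) = ip E u u + ip E v v"
    by (simp add: ip_add_left ip_add_right ip_scaleC_left ip_scaleC_right assms scaleC_minus_left
        scaleC_diff_right scaleC_ii_ii)
  have "ip E (u - \<i> *\<^sub>C v) (u - \<i> *\<^sub>C v) = ip E u u + ip E v v"
    by (simp add: ip_diff_left ip_diff_right ip_scaleC_left ip_scaleC_right assms scaleC_minus_left
        scaleC_diff_right scaleC_add_right scaleC_ii_ii)
  with 1 show "norm (u + \<i> *\<^sub>C v) = norm (u - \<i> *\<^sub>C v)" by (simp add: norm_eq_sqrt_ip)
qed

text \<open>
  The source of all lower bounds: \<open>u \<plusminus> iv\<close> have equal norms because they have equal inner
  squares, so the triangle inequality bounds both \<open>u\<close> and \<open>v\<close> by either of them.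
\<close>

lemma norm_le_norm_add_ii:
  assumes "ip E u v = ip E v u"
  shows "norm u \<le> norm (u + \<i> *\<^sub>C v)" and "norm v \<le> norm (u + \<i> *\<^sub>C v)"
proof -
  have e: "norm (u + \<i> *\<^sub>C v) = norm (u - \<i> *\<^sub>C v)" by (rule norm_add_ii_eq(1)[OF assms])
  have "2 *\<^sub>R u = (u + \<i> *\<^sub>C v) + (u - \<i> *\<^sub>C v)" by (simp add: scaleR_2)
  then have "norm (2 *\<^sub>R u) \<le> 2 * norm (u + \<i> *\<^sub>C v)"
    using norm_triangle_ineq[of "u + \<i> *\<^sub>C v" "u - \<i> *\<^sub>C v"] e by simp
  then show "norm u \<le> norm (u + \<i> *\<^sub>C v)" by simp
  have "2 *\<^sub>R (\<i> *\<^sub>C v) = (u + \<i> *\<^sub>C v) - (u - \<i> *\<^sub>C v)" by (simp add: scaleR_2)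
  then have "norm (2 *\<^sub>R (\<i> *\<^sub>C v)) \<le> 2 * norm (u + \<i> *\<^sub>C v)"
    using norm_triangle_ineq4[of "u + \<i> *\<^sub>C v" "u - \<i> *\<^sub>C v"] e by simp
  then show "norm v \<le> norm (u + \<i> *\<^sub>C v)" by (simp add: norm_scaleC)
qed

end

section \<open>Polynomials in an operator\<close>

lemma poly_op_eq: "degree p \<le> n \<Longrightarrow> poly_op p T x = (\<Sum>i\<le>n. coeff p i *\<^sub>R (T ^^ i) x)"
  unfolding poly_op_def by (rule sum.mono_neutral_left) (auto simp: coeff_eq_0)

lemma poly_op_0 [simp]: "poly_op 0 T x = 0"
  by (simp add: poly_op_def)

lemma poly_op_pCons:
  assumes "linear T"
  shows "poly_op (pCons a p) T x = a *\<^sub>R x + T (poly_op p T x)"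
proof -
  have "poly_op (pCons a p) T x = (\<Sum>i\<le>Suc (degree p). coeff (pCons a p) i *\<^sub>R (T ^^ i) x)"
    by (rule poly_op_eq) (simp add: degree_pCons_le)
  also have "\<dots> = a *\<^sub>R x + (\<Sum>i\<le>degree p. coeff p i *\<^sub>R (T ^^ Suc i) x)"
    by (simp add: sum.atMost_Suc_shift del: sum.atMost_Suc)
  also have "(\<Sum>i\<le>degree p. coeff p i *\<^sub>R (T ^^ Suc i) x) = T (poly_op p T x)"
    using assms by (simp add: poly_op_def linear_sum linear_scale)
  finally show ?thesis .
qed

lemma poly_op_add: "linear T \<Longrightarrow> poly_op (p + q) T x = poly_op p T x + poly_op q T x"
  by (induction p q rule: poly_induct2) (simp_all add: poly_op_pCons scaleR_add_left linear_add)

lemma poly_op_smult: "linear T \<Longrightarrow> poly_op (smult c p) T x = c *\<^sub>R poly_op p T x"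
  by (induction p) (simp_all add: poly_op_pCons scaleR_add_right linear_scale)

lemma poly_op_diff: "linear T \<Longrightarrow> poly_op (p - q) T x = poly_op p T x - poly_op q T x"
  using poly_op_add[of T p "smult (-1) q" x] using poly_op_smult[of T "-1" q x] by simp

lemma poly_op_linear_arg: "linear T \<Longrightarrow> linear (poly_op p T)"
  by (induction p) (auto simp: poly_op_pCons linear_iff scaleR_add_right)

lemma poly_op_mult: "linear T \<Longrightarrow> poly_op (p * q) T x = poly_op p T (poly_op q T x)"
  by (induction p) (simp_all add: poly_op_pCons mult_pCons_left poly_op_add poly_op_smult)

lemma poly_op_commute:
  assumes "linear T" "linear S" "\<And>x. S (T x) = U (S x)" "linear U"
  shows "S (poly_op p T x) = poly_op p U (S x)"
  by (induction p) (simp_all add: poly_op_pCons assms linear_add linear_scale linear_0)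

lemma poly_op_pcompose:
  assumes "linear T"
  shows "poly_op (pcompose p q) T x = poly_op p (poly_op q T) x"
  by (induction p)
    (simp_all add: assms poly_op_pCons pcompose_pCons poly_op_add poly_op_mult poly_op_linear_arg linear_0)

lemma linear_funpow: "linear (T::'a::real_vector \<Rightarrow> 'a) \<Longrightarrow> linear (T ^^ n)"
  by (induction n) (auto simp: linear_iff)

lemma poly_op_X: "linear T \<Longrightarrow> poly_op [:0, 1:] T x = T x"
  by (simp add: poly_op_pCons linear_add linear_0)

lemma poly_op_const: "linear T \<Longrightarrow> poly_op [:c:] T x = c *\<^sub>R x"
  by (simp add: poly_op_pCons linear_0)

lemma poly_op_scaled: "linear T \<Longrightarrow> poly_op p (\<lambda>x. r *\<^sub>R T x) x = (\<Sum>i\<le>degree p. (coeff p i * r ^ i) *\<^sub>R (T ^^ i) x)"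
proof -
  assume T: "linear T"
  have "((\<lambda>x. r *\<^sub>R T x) ^^ i) x = r ^ i *\<^sub>R (T ^^ i) x" for i
    using T by (induction i) (simp_all add: linear_scale)
  then show ?thesis by (simp add: poly_op_def)
qed

definition cpoly_op :: "complex poly \<Rightarrow> ('e::complex_banach \<Rightarrow> 'e) \<Rightarrow> 'e \<Rightarrow> 'e" where
  "cpoly_op p T x = (\<Sum>i\<le>degree p. coeff p i *\<^sub>C (T ^^ i) x)"

definition clinear_op :: "('e::complex_banach \<Rightarrow> 'e) \<Rightarrow> bool" where
  "clinear_op T \<longleftrightarrow> linear T \<and> (\<forall>c x. T (c *\<^sub>C x) = c *\<^sub>C T x)"

lemma cpoly_op_eq: "degree p \<le> n \<Longrightarrow> cpoly_op p T x = (\<Sum>i\<le>n. coeff p i *\<^sub>C (T ^^ i) x)"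
  unfolding cpoly_op_def by (rule sum.mono_neutral_left) (auto simp: coeff_eq_0)

lemma cpoly_op_0 [simp]: "cpoly_op 0 T x = 0"
  by (simp add: cpoly_op_def)

lemma cpoly_op_pCons:
  assumes "clinear_op T"
  shows "cpoly_op (pCons a p) T x = a *\<^sub>C x + T (cpoly_op p T x)"
proof -
  have "cpoly_op (pCons a p) T x = (\<Sum>i\<le>Suc (degree p). coeff (pCons a p) i *\<^sub>C (T ^^ i) x)"
    by (rule cpoly_op_eq) (simp add: degree_pCons_le)
  also have "\<dots> = a *\<^sub>C x + (\<Sum>i\<le>degree p. coeff p i *\<^sub>C (T ^^ Suc i) x)"
    by (simp add: sum.atMost_Suc_shift del: sum.atMost_Suc)
  also have "(\<Sum>i\<le>degree p. coeff p i *\<^sub>C (T ^^ Suc i) x) = T (cpoly_op p T x)"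
    using assms by (simp add: cpoly_op_def linear_sum clinear_op_def)
  finally show ?thesis .
qed

lemma cpoly_op_add: "clinear_op T \<Longrightarrow> cpoly_op (p + q) T x = cpoly_op p T x + cpoly_op q T x"
  by (induction p q rule: poly_induct2)
    (simp_all add: cpoly_op_pCons scaleC_add_left clinear_op_def linear_add)

lemma cpoly_op_smult: "clinear_op T \<Longrightarrow> cpoly_op (smult c p) T x = c *\<^sub>C cpoly_op p T x"
  by (induction p) (simp_all add: cpoly_op_pCons scaleC_add_right scaleC_scaleC clinear_op_def)

lemma cpoly_op_monom: "cpoly_op (monom c n) T x = c *\<^sub>C (T ^^ n) x"
proof -
  have "cpoly_op (monom c n) T x = (\<Sum>i\<le>n. coeff (monom c n) i *\<^sub>C (T ^^ i) x)"
    by (rule cpoly_op_eq) (simp add: degree_monom_le)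
  also have "\<dots> = (\<Sum>i\<le>n. if i = n then c *\<^sub>C (T ^^ n) x else 0)"
    by (rule sum.cong) auto
  finally show ?thesis by simp
qed

text \<open>Cauchy's estimate for the Taylor coefficients at \<open>0\<close>.\<close>

lemma coeff_le_unit_circle:
  fixes c :: "complex poly"
  assumes "\<And>z. cmod z = 1 \<Longrightarrow> cmod (poly c z) \<le> s"
  shows "cmod (coeff c j) \<le> s"
proof -
  have "deriv (poly p) = poly (pderiv p)" for p :: "complex poly"
    by (auto intro!: DERIV_imp_deriv poly_DERIV)
  then have d: "(deriv ^^ j) (poly c) = poly ((pderiv ^^ j) c)"
    by (induction j) simp_all
  have "cmod ((deriv ^^ j) (poly c) 0) \<le> fact j * s / 1 ^ j"
    by (rule Cauchy_inequality)
      (auto intro!: holomorphic_intros continuous_intros assms)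
  moreover have "(deriv ^^ j) (poly c) 0 = fact j * coeff c j"
    unfolding d by (simp add: poly_0_coeff_0 coeff_higher_pderiv pochhammer_fact)
  ultimately show ?thesis by (simp add: norm_mult)
qed

section \<open>Norm bounds for polynomials in a self-adjoint operator\<close>

context hilbert_module
begin

abbreviation selfadj :: "('e \<Rightarrow> 'e) \<Rightarrow> bool" where
  "selfadj T \<equiv> is_adjoint E T T"

lemma selfadj_linear: "selfadj T \<Longrightarrow> linear T"
  using adjoint_bounded_linear bounded_linear.linear by blast

lemma selfadj_poly_op: "selfadj T \<Longrightarrow> selfadj (poly_op p T)"
proof (induction p)
  case 0
  then show ?case by (simp add: adjoint_zero[unfolded is_adjoint_def] is_adjoint_def)
next
  case (pCons a p)
  have l: "linear T" using pCons.prems by (rule selfadj_linear)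
  have c: "T (poly_op p T x) = poly_op p T (T x)" for x
    by (rule poly_op_commute) (auto simp: l)
  show ?case
    using pCons.IH[OF pCons.prems] pCons.prems l c
    by (simp add: is_adjoint_def poly_op_pCons ip_add_left ip_add_right ip_scaleR_left ip_scaleR_right)
qed

text \<open>
  For a strict contraction \<open>A\<close>, the equation \<open>Q\<^sup>2 = 1 - A\<^sup>2\<close> becomes, for \<open>y = 1 - Q\<close>, the
  fixed point equation \<open>y = (A\<^sup>2 + y\<^sup>2) / 2\<close>, which is contractive on a small ball.
\<close>

lemma selfadj_complement_root:
  assumes A: "selfadj A" and le: "\<And>x. norm (A x) \<le> \<theta> * norm x" and \<theta>: "0 \<le> \<theta>" "\<theta> < 1"
  obtains Q where "selfadj Q" "\<And>x. Q (Q x) = x - A (A x)" "\<And>x. A (Q x) = Q (A x)"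
proof -
  have bA: "bounded_linear A" using A by (rule adjoint_bounded_linear)
  define a where "a = Blinfun A"
  have a: "blinfun_apply a x = A x" for x by (simp add: a_def bounded_linear_Blinfun_apply[OF bA])
  have na: "norm a \<le> \<theta>" using le \<theta> by (intro norm_blinfun_bound) (auto simp: a)
  define S where "S = {y :: 'e \<Rightarrow>\<^sub>L 'e. norm y \<le> \<theta> \<and>
    (\<forall>x z. ip E (blinfun_apply y x) z = ip E x (blinfun_apply y z)) \<and>
    (\<forall>x. blinfun_apply y (A x) = A (blinfun_apply y x))}"
  define f :: "('e \<Rightarrow>\<^sub>L 'e) \<Rightarrow> 'e \<Rightarrow>\<^sub>L 'e" where "f y = (1/2) *\<^sub>R ((a o\<^sub>L a) + (y o\<^sub>L y))" for y
  have "complete S"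
  proof -
    have "closed (\<Inter>x. \<Inter>z. {y. ip E (blinfun_apply y x) z = ip E x (blinfun_apply y z)})"
      by (intro closed_INT ballI closed_Collect_eq bounded_bilinear.continuous_on[OF bounded_bilinear_ip] continuous_intros)
    moreover have "closed (\<Inter>x. {y. blinfun_apply y (A x) = A (blinfun_apply y x)})"
      by (intro closed_INT ballI closed_Collect_eq continuous_intros bounded_linear.continuous_on[OF bA])
    moreover have "closed {y :: 'e \<Rightarrow>\<^sub>L 'e. norm y \<le> \<theta>}"
      by (intro closed_Collect_le continuous_intros)
    moreover have "S = {y :: 'e \<Rightarrow>\<^sub>L 'e. norm y \<le> \<theta>} \<inter> (\<Inter>x. \<Inter>z. {y. ip E (blinfun_apply y x) z = ip E x (blinfun_apply y z)})
        \<inter> (\<Inter>x. {y. blinfun_apply y (A x) = A (blinfun_apply y x)})"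
      by (auto simp: S_def)
    ultimately have "closed S" by auto
    then show ?thesis by (simp add: complete_eq_closed)
  qed
  moreover have "S \<noteq> {}"
  proof -
    have "0 \<in> S" using \<theta> linear_0[OF selfadj_linear[OF A]] by (simp add: S_def)
    then show ?thesis by blast
  qed
  moreover have "f ` S \<subseteq> S"
  proof (rule image_subsetI)
    fix y assume y: "y \<in> S"
    have "norm (a o\<^sub>L a) \<le> \<theta> * \<theta>" "norm (y o\<^sub>L y) \<le> \<theta> * \<theta>"
      using na y \<theta> by (auto simp: S_def intro!: order_trans[OF norm_blinfun_compose] mult_mono)
    then have "norm ((a o\<^sub>L a) + (y o\<^sub>L y)) \<le> \<theta> * \<theta> + \<theta> * \<theta>"
      using norm_triangle_ineq[of "a o\<^sub>L a" "y o\<^sub>L y"] by linarith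
    also have "\<dots> \<le> 2 * \<theta>" using \<theta> mult_left_mono[of \<theta> 1 \<theta>] by simp
    finally have "norm (f y) \<le> \<theta>" by (simp add: f_def)
    moreover have "A (r *\<^sub>R (u + v)) = r *\<^sub>R (A u + A v)" for r u v
      using selfadj_linear[OF A] by (simp add: linear_add linear_scale)
    ultimately show "f y \<in> S"
      using y is_adjointD[OF A]
      by (simp add: S_def f_def a blinfun.bilinear_simps ip_scaleR_left ip_scaleR_right ip_add_left ip_add_right)
  qed
  moreover have "dist (f x) (f y) \<le> \<theta> * dist x y" if xy: "x \<in> S" "y \<in> S" for x y
  proof -
    have "(x o\<^sub>L x) - (y o\<^sub>L y) = (x o\<^sub>L (x - y)) + ((x - y) o\<^sub>L y)"
      by (rule blinfun_eqI) (simp add: blinfun.bilinear_simps)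
    moreover have "norm (x o\<^sub>L (x - y)) \<le> \<theta> * norm (x - y)" "norm ((x - y) o\<^sub>L y) \<le> norm (x - y) * \<theta>"
      using xy \<theta> by (auto simp: S_def intro!: order_trans[OF norm_blinfun_compose] mult_mono)
    ultimately have "norm ((x o\<^sub>L x) - (y o\<^sub>L y)) \<le> 2 * (\<theta> * norm (x - y))"
      using norm_triangle_ineq[of "x o\<^sub>L (x - y)" "(x - y) o\<^sub>L y"] by (simp add: mult.commute)
    moreover have "f x - f y = (1/2) *\<^sub>R ((x o\<^sub>L x) - (y o\<^sub>L y))"
      by (simp add: f_def scaleR_diff_right[symmetric])
    ultimately show "dist (f x) (f y) \<le> \<theta> * dist x y" by (simp add: dist_norm)
  qed
  ultimately have "\<exists>!y. y \<in> S \<and> f y = y" using \<theta> by (intro Banach_fix) auto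
  then obtain y where y: "y \<in> S" "f y = y" by blast
  have yy: "2 *\<^sub>R blinfun_apply y x = A (A x) + blinfun_apply y (blinfun_apply y x)" for x
    using arg_cong[OF y(2), of "\<lambda>g. 2 *\<^sub>R blinfun_apply g x"]
    by (simp add: f_def a blinfun.bilinear_simps)
  show ?thesis
  proof (rule that[of "\<lambda>x. x - blinfun_apply y x"])
    show "selfadj (\<lambda>x. x - blinfun_apply y x)" using y(1) by (simp add: S_def is_adjoint_def ip_diff_left ip_diff_right)
    show "x - blinfun_apply y x - blinfun_apply y (x - blinfun_apply y x) = x - A (A x)" for x
      using yy[of x] by (simp add: blinfun.bilinear_simps scaleR_2 algebra_simps)
    show "A (x - blinfun_apply y x) = A x - blinfun_apply y (A x)" for x
      using y(1) selfadj_linear[OF A] by (simp add: S_def linear_diff)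
  qed
qed

text \<open>
  \<open>W = A + i(1 - A\<^sup>2)\<^sup>1\<^sup>/\<^sup>2\<close> is an isometry and \<open>2 W A = W\<^sup>2 + 1\<close>, just as \<open>2 z cos \<phi> = z\<^sup>2 + 1\<close> for
  \<open>z = e\<^sup>i\<^sup>\<phi>\<close>. So \<open>W\<^sup>n q(A)\<close> is a polynomial in \<open>W\<close> whose coefficients Cauchy's estimate controls.
  The factor \<open>2n + 1\<close> will be removed by passing to high powers of \<open>q\<close>.
\<close>

lemma norm_poly_op_le_degree:
  assumes A: "selfadj A" and le: "\<And>x. norm (A x) \<le> \<theta> * norm x" and \<theta>: "0 \<le> \<theta>" "\<theta> < 1"
    and n: "degree q \<le> n" and s: "\<And>t. \<bar>t\<bar> \<le> 1 \<Longrightarrow> \<bar>poly q t\<bar> \<le> s"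
  shows "norm (poly_op q A x) \<le> (2 * real n + 1) * s * norm x"
proof -
  obtain Q where Q: "selfadj Q" "\<And>x. Q (Q x) = x - A (A x)" "\<And>x. A (Q x) = Q (A x)"
    using selfadj_complement_root[OF A le \<theta>] by metis
  note lA = selfadj_linear[OF A] and lQ = selfadj_linear[OF Q(1)]
  define W where "W x = A x + \<i> *\<^sub>C Q x" for x
  have W: "clinear_op W"
    unfolding clinear_op_def linear_iff W_def
    by (auto simp: linear_add[OF lA] linear_add[OF lQ] linear_scale[OF lA] linear_scale[OF lQ]
        scaleC_add_right scaleC_scaleR scaleR_add_right adjoint_scaleC[OF A] adjoint_scaleC[OF Q(1)]
        scaleC_scaleC mult.commute)
  have lW: "linear W" using W by (simp add: clinear_op_def)
  have nW: "norm (W x) = norm x" for x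
  proof -
    have "ip E (A x) (Q x) = ip E (Q x) (A x)" by (simp add: is_adjointD[OF A] is_adjointD[OF Q(1)] Q)
    then have "ip E (W x) (W x) = ip E (A x) (A x) + ip E (Q x) (Q x)"
      unfolding W_def by (rule norm_add_ii_eq(2))
    also have "\<dots> = ip E x x"
      by (simp add: is_adjointD[OF A] is_adjointD[OF Q(1)] Q ip_diff_right)
    finally show ?thesis by (simp add: norm_eq_sqrt_ip)
  qed
  have nWn: "norm ((W ^^ k) x) = norm x" for k x by (induction k) (simp_all add: nW)
  have WA: "W (A x) = (1/2) *\<^sub>R (W (W x) + x)" for x
  proof -
    have "W (W x) = A (A x) + \<i> *\<^sub>C Q (A x) + \<i> *\<^sub>C Q (A x) - Q (Q x)"
      by (simp add: W_def linear_add[OF lA] linear_add[OF lQ] adjoint_scaleC[OF A] adjoint_scaleC[OF Q(1)]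
          scaleC_add_right scaleC_ii_ii Q(3))
    then have "W (W x) + x = 2 *\<^sub>R W (A x)" by (simp add: W_def Q(2) scaleR_2 algebra_simps)
    then show ?thesis by simp
  qed
  have AW: "A (W x) = W (A x)" for x
    by (simp add: W_def linear_add[OF lA] adjoint_scaleC[OF A] Q(3))
  (* c(z) = z^m p((z + 1/z) / 2), which has degree at most 2 m *)
  have ex: "\<exists>c. degree c \<le> 2 * m \<and> (\<forall>x. (W ^^ m) (poly_op p A x) = cpoly_op c W x) \<and>
      (\<forall>z. cmod z = 1 \<longrightarrow> poly c z = z ^ m * of_real (poly p (Re z)))" if "degree p \<le> m" for m p
    using that
  proof (induction p arbitrary: m)
    case 0
    show ?case using linear_0[OF linear_funpow[OF lW]] by (intro exI[of _ 0]) auto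
  next
    case (pCons a p)
    show ?case
    proof (cases m)
      case 0
      then have p: "p = 0" using pCons.prems by (auto simp: degree_pCons_eq split: if_splits)
      show ?thesis
        by (rule exI[of _ "monom (of_real a) m"])
          (simp add: degree_monom_eq monom_0 p 0 poly_op_pCons[OF lA] linear_0[OF lA] cpoly_op_pCons[OF W] scaleC_of_real linear_0[OF lW])
    next
      case (Suc k)
      have "degree p \<le> k" using pCons.prems Suc by (auto split: if_splits)
      then obtain c where c: "degree c \<le> 2 * k" "\<And>x. (W ^^ k) (poly_op p A x) = cpoly_op c W x"
        "\<And>z. cmod z = 1 \<Longrightarrow> poly c z = z ^ k * of_real (poly p (Re z))"
        using pCons.IH by blast
      define c' where "c' = monom (of_real a) m + (smult (1/2) c + pCons 0 (pCons 0 (smult (1/2) c)))"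
      have "degree (pCons 0 (pCons 0 (smult (1/2) c))) \<le> 2 * m"
        using degree_pCons_le[of 0 "pCons 0 (smult (1/2) c)"] degree_pCons_le[of 0 "smult (1/2) c"] c(1) Suc
        by (simp add: degree_pCons_le)
      then have "degree c' \<le> 2 * m"
        unfolding c'_def using c(1) Suc by (intro degree_add_le) (auto intro: order_trans[OF degree_monom_le])
      moreover have "(W ^^ m) (poly_op (pCons a p) A x) = cpoly_op c' W x" for x
      proof -
        have "(W ^^ m) (poly_op (pCons a p) A x) = a *\<^sub>R (W ^^ m) x + (W ^^ k) (W (A (poly_op p A x)))"
          using linear_funpow[OF lW, of m]
          by (simp add: poly_op_pCons[OF lA] linear_add linear_scale) (simp add: Suc funpow_swap1)
        also have "(W ^^ k) (W (A (poly_op p A x)))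
            = (1/2) *\<^sub>R (W (W ((W ^^ k) (poly_op p A x))) + (W ^^ k) (poly_op p A x))"
          using linear_funpow[OF lW, of k] by (simp add: WA linear_add linear_scale funpow_swap1)
        also have "a *\<^sub>R (W ^^ m) x + \<dots> = cpoly_op c' W x"
          using W by (simp add: c'_def cpoly_op_add cpoly_op_smult cpoly_op_pCons cpoly_op_monom c(2)
              scaleC_of_real[symmetric] scaleC_add_right clinear_op_def)
        finally show ?thesis .
      qed
      moreover have "poly c' z = z ^ m * of_real (poly (pCons a p) (Re z))" if z: "cmod z = 1" for z
      proof -
        have "z * cnj z = 1" using z by (simp add: complex_norm_square[symmetric])
        moreover have "of_real (Re z) = (z + cnj z) / 2" by (simp add: complex_add_cnj)
        ultimately have zz: "z * of_real (Re z) = (z * z + 1) / 2" by (simp add: field_simps)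
        have "poly c' z = of_real a * z ^ m + (z * z + 1) / 2 * poly c z"
          by (simp add: c'_def poly_monom field_simps)
        also have "\<dots> = z ^ m * of_real (poly (pCons a p) (Re z))"
          unfolding zz[symmetric] c(3)[OF z] by (simp add: Suc algebra_simps)
        finally show ?thesis .
      qed
      ultimately show ?thesis by blast
    qed
  qed
  obtain c where c: "degree c \<le> 2 * n" "\<And>x. (W ^^ n) (poly_op q A x) = cpoly_op c W x"
      "\<And>z. cmod z = 1 \<Longrightarrow> poly c z = z ^ n * of_real (poly q (Re z))"
    using ex[OF n] by blast
  have "cmod (poly c z) \<le> s" if z: "cmod z = 1" for z
  proof -
    have "\<bar>Re z\<bar> \<le> 1" using abs_Re_le_cmod[of z] z by simp
    then show ?thesis using s z by (simp add: c(3) norm_mult norm_power)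
  qed
  then have cs: "cmod (coeff c j) \<le> s" for j by (rule coeff_le_unit_circle)
  have "norm (poly_op q A x) = norm (cpoly_op c W x)" using nWn[of n "poly_op q A x"] c(2) by simp
  also have "\<dots> \<le> (\<Sum>i\<le>2*n. norm (coeff c i *\<^sub>C (W ^^ i) x))"
    unfolding cpoly_op_eq[OF c(1)] by (rule norm_sum)
  also have "\<dots> \<le> (\<Sum>i\<le>2*n. s * norm x)"
    by (intro sum_mono) (simp add: norm_scaleC nWn cs mult_right_mono)
  finally show ?thesis by (simp add: algebra_simps)
qed

lemma onorm_sq_le:
  assumes "selfadj T"
  shows "(onorm T)\<^sup>2 \<le> 4 * onorm (\<lambda>x. T (T x))"
proof -
  have b: "bounded_linear T" and b2: "bounded_linear (\<lambda>x. T (T x))"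
    using assms adjoint_comp[OF assms assms] by (auto intro: adjoint_bounded_linear)
  have "norm (T x) \<le> sqrt (4 * onorm (\<lambda>x. T (T x))) * norm x" for x
  proof (rule power2_le_imp_le)
    have "(norm (T x))\<^sup>2 \<le> 4 * norm x * norm (T (T x))" by (rule norm_sq_le_adjoint[OF assms])
    also have "\<dots> \<le> 4 * norm x * (onorm (\<lambda>x. T (T x)) * norm x)"
      by (intro mult_left_mono onorm[OF b2]) auto
    finally show "(norm (T x))\<^sup>2 \<le> (sqrt (4 * onorm (\<lambda>x. T (T x))) * norm x)\<^sup>2"
      using onorm_pos_le[OF b2] by (simp add: power_mult_distrib power2_eq_square mult_ac)
  qed (use onorm_pos_le[OF b2] in auto)
  then have "onorm T \<le> sqrt (4 * onorm (\<lambda>x. T (T x)))"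
    using onorm_pos_le[OF b2] by (intro onorm_bound) auto
  then have "(onorm T)\<^sup>2 \<le> (sqrt (4 * onorm (\<lambda>x. T (T x))))\<^sup>2"
    using onorm_pos_le[OF b] by (intro power_mono) auto
  then show ?thesis using onorm_pos_le[OF b2] by simp
qed

text \<open>
  Since \<open>\<parallel>q(A)\<parallel>\<^sup>2 \<le> 4 \<parallel>q(A)\<^sup>2\<parallel>\<close>, the previous bound for \<open>q\<^sup>N\<close> with \<open>N = 2\<^sup>k\<close> gives
  \<open>(\<parallel>q(A)\<parallel> / 4 s)\<^sup>N \<le> 2 N deg q + 1\<close>. Linear growth in \<open>N\<close> forces the base to be at most \<open>1\<close>.
\<close>

lemma norm_poly_op_le_contraction:
  assumes A: "selfadj A" and le: "\<And>x. norm (A x) \<le> \<theta> * norm x" and \<theta>: "0 \<le> \<theta>" "\<theta> < 1"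
    and s: "\<And>t. \<bar>t\<bar> \<le> 1 \<Longrightarrow> \<bar>poly q t\<bar> \<le> s"
  shows "norm (poly_op q A x) \<le> 4 * s * norm x"
proof -
  note lA = selfadj_linear[OF A]
  define N where "N p = onorm (poly_op p A)" for p
  have bl: "bounded_linear (poly_op p A)" for p
    by (rule adjoint_bounded_linear[OF selfadj_poly_op[OF A]])
  have N0: "0 \<le> N p" for p unfolding N_def by (rule onorm_pos_le[OF bl])
  have sq: "(N p)\<^sup>2 \<le> 4 * N (p ^ 2)" for p
  proof -
    have "poly_op (p ^ 2) A = (\<lambda>x. poly_op p A (poly_op p A x))"
      by (simp add: fun_eq_iff power2_eq_square poly_op_mult[OF lA])
    then show ?thesis using onorm_sq_le[OF selfadj_poly_op[OF A], of p] by (simp add: N_def)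
  qed
  have pow: "4 * N q ^ (2 ^ k) \<le> 4 ^ (2 ^ k) * N (q ^ (2 ^ k))" for k
  proof (induction k)
    case (Suc k)
    have "4 * (4 * N q ^ (2 ^ Suc k)) = (4 * N q ^ (2 ^ k))\<^sup>2"
      by (simp add: power_mult_distrib power_mult[symmetric] mult.commute)
    also have "\<dots> \<le> (4 ^ (2 ^ k) * N (q ^ (2 ^ k)))\<^sup>2" using Suc N0 by (intro power_mono) auto
    also have "\<dots> \<le> (4 ^ (2 ^ k))\<^sup>2 * (4 * N ((q ^ (2 ^ k)) ^ 2))"
      unfolding power_mult_distrib by (intro mult_left_mono sq) auto
    also have "\<dots> = 4 * (4 ^ (2 ^ Suc k) * N (q ^ (2 ^ Suc k)))"
      by (simp add: power_mult[symmetric] mult.commute mult.left_commute)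
    finally show ?case by (simp add: mult.commute)
  qed simp
  have main: "N q \<le> 4 * r" if r: "r > s" for r
  proof (rule ccontr)
    assume "\<not> ?thesis"
    then have gt: "N q > 4 * r" by simp
    have r0: "r > 0" using r s[of 0] abs_ge_zero[of "poly q 0"] by linarith
    define \<rho> where "\<rho> = N q / (4 * r)"
    have \<rho>: "\<rho> > 1" using gt r0 by (simp add: \<rho>_def)
    define d where "d = degree q"
    have bound: "\<rho> ^ (2 ^ k) \<le> 2 * real (d * 2 ^ k) + 1" for k
    proof -
      have "N (q ^ (2 ^ k)) \<le> (2 * real (d * 2 ^ k) + 1) * r ^ (2 ^ k)"
        unfolding N_def
      proof (rule onorm_bound)
        fix x
        have "\<bar>poly (q ^ 2 ^ k) t\<bar> \<le> r ^ 2 ^ k" if "\<bar>t\<bar> \<le> 1" for t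
        proof -
          have "\<bar>poly q t\<bar> \<le> r" using s[OF that] r by simp
          then show ?thesis by (simp add: poly_power power_abs power_mono)
        qed
        then show "norm (poly_op (q ^ 2 ^ k) A x) \<le> (2 * real (d * 2 ^ k) + 1) * r ^ 2 ^ k * norm x"
          by (intro norm_poly_op_le_degree[OF A le \<theta>]) (auto simp: d_def degree_power_le)
      qed (use r0 in auto)
      then have "4 * N q ^ (2 ^ k) \<le> 4 ^ (2 ^ k) * ((2 * real (d * 2 ^ k) + 1) * r ^ (2 ^ k))"
        using pow[of k] by (meson mult_left_mono order_trans zero_le_numeral zero_le_power)
      then have "N q ^ (2 ^ k) \<le> (2 * real (d * 2 ^ k) + 1) * (4 * r) ^ (2 ^ k)"
        using zero_le_power[OF N0, of q "2^k"] by (simp add: power_mult_distrib mult_ac)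
      then show ?thesis using r0 by (simp add: \<rho>_def power_divide divide_le_eq)
    qed
    have "(\<lambda>n. of_nat n / \<rho> ^ n) \<longlonglongrightarrow> 0" using \<rho> by (intro lim_n_over_pown) auto
    then have "\<forall>\<^sub>F n in sequentially. real n / \<rho> ^ n < 1 / (2 * d + 2)"
      by (rule order_tendstoD) simp
    then obtain k where k: "\<And>n. n \<ge> k \<Longrightarrow> real n / \<rho> ^ n < 1 / (2 * d + 2)"
      unfolding eventually_sequentially by blast
    have "k \<le> 2 ^ k" using less_exp[of k] by simp
    then have "real (2 ^ k) / \<rho> ^ (2 ^ k) < 1 / (2 * d + 2)" by (rule k)
    then have "real (2 ^ k) * (2 * d + 2) < \<rho> ^ (2 ^ k)" using \<rho> by (simp add: field_simps)
    moreover have "2 * real (d * 2 ^ k) + 1 \<le> real (2 ^ k) * (2 * d + 2)"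
      using one_le_power[of "2::real" k] by (simp add: algebra_simps del: one_le_power)
    ultimately show False using bound[of k] by linarith
  qed
  have "N q \<le> 4 * s"
  proof (rule field_le_epsilon)
    fix e :: real assume "e > 0"
    then show "N q \<le> 4 * s + e" using main[of "s + e / 4"] by simp
  qed
  then show ?thesis
    using onorm[OF bl, of q x] mult_right_mono[of "N q" "4 * s" "norm x"] by (simp add: N_def)
qed

text \<open>
  The interval \<open>{l..u}\<close> carries the functional calculus of \<open>P\<close>. It contains the spectrum, and the
  factor \<open>4\<close> is the constant of \<open>norm_ip_le\<close>. An inequality for polynomials is all that the
  continuous calculus and its transport from operator to operator require.
\<close>

definition spectral_bound :: "('e \<Rightarrow> 'e) \<Rightarrow> real \<Rightarrow> real \<Rightarrow> bool" where
  "spectral_bound P l u \<longleftrightarrow> selfadj P \<and> (\<forall>p s. (\<forall>t\<in>{l..u}. \<bar>poly p t\<bar> \<le> s) \<longrightarrow>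
     (\<forall>x. norm (poly_op p P x) \<le> 4 * s * norm x))"

lemma spectral_boundD:
  "spectral_bound P l u \<Longrightarrow> (\<And>t. t \<in> {l..u} \<Longrightarrow> \<bar>poly p t\<bar> \<le> s) \<Longrightarrow> norm (poly_op p P x) \<le> 4 * s * norm x"
  unfolding spectral_bound_def by blast

lemma spectral_bound_selfadj: "spectral_bound P l u \<Longrightarrow> selfadj P"
  unfolding spectral_bound_def by blast

lemma spectral_bound_mono: "spectral_bound P l u \<Longrightarrow> l' \<le> l \<Longrightarrow> u \<le> u' \<Longrightarrow> spectral_bound P l' u'"
  unfolding spectral_bound_def by (meson atLeastAtMost_iff order_trans)

theorem spectral_bound_norm:
  assumes H: "selfadj H" and le: "\<And>x. norm (H x) \<le> M * norm x" and M: "M > 0"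
  shows "spectral_bound H (- M) M"
  unfolding spectral_bound_def
proof (intro conjI H allI impI)
  fix p s x assume s: "\<forall>t\<in>{- M..M}. \<bar>poly p t\<bar> \<le> s"
  note lH = selfadj_linear[OF H]
  (* Shrinking H by a factor below 1 makes H / M a strict contraction, as unitary dilation requires. *)
  have small: "norm (poly_op p (\<lambda>x. \<theta> *\<^sub>R H x) x) \<le> 4 * s * norm x" if \<theta>: "0 < \<theta>" "\<theta> < 1" for \<theta>
  proof -
    define A where "A x = (\<theta> / M) *\<^sub>R H x" for x
    have A: "selfadj A" unfolding A_def by (rule adjoint_scaleR[OF H])
    have leA: "norm (A x) \<le> \<theta> * norm x" for x
      using mult_left_mono[OF le[of x], of "\<theta> / M"] \<theta> M by (simp add: A_def)
    have "norm (poly_op (pcompose p [:0, M:]) A x) \<le> 4 * s * norm x"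
    proof (rule norm_poly_op_le_contraction[OF A leA])
      fix t :: real assume "\<bar>t\<bar> \<le> 1"
      then have "M * t \<le> M * 1" "M * (- 1) \<le> M * t" using M by (intro mult_left_mono; simp)+
      then have "M * t \<in> {-M..M}" by simp
      then show "\<bar>poly (pcompose p [:0, M:]) t\<bar> \<le> s" using s by (auto simp: poly_pcompose mult.commute)
    qed (use \<theta> in auto)
    moreover have "poly_op [:0, M:] A = (\<lambda>x. \<theta> *\<^sub>R H x)"
      using M by (auto simp: poly_op_pCons[OF selfadj_linear[OF A]] linear_0[OF selfadj_linear[OF A]] A_def
          linear_scale[OF selfadj_linear[OF A], unfolded A_def] linear_scale[OF lH] linear_0[OF lH])
    ultimately show ?thesis by (simp add: poly_op_pcompose[OF selfadj_linear[OF A]])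
  qed
  have "((\<lambda>\<theta>. poly_op p (\<lambda>x. \<theta> *\<^sub>R H x) x) \<longlongrightarrow> poly_op p (\<lambda>x. 1 *\<^sub>R H x) x) (at_left 1)"
    unfolding poly_op_scaled[OF lH] by (intro tendsto_intros)
  then have "((\<lambda>\<theta>. norm (poly_op p (\<lambda>x. \<theta> *\<^sub>R H x) x)) \<longlongrightarrow> norm (poly_op p H x)) (at_left 1)"
    by (auto intro: tendsto_norm)
  moreover have "\<forall>\<^sub>F \<theta> in at_left 1. norm (poly_op p (\<lambda>x. \<theta> *\<^sub>R H x) x) \<le> 4 * s * norm x"
    using eventually_at_left[of 0 "1::real"] small by (auto intro!: exI[of _ 0])
  ultimately show "norm (poly_op p H x) \<le> 4 * s * norm x"
    by (intro tendsto_upperbound) auto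
qed

lemma spectral_bound_onorm:
  assumes H: "selfadj H" and M: "onorm H \<le> M" "M > 0"
  shows "spectral_bound H (- M) M"
proof (rule spectral_bound_norm[OF H _ M(2)])
  fix x
  show "norm (H x) \<le> M * norm x"
    using onorm[OF adjoint_bounded_linear[OF H], of x] mult_right_mono[OF M(1), of "norm x"] by simp
qed

end

section \<open>Continuous functional calculus\<close>

lemma polynomial_approximation:
  assumes "continuous_on {l..u} (f::real \<Rightarrow> real)"
  shows "\<exists>p::nat \<Rightarrow> real poly. uniform_limit {l..u} (\<lambda>n. poly (p n)) f sequentially"
proof -
  obtain g where g: "uniform_limit {l..u} g f sequentially" "\<And>n. polynomial_function (g n)"
    using Stone_Weierstrass_uniform_limit[OF compact_Icc assms] by blast
  have "\<exists>p. g n = poly p" for n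
  proof -
    have "real_polynomial_function (g n)" using g(2) by (simp add: real_polynomial_function_eq)
    then obtain a m where "g n = (\<lambda>x. \<Sum>i\<le>m. a i * x ^ i)" using real_polynomial_function_imp_sum by blast
    then have "g n = poly (\<Sum>i\<le>m. monom (a i) i)" by (auto simp: poly_sum poly_monom)
    then show ?thesis by blast
  qed
  then obtain p where "\<And>n. g n = poly (p n)" by metis
  then have "g = (\<lambda>n. poly (p n))" by auto
  then show ?thesis using g(1) by metis
qed

definition poly_approx :: "real \<Rightarrow> real \<Rightarrow> (real \<Rightarrow> real) \<Rightarrow> nat \<Rightarrow> real poly" where
  "poly_approx l u f = (SOME p. uniform_limit {l..u} (\<lambda>n. poly (p n)) f sequentially)"

lemma poly_approx: "continuous_on {l..u} f \<Longrightarrow> uniform_limit {l..u} (\<lambda>n. poly (poly_approx l u f n)) f sequentially"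
  unfolding poly_approx_def using someI_ex[OF polynomial_approximation] by blast

text \<open>
  \<open>f(P)\<close> as a pointwise limit. For \<open>P\<close> with \<open>spectral_bound P l u\<close> and \<open>f\<close> continuous on \<open>{l..u}\<close>, it
  does not depend on the approximating polynomials.
\<close>

definition fcal :: "real \<Rightarrow> real \<Rightarrow> ('e::real_normed_vector \<Rightarrow> 'e) \<Rightarrow> (real \<Rightarrow> real) \<Rightarrow> 'e \<Rightarrow> 'e" where
  "fcal l u P f x = lim (\<lambda>n. poly_op (poly_approx l u f n) P x)"

context hilbert_module
begin

lemma spectral_bound_linear: "spectral_bound P l u \<Longrightarrow> linear P"
  by (rule selfadj_linear[OF spectral_bound_selfadj])

lemma fcal_convergent:
  assumes P: "spectral_bound P l u" and p: "uniform_limit {l..u} (\<lambda>n. poly (p n)) f sequentially"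
  shows "convergent (\<lambda>n. poly_op (p n) P x)"
proof -
  have "Cauchy (\<lambda>n. poly_op (p n) P x)"
  proof (rule Cauchy_if_le_mult[of _ "8 * norm x"])
    fix e :: real assume "e > 0"
    then obtain N where N: "\<And>n t. n \<ge> N \<Longrightarrow> t \<in> {l..u} \<Longrightarrow> dist (poly (p n) t) (f t) < e"
      using uniform_limitD[OF p] unfolding eventually_sequentially by blast
    have "norm (poly_op (p m) P x - poly_op (p n) P x) \<le> e * (8 * norm x)" if "m \<ge> N" "n \<ge> N" for m n
    proof -
      have "norm (poly_op (p m - p n) P x) \<le> 4 * (2 * e) * norm x"
      proof (rule spectral_boundD[OF P])
        fix t assume "t \<in> {l..u}"
        then show "\<bar>poly (p m - p n) t\<bar> \<le> 2 * e"
          using N[OF that(1)] N[OF that(2)] unfolding dist_real_def by (smt (verit, best) poly_diff)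
      qed
      then show ?thesis by (simp add: poly_op_diff[OF spectral_bound_linear[OF P]])
    qed
    then show "\<exists>N. \<forall>m\<ge>N. \<forall>n\<ge>N. norm (poly_op (p m) P x - poly_op (p n) P x) \<le> e * (8 * norm x)" by blast
  qed
  then show ?thesis by (rule Cauchy_convergent)
qed

lemma fcal_tendsto:
  assumes P: "spectral_bound P l u" and f: "continuous_on {l..u} f"
    and p: "uniform_limit {l..u} (\<lambda>n. poly (p n)) f sequentially"
  shows "(\<lambda>n. poly_op (p n) P x) \<longlonglongrightarrow> fcal l u P f x"
proof -
  let ?q = "poly_approx l u f"
  have q: "(\<lambda>n. poly_op (?q n) P x) \<longlonglongrightarrow> fcal l u P f x"
    unfolding fcal_def using fcal_convergent[OF P poly_approx[OF f]] by (simp add: convergent_LIMSEQ_iff)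
  have "(\<lambda>n. poly_op (p n) P x - poly_op (?q n) P x) \<longlonglongrightarrow> 0"
  proof (rule tendsto_if_le_mult[of _ _ "4 * norm x"])
    fix e :: real assume e: "e > 0"
    have "uniform_limit {l..u} (\<lambda>n t. poly (p n) t - poly (?q n) t) (\<lambda>t. f t - f t) sequentially"
      by (intro uniform_limit_minus p poly_approx[OF f])
    from uniform_limitD[OF this e] obtain N
      where N: "\<And>n t. n \<ge> N \<Longrightarrow> t \<in> {l..u} \<Longrightarrow> dist (poly (p n) t - poly (?q n) t) (f t - f t) < e"
      unfolding eventually_sequentially by blast
    have "norm (poly_op (p n - ?q n) P x) \<le> 4 * e * norm x" if "n \<ge> N" for n
      by (rule spectral_boundD[OF P]) (use N[OF that] in \<open>simp add: less_imp_le\<close>)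
    then show "\<exists>N. \<forall>n\<ge>N. norm (poly_op (p n) P x - poly_op (?q n) P x - 0) \<le> e * (4 * norm x)"
      by (auto simp: poly_op_diff[OF spectral_bound_linear[OF P]] mult_ac)
  qed
  from tendsto_add[OF this q] show ?thesis by simp
qed

lemma fcal_tendsto_approx:
  "spectral_bound P l u \<Longrightarrow> continuous_on {l..u} f \<Longrightarrow>
    (\<lambda>n. poly_op (poly_approx l u f n) P x) \<longlonglongrightarrow> fcal l u P f x"
  by (intro fcal_tendsto poly_approx)

lemma fcal_cong:
  assumes "spectral_bound P l u" "continuous_on {l..u} f" "\<And>t. t \<in> {l..u} \<Longrightarrow> f t = g t"
  shows "fcal l u P f x = fcal l u P g x"
proof -
  have g: "continuous_on {l..u} g" using continuous_on_eq[OF assms(2)] assms(3) by blast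
  have "uniform_limit {l..u} (\<lambda>n. poly (poly_approx l u f n)) g sequentially"
    using poly_approx[OF assms(2)] assms(3) by (subst (asm) uniform_limit_cong'[of _ _ _ f g]) auto
  then show ?thesis
    using fcal_tendsto[OF assms(1) g] fcal_tendsto_approx[OF assms(1,2)] LIMSEQ_unique by blast
qed

lemma fcal_poly:
  assumes P: "spectral_bound P l u" shows "fcal l u P (poly p) x = poly_op p P x"
proof -
  have "uniform_limit {l..u} (\<lambda>n. poly p) (poly p) sequentially" by (rule uniform_limit_const)
  then have "(\<lambda>n::nat. poly_op p P x) \<longlonglongrightarrow> fcal l u P (poly p) x"
    by (intro fcal_tendsto[OF P]) (auto intro!: continuous_intros)
  then show ?thesis by (simp add: LIMSEQ_const_iff)
qed

lemma fcal_const: "spectral_bound P l u \<Longrightarrow> fcal l u P (\<lambda>t. c) x = c *\<^sub>R x"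
proof -
  assume P: "spectral_bound P l u"
  have "poly [:c:] = (\<lambda>t. c)" by auto
  then show ?thesis using fcal_poly[OF P, of "[:c:]" x] by (simp add: poly_op_const spectral_bound_linear[OF P])
qed

lemma fcal_ident: "spectral_bound P l u \<Longrightarrow> fcal l u P (\<lambda>t. t) x = P x"
proof -
  assume P: "spectral_bound P l u"
  have "poly [:0, 1:] = (\<lambda>t::real. t)" by auto
  then show ?thesis using fcal_poly[OF P, of "[:0, 1:]" x] by (simp add: poly_op_X spectral_bound_linear[OF P])
qed

lemma fcal_add:
  assumes P: "spectral_bound P l u" and f: "continuous_on {l..u} f" and g: "continuous_on {l..u} g"
  shows "fcal l u P (\<lambda>t. f t + g t) x = fcal l u P f x + fcal l u P g x"
proof -
  let ?p = "\<lambda>n. poly_approx l u f n + poly_approx l u g n"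
  have "uniform_limit {l..u} (\<lambda>n. poly (?p n)) (\<lambda>t. f t + g t) sequentially"
    unfolding poly_add by (intro uniform_limit_add poly_approx f g)
  then have "(\<lambda>n. poly_op (?p n) P x) \<longlonglongrightarrow> fcal l u P (\<lambda>t. f t + g t) x"
    by (intro fcal_tendsto[OF P] continuous_intros f g)
  moreover have "(\<lambda>n. poly_op (?p n) P x) \<longlonglongrightarrow> fcal l u P f x + fcal l u P g x"
    unfolding poly_op_add[OF spectral_bound_linear[OF P]]
    by (intro tendsto_intros fcal_tendsto_approx[OF P] f g)
  ultimately show ?thesis by (rule LIMSEQ_unique)
qed

lemma fcal_mult:
  assumes P: "spectral_bound P l u" and f: "continuous_on {l..u} f" and g: "continuous_on {l..u} g"
  shows "fcal l u P (\<lambda>t. f t * g t) x = fcal l u P f (fcal l u P g x)"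
proof -
  have poly1: "fcal l u P (\<lambda>t. poly p t * g t) x = poly_op p P (fcal l u P g x)" for p
  proof -
    let ?p = "\<lambda>n. p * poly_approx l u g n"
    have "bounded (poly p ` {l..u})" "bounded (g ` {l..u})"
      by (auto intro!: compact_imp_bounded compact_continuous_image continuous_intros g)
    then have "uniform_limit {l..u} (\<lambda>n. poly (?p n)) (\<lambda>t. poly p t * g t) sequentially"
      unfolding poly_mult by (intro uniform_lim_mult poly_approx g uniform_limit_const)
    then have "(\<lambda>n. poly_op (?p n) P x) \<longlonglongrightarrow> fcal l u P (\<lambda>t. poly p t * g t) x"
      by (intro fcal_tendsto[OF P] continuous_intros g)
    moreover have "(\<lambda>n. poly_op (?p n) P x) \<longlonglongrightarrow> poly_op p P (fcal l u P g x)"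
      unfolding poly_op_mult[OF spectral_bound_linear[OF P]]
      by (rule bounded_linear.tendsto[OF adjoint_bounded_linear[OF selfadj_poly_op[OF spectral_bound_selfadj[OF P]]]
            fcal_tendsto_approx[OF P g]])
    ultimately show ?thesis by (rule LIMSEQ_unique)
  qed
  let ?p = "\<lambda>n. poly_approx l u f n * poly_approx l u g n"
  have "bounded (f ` {l..u})" "bounded (g ` {l..u})"
    by (auto intro!: compact_imp_bounded compact_continuous_image continuous_intros f g)
  then have "uniform_limit {l..u} (\<lambda>n. poly (?p n)) (\<lambda>t. f t * g t) sequentially"
    unfolding poly_mult by (intro uniform_lim_mult poly_approx f g)
  then have 1: "(\<lambda>n. poly_op (?p n) P x) \<longlonglongrightarrow> fcal l u P (\<lambda>t. f t * g t) x"
    by (intro fcal_tendsto[OF P] continuous_intros f g)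
  have 2: "(\<lambda>n. poly_op (poly_approx l u f n) P (fcal l u P g x)) \<longlonglongrightarrow> fcal l u P f (fcal l u P g x)"
    by (intro fcal_tendsto_approx[OF P] f)
  have "(\<lambda>n. poly_op (?p n) P x - poly_op (poly_approx l u f n) P (fcal l u P g x)) \<longlonglongrightarrow> 0"
  proof -
    have "bounded (f ` {l..u})" by (auto intro!: compact_imp_bounded compact_continuous_image f)
    then obtain B where B: "B > 0" "\<And>t. t \<in> {l..u} \<Longrightarrow> \<bar>f t\<bar> \<le> B" unfolding bounded_pos by auto
    have "\<forall>\<^sub>F n in sequentially. \<forall>t\<in>{l..u}. dist (poly (poly_approx l u f n) t) (f t) < 1"
      by (rule uniform_limitD[OF poly_approx[OF f]]) simp
    then have ev: "\<forall>\<^sub>F n in sequentially. norm (poly_op (?p n) P x - poly_op (poly_approx l u f n) P (fcal l u P g x))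
        \<le> 4 * (B + 1) * norm (poly_op (poly_approx l u g n) P x - fcal l u P g x)"
    proof eventually_elim
      case (elim n)
      have "\<bar>poly (poly_approx l u f n) t\<bar> \<le> B + 1" if "t \<in> {l..u}" for t
        using elim B(2) that by (force simp: dist_real_def)
      then have "norm (poly_op (poly_approx l u f n) P (poly_op (poly_approx l u g n) P x - fcal l u P g x))
        \<le> 4 * (B + 1) * norm (poly_op (poly_approx l u g n) P x - fcal l u P g x)"
        by (intro spectral_boundD[OF P])
      then show ?case
        unfolding poly_op_mult[OF spectral_bound_linear[OF P]]
          linear_diff[OF poly_op_linear_arg[OF spectral_bound_linear[OF P]]] .
    qed
    have "(\<lambda>n. 4 * (B + 1) * norm (poly_op (poly_approx l u g n) P x - fcal l u P g x)) \<longlonglongrightarrow> 4 * (B + 1) * norm (fcal l u P g x - fcal l u P g x)"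
      by (intro tendsto_intros fcal_tendsto_approx[OF P] g)
    then have "(\<lambda>n. 4 * (B + 1) * norm (poly_op (poly_approx l u g n) P x - fcal l u P g x)) \<longlonglongrightarrow> 0" by simp
    with ev show ?thesis by (rule Lim_null_comparison)
  qed
  from tendsto_add[OF this 2] have "(\<lambda>n. poly_op (?p n) P x) \<longlonglongrightarrow> fcal l u P f (fcal l u P g x)" by simp
  with 1 show ?thesis by (rule LIMSEQ_unique)
qed

lemma fcal_cmult:
  assumes "spectral_bound P l u" "continuous_on {l..u} f"
  shows "fcal l u P (\<lambda>t. c * f t) x = c *\<^sub>R fcal l u P f x"
  using fcal_mult[OF assms(1) _ assms(2), of "\<lambda>t. c"] by (simp add: fcal_const[OF assms(1)])

lemma fcal_diff:
  assumes "spectral_bound P l u" "continuous_on {l..u} f" "continuous_on {l..u} g"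
  shows "fcal l u P (\<lambda>t. f t - g t) x = fcal l u P f x - fcal l u P g x"
proof -
  have c: "continuous_on {l..u} (\<lambda>t. -1 * g t)" by (intro continuous_intros assms(3))
  show ?thesis
    using fcal_add[OF assms(1,2) c, of x] unfolding fcal_cmult[OF assms(1,3)] by simp
qed

lemma fcal_minus:
  assumes "spectral_bound P l u" "continuous_on {l..u} f"
  shows "fcal l u P (\<lambda>t. - f t) x = - fcal l u P f x"
  using fcal_cmult[OF assms, of "-1"] by simp

lemma fcal_selfadj:
  assumes P: "spectral_bound P l u" and f: "continuous_on {l..u} f"
  shows "selfadj (fcal l u P f)"
  by (rule adjoint_limit[where T="\<lambda>n. poly_op (poly_approx l u f n) P" and T'="\<lambda>n. poly_op (poly_approx l u f n) P"])
    (intro selfadj_poly_op spectral_bound_selfadj[OF P] fcal_tendsto_approx[OF P] f)+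

lemma fcal_linear:
  assumes "spectral_bound P l u" "continuous_on {l..u} f"
  shows "linear (fcal l u P f)"
  by (rule selfadj_linear[OF fcal_selfadj[OF assms]])

lemma fcal_norm_le:
  assumes P: "spectral_bound P l u" and f: "continuous_on {l..u} f"
    and s: "\<And>t. t \<in> {l..u} \<Longrightarrow> \<bar>f t\<bar> \<le> s"
  shows "norm (fcal l u P f x) \<le> 4 * s * norm x"
proof (rule le_if_le_add_mult[of _ _ "4 * norm x"])
  fix e :: real assume e: "e > 0"
  have "\<forall>\<^sub>F n in sequentially. norm (poly_op (poly_approx l u f n) P x) \<le> 4 * (s + e) * norm x"
    using uniform_limitD[OF poly_approx[OF f] e]
  proof eventually_elim
    case (elim n)
    show ?case
    proof (rule spectral_boundD[OF P])
      fix t assume "t \<in> {l..u}"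
      then show "\<bar>poly (poly_approx l u f n) t\<bar> \<le> s + e"
        using elim s by (force simp: dist_real_def)
    qed
  qed
  then have "norm (fcal l u P f x) \<le> 4 * (s + e) * norm x"
    by (intro tendsto_upperbound[OF tendsto_norm[OF fcal_tendsto_approx[OF P f]]]) auto
  then show "norm (fcal l u P f x) \<le> 4 * s * norm x + e * (4 * norm x)" by (simp add: algebra_simps)
qed

lemma fcal_intertwine:
  assumes P: "spectral_bound P l u" and P': "spectral_bound P' l u" and f: "continuous_on {l..u} f"
    and S: "bounded_linear S" and SP: "\<And>x. S (P x) = P' (S x)"
  shows "S (fcal l u P f x) = fcal l u P' f (S x)"
proof -
  have "(\<lambda>n. S (poly_op (poly_approx l u f n) P x)) \<longlonglongrightarrow> S (fcal l u P f x)"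
    by (intro bounded_linear.tendsto[OF S] fcal_tendsto_approx[OF P f])
  moreover have "S (poly_op p P x) = poly_op p P' (S x)" for p
    by (rule poly_op_commute)
      (use S SP spectral_bound_linear[OF P] spectral_bound_linear[OF P'] bounded_linear.linear in auto)
  ultimately have "(\<lambda>n. poly_op (poly_approx l u f n) P' (S x)) \<longlonglongrightarrow> S (fcal l u P f x)" by simp
  then show ?thesis using fcal_tendsto_approx[OF P' f] LIMSEQ_unique by blast
qed

lemma fcal_commute:
  assumes P: "spectral_bound P l u" and f: "continuous_on {l..u} f" and g: "continuous_on {l..u} g"
  shows "fcal l u P f (fcal l u P g x) = fcal l u P g (fcal l u P f x)"
  using fcal_mult[OF P f g, of x] fcal_mult[OF P g f, of x] by (simp add: mult.commute)

lemma fcal_commute_base: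
  assumes P: "spectral_bound P l u" and f: "continuous_on {l..u} f"
  shows "fcal l u P f (P x) = P (fcal l u P f x)"
  using fcal_commute[OF P f continuous_on_id, of x] by (simp add: fcal_ident[OF P])

lemma poly_op_fcal:
  assumes P: "spectral_bound P l u" and g: "continuous_on {l..u} g"
  shows "poly_op p (fcal l u P g) x = fcal l u P (\<lambda>t. poly p (g t)) x"
proof (induction p arbitrary: x)
  case (pCons a p)
  have c: "continuous_on {l..u} (\<lambda>t. poly p (g t))" by (intro continuous_intros g)
  have "fcal l u P (\<lambda>t. a + g t * poly p (g t)) x = a *\<^sub>R x + fcal l u P g (fcal l u P (\<lambda>t. poly p (g t)) x)"
    by (subst fcal_add[OF P]) (auto intro!: continuous_intros g c simp: fcal_const[OF P] fcal_mult[OF P g c])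
  then show ?case by (simp add: poly_op_pCons[OF fcal_linear[OF P g]] pCons.IH)
qed (simp add: fcal_const[OF P])

lemma spectral_bound_fcal:
  assumes P: "spectral_bound P l u" and g: "continuous_on {l..u} g" and "g ` {l..u} \<subseteq> {l'..u'}"
  shows "spectral_bound (fcal l u P g) l' u'"
  unfolding spectral_bound_def
proof (intro conjI allI impI)
  fix p s x assume "\<forall>t\<in>{l'..u'}. \<bar>poly p t\<bar> \<le> s"
  then show "norm (poly_op p (fcal l u P g) x) \<le> 4 * s * norm x"
    unfolding poly_op_fcal[OF P g] using assms(3)[unfolded image_subset_iff]
    by (intro fcal_norm_le[OF P]) (auto intro!: continuous_intros g)
qed (rule fcal_selfadj[OF P g])

lemma fcal_fcal:
  assumes P: "spectral_bound P l u" and g: "continuous_on {l..u} g" and sub: "g ` {l..u} \<subseteq> {l'..u'}"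
    and f: "continuous_on {l'..u'} f"
  shows "fcal l' u' (fcal l u P g) f x = fcal l u P (\<lambda>t. f (g t)) x"
proof -
  have fg: "continuous_on {l..u} (\<lambda>t. f (g t))"
    using continuous_on_compose2[OF f g sub] .
  have "uniform_limit {l..u} (\<lambda>n t. poly (poly_approx l' u' f n) (g t)) (\<lambda>t. f (g t)) sequentially"
    using poly_approx[OF f] sub[unfolded image_subset_iff] unfolding uniform_limit_iff by (fast elim!: eventually_mono)
  then have u: "uniform_limit {l..u} (\<lambda>n. (\<lambda>t. poly (poly_approx l' u' f n) (g t))) (\<lambda>t. f (g t)) sequentially" .
  have 1: "(\<lambda>n. fcal l u P (\<lambda>t. poly (poly_approx l' u' f n) (g t)) x) \<longlonglongrightarrow> fcal l' u' (fcal l u P g) f x"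
    using fcal_tendsto_approx[OF spectral_bound_fcal[OF P g sub] f, of x] by (simp add: poly_op_fcal[OF P g])
  have "(\<lambda>n. fcal l u P (\<lambda>t. poly (poly_approx l' u' f n) (g t)) x) \<longlonglongrightarrow> fcal l u P (\<lambda>t. f (g t)) x"
  proof (rule tendsto_if_le_mult[of _ _ "4 * norm x"])
    fix e :: real assume "e > 0"
    then obtain N where N: "\<And>n t. n \<ge> N \<Longrightarrow> t \<in> {l..u} \<Longrightarrow> dist (poly (poly_approx l' u' f n) (g t)) (f (g t)) < e"
      using uniform_limitD[OF u] unfolding eventually_sequentially by blast
    have "norm (fcal l u P (\<lambda>t. poly (poly_approx l' u' f n) (g t)) x - fcal l u P (\<lambda>t. f (g t)) x) \<le> e * (4 * norm x)"
      if n: "n \<ge> N" for n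
    proof -
      have c: "continuous_on {l..u} (\<lambda>t. poly (poly_approx l' u' f n) (g t))" by (intro continuous_intros g)
      have "norm (fcal l u P (\<lambda>t. poly (poly_approx l' u' f n) (g t) - f (g t)) x) \<le> 4 * e * norm x"
        by (rule fcal_norm_le[OF P]) (use N[OF n] in \<open>auto intro!: continuous_intros c fg simp: dist_real_def less_imp_le\<close>)
      then show ?thesis by (simp add: fcal_diff[OF P c fg] mult_ac)
    qed
    then show "\<exists>N. \<forall>n\<ge>N. norm (fcal l u P (\<lambda>t. poly (poly_approx l' u' f n) (g t)) x - fcal l u P (\<lambda>t. f (g t)) x)
        \<le> e * (4 * norm x)"
      by blast
  qed
  with 1 show ?thesis by (rule LIMSEQ_unique)
qed

lemma fcal_interval:
  assumes P: "spectral_bound P l u" and sub: "l' \<le> l" "u \<le> u'" and f: "continuous_on {l'..u'} f"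
  shows "fcal l' u' P f x = fcal l u P f x"
proof -
  have "{l..u} \<subseteq> {l'..u'}" using sub by auto
  then have "continuous_on {l..u} f" "uniform_limit {l..u} (\<lambda>n. poly (poly_approx l' u' f n)) f sequentially"
    using f poly_approx[OF f] by (auto intro: continuous_on_subset uniform_limit_on_subset)
  then have "(\<lambda>n. poly_op (poly_approx l' u' f n) P x) \<longlonglongrightarrow> fcal l u P f x"
    by (intro fcal_tendsto[OF P])
  then show ?thesis
    using fcal_tendsto_approx[OF spectral_bound_mono[OF P sub] f, of x] LIMSEQ_unique by blast
qed

text \<open>
  The bounded inverse of a self-adjoint operator that is bounded below: its functional calculus
  does not see a neighbourhood of \<open>0\<close>, where \<open>1/t\<close> may therefore be cut off.
\<close>

lemma selfadj_bounded_below_inverse: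
  assumes H: "selfadj H" and below: "\<And>x. \<delta> * norm x \<le> norm (H x)" and \<delta>: "\<delta> > 0"
  obtains G where "selfadj G" "\<And>x. H (G x) = x" "\<And>x. G (H x) = x"
proof -
  define M where "M = onorm H + 1"
  have M: "onorm H \<le> M" "M > 0"
    using onorm_pos_le[OF adjoint_bounded_linear[OF H]] by (auto simp: M_def)
  note P = spectral_bound_onorm[OF H M]
  define \<epsilon> where "\<epsilon> = \<delta> / 8"
  have \<epsilon>: "\<epsilon> > 0" using \<delta> by (simp add: \<epsilon>_def)
  (* equals 1 / t outside [-eps, eps] *)
  define g where "g t = t / (max \<bar>t\<bar> \<epsilon>)\<^sup>2" for t
  define r where "r t = 1 - t * g t" for t
  (* r is supported in [-eps, eps], where t and its truncation m agree. *)
  define m where "m t = max (- \<epsilon>) (min \<epsilon> t)" for t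
  have nz: "(max \<bar>t\<bar> \<epsilon>)\<^sup>2 \<noteq> 0" for t using \<epsilon> by (auto simp: max_def)
  have cg: "continuous_on S g" for S unfolding g_def by (intro continuous_intros) (use nz in auto)
  have cr: "continuous_on S r" for S unfolding r_def by (intro continuous_intros cg)
  have cm: "continuous_on S m" for S unfolding m_def by (intro continuous_intros)
  have tr: "t * r t = m t * r t" for t
  proof (cases "\<bar>t\<bar> \<le> \<epsilon>")
    case False
    then have "r t = 0" using \<epsilon> by (auto simp: r_def g_def max_def power2_eq_square abs_if)
    then show ?thesis by simp
  qed (auto simp: m_def)
  have r0: "fcal (-M) M H r x = 0" for x
  proof -
    have "H (fcal (-M) M H r x) = fcal (-M) M H (\<lambda>t. t * r t) x"
      unfolding fcal_mult[OF P continuous_on_id cr] fcal_ident[OF P] ..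
    also have "\<dots> = fcal (-M) M H m (fcal (-M) M H r x)"
      unfolding tr by (rule fcal_mult[OF P cm cr])
    finally have "norm (H (fcal (-M) M H r x)) \<le> 4 * \<epsilon> * norm (fcal (-M) M H r x)"
      using fcal_norm_le[OF P cm, of \<epsilon>] \<epsilon> by (simp add: m_def)
    then have "\<delta> * norm (fcal (-M) M H r x) \<le> \<delta> / 2 * norm (fcal (-M) M H r x)"
      using below[of "fcal (-M) M H r x"] by (simp add: \<epsilon>_def)
    then show ?thesis using \<delta> by (simp add: mult_le_cancel_right)
  qed
  have HG: "H (fcal (-M) M H g x) = x" for x
  proof -
    have "0 = fcal (-M) M H (\<lambda>t. 1 - t * g t) x" using r0 by (simp add: r_def[abs_def])
    also have "\<dots> = x - H (fcal (-M) M H g x)"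
      by (subst fcal_diff[OF P]) (auto intro!: continuous_intros cg simp: fcal_const[OF P] fcal_mult[OF P continuous_on_id cg] fcal_ident[OF P])
    finally show ?thesis by simp
  qed
  show ?thesis
  proof (rule that[of "fcal (-M) M H g"])
    show "selfadj (fcal (-M) M H g)" by (rule fcal_selfadj[OF P cg])
    show "H (fcal (-M) M H g x) = x" for x by (rule HG)
    then show "fcal (-M) M H g (H x) = x" for x by (simp add: fcal_commute_base[OF P cg])
  qed
qed

end

section \<open>Positivity of \<open>V V\<^sup>*\<close>\<close>

context hilbert_module
begin

text \<open>
  For self-adjoint \<open>N\<close> this means positivity. In this form it needs no information about the
  spectrum and passes to sums, as it bounds \<open>\<parallel>1 - s N\<parallel>\<close> to first order at \<open>s = 0\<close>.
\<close>

definition accretive :: "('e \<Rightarrow> 'e) \<Rightarrow> bool" where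
  "accretive N \<longleftrightarrow> (\<exists>C s0. s0 > 0 \<and> (\<forall>s x. 0 \<le> s \<longrightarrow> s \<le> s0 \<longrightarrow> norm (x - s *\<^sub>R N x) \<le> (1 + C * s\<^sup>2) * norm x))"

lemma selfadj_square_zero: "selfadj T \<Longrightarrow> T (T x) = 0 \<Longrightarrow> T x = 0"
  by (rule ip_self_eq_zero) (simp add: is_adjointD)

text \<open>\<open>1 + s K\<^sup>2\<close> factors as \<open>(1 - i \<surd>s K) (1 + i \<surd>s K)\<close>, and neither factor decreases norms.\<close>

lemma norm_le_norm_add_square:
  assumes K: "selfadj K" and s: "0 \<le> s"
  shows "norm x \<le> norm (x + s *\<^sub>R K (K x))"
proof -
  note lK = selfadj_linear[OF K]
  define y where "y = x + \<i> *\<^sub>C (sqrt s *\<^sub>R K x)"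
  have "norm x \<le> norm y"
    unfolding y_def by (rule norm_le_norm_add_ii) (simp add: ip_scaleR_left ip_scaleR_right is_adjointD[OF K])
  also have "norm y \<le> norm (y + \<i> *\<^sub>C ((- sqrt s) *\<^sub>R K y))"
    by (rule norm_le_norm_add_ii) (simp add: ip_minus_left ip_minus_right ip_scaleR_left ip_scaleR_right is_adjointD[OF K])
  also have "y + \<i> *\<^sub>C ((- sqrt s) *\<^sub>R K y) = x + s *\<^sub>R K (K x)"
    using s by (simp add: y_def linear_add[OF lK] linear_scale[OF lK] adjoint_scaleC[OF K] scaleC_minus_right
        scaleC_scaleR scaleC_add_right scaleC_diff_right scaleR_add_right scaleC_ii_ii)
  finally show ?thesis .
qed

lemma accretive_square:
  assumes K: "selfadj K"
  shows "accretive (\<lambda>x. K (K x))"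
proof -
  note lK = selfadj_linear[OF K]
  obtain C where C: "\<And>x. norm (K (K (K (K x)))) \<le> norm x * C"
    using bounded_linear.bounded[OF adjoint_bounded_linear[OF adjoint_comp[OF adjoint_comp[OF K K] adjoint_comp[OF K K]]]]
    by blast
  have "norm (x - s *\<^sub>R K (K x)) \<le> (1 + C * s\<^sup>2) * norm x" if s: "0 \<le> s" for s x
  proof -
    let ?z = "x - s *\<^sub>R K (K x)"
    have "norm ?z \<le> norm (?z + s *\<^sub>R K (K ?z))" by (rule norm_le_norm_add_square[OF K s])
    also have "?z + s *\<^sub>R K (K ?z) = x - s\<^sup>2 *\<^sub>R K (K (K (K x)))"
      by (simp add: linear_diff[OF lK] linear_scale[OF lK] scaleR_diff_right power2_eq_square)
    also have "norm \<dots> \<le> norm x + s\<^sup>2 * norm (K (K (K (K x))))"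
      using norm_triangle_ineq4[of x "s\<^sup>2 *\<^sub>R K (K (K (K x)))"] by simp
    also have "\<dots> \<le> norm x + s\<^sup>2 * (norm x * C)" by (intro add_left_mono mult_left_mono C) auto
    finally show ?thesis by (simp add: algebra_simps)
  qed
  then show ?thesis unfolding accretive_def by (intro exI[of _ C] exI[of _ 1]) auto
qed

lemma accretive_add:
  assumes "accretive N" "accretive N'"
  shows "accretive (\<lambda>x. N x + N' x)"
proof -
  obtain C s0 where 1: "s0 > 0" "\<And>s x. 0 \<le> s \<Longrightarrow> s \<le> s0 \<Longrightarrow> norm (x - s *\<^sub>R N x) \<le> (1 + C * s\<^sup>2) * norm x"
    using assms(1) unfolding accretive_def by blast
  obtain C' s0' where 2: "s0' > 0" "\<And>s x. 0 \<le> s \<Longrightarrow> s \<le> s0' \<Longrightarrow> norm (x - s *\<^sub>R N' x) \<le> (1 + C' * s\<^sup>2) * norm x"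
    using assms(2) unfolding accretive_def by blast
  have "norm (x - s *\<^sub>R (N x + N' x)) \<le> (1 + (2 * C + 2 * C') * s\<^sup>2) * norm x"
    if s: "0 \<le> s" "s \<le> min s0 s0' / 2" for s x
  proof -
    have a: "norm (x - (2 * s) *\<^sub>R N x) \<le> (1 + C * (2 * s)\<^sup>2) * norm x"
      "norm (x - (2 * s) *\<^sub>R N' x) \<le> (1 + C' * (2 * s)\<^sup>2) * norm x"
      using s by (intro 1 2; simp)+
    have "2 *\<^sub>R (x - s *\<^sub>R (N x + N' x)) = (x - (2 * s) *\<^sub>R N x) + (x - (2 * s) *\<^sub>R N' x)"
      by (simp add: algebra_simps scaleR_2)
    then have "2 * norm (x - s *\<^sub>R (N x + N' x)) \<le> norm (x - (2 * s) *\<^sub>R N x) + norm (x - (2 * s) *\<^sub>R N' x)"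
      using norm_triangle_ineq[of "x - (2 * s) *\<^sub>R N x" "x - (2 * s) *\<^sub>R N' x"]
      by (metis norm_scaleR abs_numeral)
    also have "\<dots> \<le> 2 * ((1 + (2 * C + 2 * C') * s\<^sup>2) * norm x)"
      using add_mono[OF a] by (simp add: algebra_simps power2_eq_square)
    finally show ?thesis by simp
  qed
  then show ?thesis
    unfolding accretive_def using 1(1) 2(1)
    by (intro exI[of _ "2 * C + 2 * C'"] exI[of _ "min s0 s0' / 2"]) auto
qed

text \<open>
  On the spectral subspace where \<open>N \<le> -\<delta>\<close>, the powers of \<open>1 - sN\<close> grow at least like
  \<open>(1 + s\<delta>)\<^sup>m\<close>, while accretivity only allows \<open>(1 + Cs\<^sup>2)\<^sup>m\<close>. For small \<open>s\<close> this subspace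
  must be zero.
\<close>

lemma accretive_negative_part:
  assumes P: "spectral_bound N (- M) M" and M: "M > 0" and acc: "accretive N"
  shows "fcal (- M) M N (\<lambda>t. max (- t) 0) x = 0"
proof -
  obtain C0 s0 where C0: "s0 > 0" "\<And>s x. 0 \<le> s \<Longrightarrow> s \<le> s0 \<Longrightarrow> norm (x - s *\<^sub>R N x) \<le> (1 + C0 * s\<^sup>2) * norm x"
    using acc unfolding accretive_def by blast
  define C where "C = \<bar>C0\<bar> + 1"
  have C: "norm (x - s *\<^sub>R N x) \<le> (1 + C * s\<^sup>2) * norm x" if "0 \<le> s" "s \<le> s0" for s x
  proof -
    have "(1 + C0 * s\<^sup>2) * norm x \<le> (1 + C * s\<^sup>2) * norm x"
      by (intro mult_right_mono add_left_mono) (auto simp: C_def)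
    then show ?thesis using C0(2)[OF that, of x] by linarith
  qed
  have Cpos: "C > 0" by (simp add: C_def add_nonneg_pos)
  note lN = spectral_bound_linear[OF P]
  have cut: "fcal (- M) M N (\<lambda>t. max (- t - \<delta>) 0) x = 0" if \<delta>: "\<delta> > 0" for \<delta>
  proof -
    (* The three bounds keep s admissible, 1 - s N invertible, and C s below delta. *)
    define s where "s = min s0 (min (1 / (2 * M)) (\<delta> / (2 * C)))"
    have s: "0 < s" "s \<le> s0" "s * M < 1" "C * s < \<delta>"
    proof -
      show "0 < s" "s \<le> s0" using C0 M \<delta> Cpos by (auto simp: s_def)
      have "s \<le> 1 / (2 * M)" "s \<le> \<delta> / (2 * C)" by (auto simp: s_def)
      then have "2 * (s * M) \<le> 1" "2 * (C * s) \<le> \<delta>" using M Cpos by (auto simp: field_simps)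
      moreover have "0 < s * M" "0 < C * s" using \<open>0 < s\<close> M Cpos by auto
      ultimately show "s * M < 1" "C * s < \<delta>" by linarith+
    qed
    have pos: "1 - s * t > 0" if "t \<in> {-M..M}" for t
    proof -
      have "s * t \<le> s * M" using that s(1) by (intro mult_left_mono) auto
      then show ?thesis using s(3) by linarith
    qed
    define g where "g m t = max (- t - \<delta>) 0 / (1 - s * t) ^ m" for m :: nat and t
    have cg: "continuous_on {-M..M} (g m)" for m
      unfolding g_def by (intro continuous_intros) (use pos in force)
    have pow: "norm (poly_op ([:1, - s:] ^ m) N y) \<le> (1 + C * s\<^sup>2) ^ m * norm y" for m y
    proof (induction m)
      case 0
      show ?case by (simp add: one_pCons poly_op_const[OF lN])
    next
      case (Suc m)
      have "poly_op ([:1, - s:] ^ Suc m) N y = poly_op [:1, - s:] N (poly_op ([:1, - s:] ^ m) N y)"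
        unfolding power_Suc by (rule poly_op_mult[OF lN])
      also have "\<dots> = poly_op ([:1, - s:] ^ m) N y - s *\<^sub>R N (poly_op ([:1, - s:] ^ m) N y)"
        by (simp add: poly_op_pCons[OF lN] linear_0[OF lN] linear_add[OF lN] linear_neg[OF lN] linear_scale[OF lN])
      also have "norm \<dots> \<le> (1 + C * s\<^sup>2) * norm (poly_op ([:1, - s:] ^ m) N y)" using s by (intro C) auto
      also have "\<dots> \<le> (1 + C * s\<^sup>2) * ((1 + C * s\<^sup>2) ^ m * norm y)"
        using Cpos by (intro mult_left_mono Suc) auto
      finally show ?case by (simp add: mult.assoc)
    qed
    define \<rho> where "\<rho> = (1 + C * s\<^sup>2) / (1 + s * \<delta>)"
    have pd: "1 + s * \<delta> > 0" using s \<delta> by (simp add: add_pos_pos)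
    have \<rho>: "0 \<le> \<rho>" "\<rho> < 1"
    proof -
      show "0 \<le> \<rho>" using Cpos s \<delta> by (simp add: \<rho>_def)
      have "C * s\<^sup>2 < s * \<delta>" using mult_strict_left_mono[OF s(4,1)] by (simp add: power2_eq_square mult_ac)
      then show "\<rho> < 1" using pd by (simp add: \<rho>_def)
    qed
    have bound: "norm (fcal (- M) M N (\<lambda>t. max (- t - \<delta>) 0) x) \<le> 4 * M * norm x * \<rho> ^ m" for m
    proof -
      have "fcal (- M) M N (\<lambda>t. max (- t - \<delta>) 0) x = fcal (- M) M N (\<lambda>t. poly ([:1, - s:] ^ m) t * g m t) x"
      proof (rule fcal_cong[OF P])
        fix t assume "t \<in> {- M..M}"
        then show "max (- t - \<delta>) 0 = poly ([:1, - s:] ^ m) t * g m t"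
          using pos[of t] by (simp add: g_def mult.commute)
      qed (intro continuous_intros)
      also have "\<dots> = poly_op ([:1, - s:] ^ m) N (fcal (- M) M N (g m) x)"
        by (subst fcal_mult[OF P]) (auto intro!: continuous_intros cg simp del: poly_power simp: fcal_poly[OF P])
      finally have "norm (fcal (- M) M N (\<lambda>t. max (- t - \<delta>) 0) x) \<le> (1 + C * s\<^sup>2) ^ m * norm (fcal (- M) M N (g m) x)"
        using pow by simp
      also have "\<dots> \<le> (1 + C * s\<^sup>2) ^ m * (4 * (M / (1 + s * \<delta>) ^ m) * norm x)"
      proof (intro mult_left_mono fcal_norm_le[OF P cg])
        fix t assume t: "t \<in> {- M..M}"
        show "\<bar>g m t\<bar> \<le> M / (1 + s * \<delta>) ^ m"
        proof (cases "- t - \<delta> \<le> 0")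
          case True
          then show ?thesis using M pd by (simp add: g_def)
        next
          case False
          then have "s * \<delta> \<le> s * (- t)" using s(1) by (intro mult_left_mono) auto
          then have "(1 + s * \<delta>) ^ m \<le> (1 - s * t) ^ m" using pd by (intro power_mono) auto
          moreover have "\<bar>max (- t - \<delta>) 0\<bar> \<le> M" using t \<delta> M by auto
          ultimately show ?thesis
            using pd M pos[OF t] unfolding g_def abs_divide by (intro frac_le) auto
        qed
      qed (use Cpos in auto)
      also have "\<dots> = 4 * M * norm x * \<rho> ^ m" by (simp add: \<rho>_def power_divide)
      finally show ?thesis .
    qed
    have "(\<lambda>m. 4 * M * norm x * \<rho> ^ m) \<longlonglongrightarrow> 4 * M * norm x * 0"
      using \<rho> by (intro tendsto_intros LIMSEQ_realpow_zero) auto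
    then have "norm (fcal (- M) M N (\<lambda>t. max (- t - \<delta>) 0) x) \<le> 4 * M * norm x * 0"
      by (rule LIMSEQ_le_const) (use bound in auto)
    then show ?thesis by simp
  qed
  have "norm (fcal (- M) M N (\<lambda>t. max (- t) 0) x) \<le> 0"
  proof (rule le_if_le_add_mult[of _ _ "4 * norm x"])
    fix \<delta> :: real assume \<delta>: "\<delta> > 0"
    have "fcal (- M) M N (\<lambda>t. max (- t) 0) x
        = fcal (- M) M N (\<lambda>t. max (- t) 0 - max (- t - \<delta>) 0) x"
      by (subst fcal_diff[OF P]) (auto intro!: continuous_intros simp: cut[OF \<delta>])
    also have "norm \<dots> \<le> 4 * \<delta> * norm x"
      by (rule fcal_norm_le[OF P]) (use \<delta> in \<open>auto intro!: continuous_intros\<close>)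
    finally show "norm (fcal (- M) M N (\<lambda>t. max (- t) 0) x) \<le> 0 + \<delta> * (4 * norm x)" by (simp add: mult_ac)
  qed
  then show ?thesis by simp
qed

lemma spectral_bound_nonneg:
  assumes P: "spectral_bound N (- M) M" and M: "M > 0"
    and neg: "\<And>x. fcal (- M) M N (\<lambda>t. max (- t) 0) x = 0"
  shows "spectral_bound N 0 M"
proof -
  have c: "continuous_on {-M..M} (\<lambda>t. max t 0)" "continuous_on {-M..M} (\<lambda>t. max (- t) 0)"
    by (intro continuous_intros)+
  have "N x = fcal (- M) M N (\<lambda>t. max t 0 - max (- t) 0) x" for x
    using fcal_cong[OF P continuous_on_id, of "\<lambda>t. max t 0 - max (- t) 0" x] by (simp add: fcal_ident[OF P])
  then have "N = fcal (- M) M N (\<lambda>t. max t 0)" by (auto simp: fcal_diff[OF P c] neg)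
  moreover have "spectral_bound (fcal (- M) M N (\<lambda>t. max t 0)) 0 M"
    by (rule spectral_bound_fcal[OF P c(1)]) (use M in auto)
  ultimately show ?thesis by simp
qed

lemma accretive_spectral_bound:
  assumes "selfadj N" "onorm N \<le> M" "M > 0" "accretive N"
  shows "spectral_bound N 0 M"
  using spectral_bound_onorm[OF assms(1-3)] assms(3,4)
  by (intro spectral_bound_nonneg accretive_negative_part)

lemma spectral_bound_both_zero:
  assumes P: "spectral_bound N 0 M" and P': "spectral_bound (\<lambda>x. - N x) 0 M" and M: "M > 0"
  shows "N x = 0"
proof -
  have c: "continuous_on S (\<lambda>t::real. max t 0)" "continuous_on S (\<lambda>t::real. max (- t) 0)" "continuous_on S (\<lambda>t::real. - t)" for S
    by (intro continuous_intros)+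
  have Q: "spectral_bound N (- M) M" "spectral_bound (\<lambda>x. - N x) (- M) M"
    using spectral_bound_mono[OF P, of "- M" M] spectral_bound_mono[OF P', of "- M" M] M by auto
  have z: "fcal (- M) M T (\<lambda>t. max (- t) 0) x = 0" if "spectral_bound T 0 M" for T
  proof -
    have "fcal (- M) M T (\<lambda>t. max (- t) 0) x = fcal 0 M T (\<lambda>t. max (- t) 0) x"
      by (rule fcal_interval[OF that]) (use M c in auto)
    also have "norm \<dots> \<le> 4 * 0 * norm x" by (rule fcal_norm_le[OF that]) (auto intro: c)
    finally show ?thesis by simp
  qed
  have "(\<lambda>x. - N x) = fcal (- M) M N (\<lambda>t. - t)"
    using fcal_minus[OF Q(1) continuous_on_id] by (auto simp: fcal_ident[OF Q(1)])
  then have "fcal (- M) M N (\<lambda>t. max (- (- t)) 0) x = fcal (- M) M (\<lambda>x. - N x) (\<lambda>t. max (- t) 0) x"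
    using fcal_fcal[OF Q(1) c(3) _ c(2), of "- M" M x] by auto
  then have "fcal (- M) M N (\<lambda>t. max t 0) x = 0" using z[OF P'] by simp
  moreover have "N x = fcal (- M) M N (\<lambda>t. max t 0 - max (- t) 0) x"
    using fcal_cong[OF Q(1) continuous_on_id, of "\<lambda>t. max t 0 - max (- t) 0" x] by (simp add: fcal_ident[OF Q(1)])
  ultimately show ?thesis using z[OF P] by (simp add: fcal_diff[OF Q(1) c(1,2)])
qed

text \<open>
  The Kelley--Vaught argument. For the negative part \<open>f(H)\<close> of \<open>H = V V\<^sup>*\<close> put
  \<open>w = f(H) V\<close>, so that \<open>-w w\<^sup>* = f(H)\<^sup>3\<close> is positive. Then \<open>-w\<^sup>* w\<close> is positive as well, having
  the same spectrum up to \<open>0\<close>. So \<open>-(w w\<^sup>* + w\<^sup>* w)\<close> is positive. But \<open>w w\<^sup>* + w\<^sup>* w\<close> is positive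
  too, being a sum of two squares of self-adjoint operators. Hence it vanishes, both \<open>-w w\<^sup>*\<close> and
  \<open>w w\<^sup>* = -w\<^sup>* w\<close> are positive, and \<open>f(H)\<^sup>3 = 0\<close>.
\<close>

theorem spectral_bound_self_mult_adjoint:
  assumes V: "is_adjoint E V V'" and M: "onorm (\<lambda>x. V (V' x)) \<le> M" "M > 0"
  shows "spectral_bound (\<lambda>x. V (V' x)) 0 M"
proof -
  define H where "H x = V (V' x)" for x
  have H: "selfadj H" unfolding H_def using adjoint_comp[OF V is_adjoint_sym[OF V]] .
  have P: "spectral_bound H (- M) M"
    using M by (intro spectral_bound_onorm H) (auto simp: H_def[abs_def])
  define f where "f t = max (- t) 0" for t :: real
  have cf: "continuous_on S f" for S unfolding f_def by (intro continuous_intros)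
  let ?\<Phi> = "fcal (- M) M H"
  define F where "F = ?\<Phi> f"
  define K where "K = ?\<Phi> (\<lambda>t. f t * sqrt (f t))"
  have cK: "continuous_on S (\<lambda>t. f t * sqrt (f t))" for S by (intro continuous_intros cf)
  have F: "selfadj F" unfolding F_def by (rule fcal_selfadj[OF P cf])
  have K: "selfadj K" unfolding K_def by (rule fcal_selfadj[OF P cK])
  define w where "w x = F (V x)" for x
  define w' where "w' x = V' (F x)" for x
  have w: "is_adjoint E w w'" unfolding w_def w'_def by (rule adjoint_comp[OF F V])
  have w': "is_adjoint E w' w" by (rule is_adjoint_sym[OF w])
  note lw = bounded_linear.linear[OF adjoint_bounded_linear[OF w]]
    and lw' = bounded_linear.linear[OF adjoint_bounded_linear[OF w']]
  have f0: "f t \<ge> 0" for t by (simp add: f_def)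
  have KK: "K (K x) = - w (w' x)" for x
  proof -
    have "K (K x) = ?\<Phi> (\<lambda>t. (f t * sqrt (f t)) * (f t * sqrt (f t))) x"
      unfolding K_def by (rule fcal_mult[OF P cK cK, symmetric])
    also have "\<dots> = ?\<Phi> (\<lambda>t. - (f t * (t * f t))) x"
    proof (rule fcal_cong[OF P])
      fix t :: real
      have "f t * sqrt (f t) * (f t * sqrt (f t)) = f t * f t * (sqrt (f t) * sqrt (f t))"
        by (simp only: mult_ac)
      also have "\<dots> = f t * f t * f t" by (simp add: f0)
      also have "\<dots> = - (f t * (t * f t))" by (cases "t \<ge> 0") (auto simp: f_def)
      finally show "f t * sqrt (f t) * (f t * sqrt (f t)) = - (f t * (t * f t))" .
    qed (intro continuous_intros cf)
    also have "\<dots> = - ?\<Phi> f (?\<Phi> (\<lambda>t. t) (?\<Phi> f x))"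
    proof -
      have c: "continuous_on {-M..M} (\<lambda>t. t * f t)" by (intro continuous_intros cf)
      show ?thesis
        unfolding fcal_minus[OF P continuous_on_mult[OF cf c]] fcal_mult[OF P cf c]
          fcal_mult[OF P continuous_on_id cf] ..
    qed
    also have "\<dots> = - w (w' x)" by (simp add: fcal_ident[OF P] w_def w'_def F_def H_def)
    finally show ?thesis .
  qed
  define L where "L x = - w' (w x)" for x
  have L: "selfadj L" unfolding L_def using adjoint_minus[OF adjoint_comp[OF w' w]] .
  define MK where "MK = onorm K + 1"
  have MK: "onorm K \<le> MK" "MK > 0"
    using onorm_pos_le[OF adjoint_bounded_linear[OF K]] by (auto simp: MK_def)
  note PK = spectral_bound_onorm[OF K MK]
  define M2 where "M2 = max (onorm L + 1) (MK\<^sup>2)"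
  have M2: "onorm L \<le> M2" "MK\<^sup>2 \<le> M2" "M2 > 0"
    using onorm_pos_le[OF adjoint_bounded_linear[OF L]] by (auto simp: M2_def max_def)
  note PL = spectral_bound_onorm[OF L M2(1,3)]
  define KS where "KS x = K (K x)" for x
  have PKS: "spectral_bound KS 0 M2"
  proof -
    have "KS = fcal (- MK) MK K (\<lambda>t. t * t)"
      by (auto simp: KS_def fcal_mult[OF PK continuous_on_id continuous_on_id] fcal_ident[OF PK])
    moreover have "spectral_bound (fcal (- MK) MK K (\<lambda>t. t * t)) 0 (MK\<^sup>2)"
    proof (rule spectral_bound_fcal[OF PK])
      have "t * t \<le> MK\<^sup>2" if "t \<in> {-MK..MK}" for t
        using that power_mono[of "\<bar>t\<bar>" MK 2] by (auto simp: power2_eq_square)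
      then show "(\<lambda>t. t * t) ` {- MK..MK} \<subseteq> {0..MK\<^sup>2}" by auto
    qed (intro continuous_intros)
    ultimately show ?thesis using spectral_bound_mono M2(2) by auto
  qed
  have PKS': "spectral_bound KS (- M2) M2" using spectral_bound_mono[OF PKS] M2(3) by simp
  have fKS: "fcal (- M2) M2 KS f x = 0" for x
  proof -
    have "fcal (- M2) M2 KS f x = fcal 0 M2 KS f x"
      by (rule fcal_interval[OF PKS _ _ cf]) (use M2 in auto)
    also have "norm \<dots> \<le> 4 * 0 * norm x" by (rule fcal_norm_le[OF PKS cf]) (auto simp: f_def)
    finally show ?thesis by simp
  qed
  (* w' f(- w w') = f(- w' w) w' transports the vanishing of f(KS) to L f(L) = - f(L)^2. *)
  have fL: "fcal (- M2) M2 L f x = 0" for x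
  proof -
    have "w' (fcal (- M2) M2 KS f (w x)) = fcal (- M2) M2 L f (w' (w x))"
      by (rule fcal_intertwine[OF PKS' PL cf adjoint_bounded_linear[OF w']])
        (simp add: KS_def KK L_def linear_neg[OF lw'])
    then have "fcal (- M2) M2 L f (L x) = 0"
      using linear_neg[OF fcal_linear[OF PL cf]] by (simp add: fKS L_def linear_0[OF lw'])
    then have "fcal (- M2) M2 L (\<lambda>t. f t * t) x = 0"
      by (simp add: fcal_mult[OF PL cf continuous_on_id] fcal_ident[OF PL])
    moreover have "fcal (- M2) M2 L (\<lambda>t. f t * t) x = fcal (- M2) M2 L (\<lambda>t. - (f t * f t)) x"
    proof (rule fcal_cong[OF PL])
      show "f t * t = - (f t * f t)" for t by (cases "t \<ge> 0") (auto simp: f_def)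
    qed (intro continuous_intros cf)
    moreover have "\<dots> = - fcal (- M2) M2 L f (fcal (- M2) M2 L f x)"
      unfolding fcal_minus[OF PL continuous_on_mult[OF cf cf]] fcal_mult[OF PL cf cf] ..
    ultimately have "fcal (- M2) M2 L f (fcal (- M2) M2 L f x) = 0" by simp
    then show ?thesis by (rule selfadj_square_zero[OF fcal_selfadj[OF PL cf]])
  qed
  have PL0: "spectral_bound L 0 M2"
    by (rule spectral_bound_nonneg[OF PL M2(3)]) (use fL in \<open>simp add: f_def[abs_def]\<close>)
  have accL: "accretive L"
  proof -
    have c: "continuous_on S sqrt" for S by (intro continuous_intros)
    have "fcal 0 M2 L sqrt (fcal 0 M2 L sqrt x) = L x" for x
    proof -
      have "fcal 0 M2 L sqrt (fcal 0 M2 L sqrt x) = fcal 0 M2 L (\<lambda>t. sqrt t * sqrt t) x"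
        by (rule fcal_mult[OF PL0 c c, symmetric])
      also have "\<dots> = fcal 0 M2 L (\<lambda>t. t) x"
        by (rule fcal_cong[OF PL0]) (auto intro!: continuous_intros)
      finally show ?thesis by (simp add: fcal_ident[OF PL0])
    qed
    then show ?thesis using accretive_square[OF fcal_selfadj[OF PL0 c]] by simp
  qed
  define N where "N x = w (w' x) + w' (w x)" for x
  have N: "selfadj N" unfolding N_def using adjoint_add[OF adjoint_comp[OF w w'] adjoint_comp[OF w' w]] .
  have N': "selfadj (\<lambda>x. - N x)" by (rule adjoint_minus[OF N])
  (* a and b are sqrt 2 times the real part and, up to sign, the imaginary part of w. *)
  have accN: "accretive N"
  proof -
    define a where "a x = (1 / sqrt 2) *\<^sub>R (w x + w' x)" for x
    define b where "b x = (1 / sqrt 2) *\<^sub>R (\<i> *\<^sub>C (w x - w' x))" for x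
    have a: "selfadj a"
      using adjoint_scaleR[OF adjoint_add[OF w w'], of "1 / sqrt 2"] by (simp add: a_def[abs_def] add.commute)
    have "is_adjoint E b (\<lambda>x. (1 / sqrt 2) *\<^sub>R (cnj \<i> *\<^sub>C (w' x - w x)))"
      unfolding b_def by (intro adjoint_scaleR adjoint_scaleC_op adjoint_diff w w')
    moreover have "cnj \<i> *\<^sub>C (w' x - w x) = \<i> *\<^sub>C (w x - w' x)" for x
      by (simp add: scaleC_minus_left scaleC_diff_right)
    ultimately have b: "selfadj b" by (simp add: b_def[abs_def])
    have "2 *\<^sub>R (a (a x) + b (b x)) = 2 *\<^sub>R N x" for x
    proof -
      have "2 *\<^sub>R a (a x) = w (w x) + w (w' x) + w' (w x) + w' (w' x)"
        by (simp add: a_def linear_add[OF lw] linear_add[OF lw'] linear_scale[OF lw] linear_scale[OF lw']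
            scaleR_add_right[symmetric])
      moreover have "2 *\<^sub>R b (b x) = - (w (w x)) + w (w' x) + w' (w x) - w' (w' x)"
        by (simp add: b_def linear_diff[OF lw] linear_diff[OF lw'] linear_scale[OF lw] linear_scale[OF lw']
            scaleR_diff_right[symmetric] adjoint_scaleC[OF w] adjoint_scaleC[OF w'] scaleC_scaleR
            scaleC_diff_right scaleC_ii_ii)
      ultimately show ?thesis by (simp add: scaleR_add_right N_def scaleR_2)
    qed
    then have "N = (\<lambda>x. a (a x) + b (b x))" by (auto simp del: scaleR_add_right)
    then show ?thesis using accretive_add[OF accretive_square[OF a] accretive_square[OF b]] by simp
  qed
  have accN': "accretive (\<lambda>x. - N x)"
  proof -
    have "(\<lambda>x. - N x) = (\<lambda>x. K (K x) + L x)" by (simp add: N_def KK L_def fun_eq_iff)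
    then show ?thesis using accretive_add[OF accretive_square[OF K] accL] by simp
  qed
  define MN where "MN = onorm N + onorm (\<lambda>x. - N x) + 1"
  have MN: "onorm N \<le> MN" "onorm (\<lambda>x. - N x) \<le> MN" "MN > 0"
    using onorm_pos_le[OF adjoint_bounded_linear[OF N]] onorm_pos_le[OF adjoint_bounded_linear[OF N']]
    by (auto simp: MN_def)
  have "N x = 0" for x
    by (rule spectral_bound_both_zero[OF accretive_spectral_bound[OF N MN(1,3) accN]
          accretive_spectral_bound[OF N' MN(2,3) accN'] MN(3)])
  then have "(\<lambda>x. - L x) = KS" by (auto simp: fun_eq_iff N_def L_def KS_def KK eq_neg_iff_add_eq_0 add.commute)
  then have "L x = 0" for x using spectral_bound_both_zero[OF PL0 _ M2(3)] PKS by simp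
  then have "KS x = 0" for x using \<open>(\<lambda>x. - L x) = KS\<close> by (metis neg_equal_zero minus_zero)
  then have K0: "K x = 0" for x by (rule selfadj_square_zero[OF K, unfolded KS_def[symmetric]])
  have c2: "continuous_on S (\<lambda>t. f t * f t)" for S by (intro continuous_intros cf)
  have "?\<Phi> (\<lambda>t. f t * f t) (?\<Phi> (\<lambda>t. f t * f t) x) = 0" for x
  proof -
    have c: "continuous_on {-M..M} (\<lambda>t. f t * f t * sqrt (f t))" by (intro continuous_intros cf)
    have "?\<Phi> (\<lambda>t. f t * f t) (?\<Phi> (\<lambda>t. f t * f t) x) = ?\<Phi> (\<lambda>t. (f t * f t) * (f t * f t)) x"
      by (rule fcal_mult[OF P c2 c2, symmetric])
    also have "\<dots> = ?\<Phi> (\<lambda>t. (f t * sqrt (f t)) * (f t * f t * sqrt (f t))) x"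
      by (rule fcal_cong[OF P]) (auto intro!: continuous_intros cf simp: f0 mult_ac real_sqrt_mult[symmetric])
    also have "\<dots> = K (?\<Phi> (\<lambda>t. f t * f t * sqrt (f t)) x)"
      unfolding K_def by (rule fcal_mult[OF P cK c])
    finally show ?thesis by (simp add: K0)
  qed
  then have "?\<Phi> (\<lambda>t. f t * f t) x = 0" for x
    using selfadj_square_zero[OF fcal_selfadj[OF P c2]] by blast
  then have "?\<Phi> f (?\<Phi> f x) = 0" for x by (simp add: fcal_mult[OF P cf cf])
  then have "?\<Phi> f x = 0" for x
    using selfadj_square_zero[OF fcal_selfadj[OF P cf]] by blast
  then have "spectral_bound H 0 M"
    by (intro spectral_bound_nonneg[OF P M(2)]) (simp add: f_def[abs_def])
  then show ?thesis by (simp add: H_def[abs_def])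
qed

end

section \<open>Powers of positive operators and domination\<close>

lemma rpow_0 [simp]: "rpow 0 t = 1"
  by (simp add: rpow_def)

lemma rpow_nonneg: "0 \<le> rpow r t"
  by (simp add: rpow_def)

lemma rpow_1: "0 \<le> t \<Longrightarrow> rpow 1 t = t"
  by (simp add: rpow_def)

lemma rpow_pos: "0 < t \<Longrightarrow> rpow r t = t powr r"
  by (simp add: rpow_def)

lemma rpow_add: "0 \<le> r \<Longrightarrow> 0 \<le> s \<Longrightarrow> 0 \<le> t \<Longrightarrow> rpow (r + s) t = rpow r t * rpow s t"
  by (auto simp: rpow_def powr_add)

lemma rpow_mono: "0 \<le> r \<Longrightarrow> 0 \<le> t \<Longrightarrow> t \<le> u \<Longrightarrow> rpow r t \<le> rpow r u"
  by (auto simp: rpow_def intro: powr_mono2)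

lemma continuous_on_rpow: "0 \<le> r \<Longrightarrow> continuous_on {0..u} (rpow r)"
proof (cases "r = 0")
  case False
  assume "0 \<le> r"
  then have "continuous_on {0..u} (\<lambda>t. t powr r)"
    using False by (intro continuous_on_powr' continuous_intros) auto
  then show ?thesis using False by (simp add: rpow_def[abs_def])
qed (simp add: rpow_def[abs_def])

lemma rpow_le_linear:
  assumes "0 \<le> r" "r \<le> 1" "0 < \<epsilon>" "0 \<le> t"
  shows "rpow r t \<le> \<epsilon> powr r + \<epsilon> powr (r - 1) * t"
proof (cases "t \<le> \<epsilon>")
  case True
  then have "rpow r t \<le> \<epsilon> powr r" using rpow_mono[OF assms(1,4) True] assms(3) by (simp add: rpow_pos)
  then show ?thesis using assms(4) by (simp add: add_increasing2)
next
  case False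
  then have t: "t > 0" using assms(3) by simp
  have "t powr r = t powr (r - 1) * t" using t powr_mult_base[of t "r - 1"] by (simp add: mult.commute)
  also have "\<dots> \<le> \<epsilon> powr (r - 1) * t"
    using False assms t by (intro mult_right_mono powr_mono2') auto
  finally show ?thesis using t by (simp add: rpow_pos add_increasing)
qed

text \<open>For \<open>T = h\<^sup>r\<close> with \<open>h = \<langle>D\<rangle>\<^sup>-\<^sup>1\<close>, this says that \<open>J \<langle>D\<rangle>\<^sup>r\<close> is bounded.\<close>

definition dominated :: "('e::real_normed_vector \<Rightarrow> 'f::real_normed_vector) \<Rightarrow> ('e \<Rightarrow> 'g::real_normed_vector) \<Rightarrow> bool" where
  "dominated J T \<longleftrightarrow> (\<exists>C\<ge>0. \<forall>x. norm (J x) \<le> C * norm (T x))"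

lemma dominatedI: "(\<And>x. norm (J x) \<le> C * norm (T x)) \<Longrightarrow> dominated J T"
  unfolding dominated_def
  by (rule exI[of _ "\<bar>C\<bar>"]) (meson abs_ge_self abs_ge_zero mult_right_mono norm_ge_zero order_trans)

lemma dominatedE:
  assumes "dominated J T"
  obtains C where "0 \<le> C" "\<And>x. norm (J x) \<le> C * norm (T x)"
  using assms unfolding dominated_def by blast

lemma dominated_refl: "dominated T T"
  by (rule dominatedI[of _ 1]) simp

lemma dominated_trans: "dominated J T \<Longrightarrow> dominated T U \<Longrightarrow> dominated J U"
proof -
  assume "dominated J T" "dominated T U"
  then obtain C C' where C: "0 \<le> C" "\<And>x. norm (J x) \<le> C * norm (T x)" and C': "\<And>x. norm (T x) \<le> C' * norm (U x)"
    unfolding dominated_def by blast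
  have "norm (J x) \<le> (C * C') * norm (U x)" for x
    using C(2)[of x] mult_left_mono[OF C'[of x] C(1)] by (simp add: mult.assoc)
  then show ?thesis by (rule dominatedI)
qed

lemma dominated_add: "dominated J T \<Longrightarrow> dominated J' T \<Longrightarrow> dominated (\<lambda>x. J x + J' x) T"
proof -
  assume "dominated J T" "dominated J' T"
  then obtain C C' where C: "\<And>x. norm (J x) \<le> C * norm (T x)" and C': "\<And>x. norm (J' x) \<le> C' * norm (T x)"
    unfolding dominated_def by blast
  have "norm (J x + J' x) \<le> (C + C') * norm (T x)" for x
    using C[of x] C'[of x] norm_triangle_ineq[of "J x" "J' x"] by (simp add: algebra_simps)
  then show ?thesis by (rule dominatedI)
qed

lemma dominated_minus: "dominated J T \<Longrightarrow> dominated (\<lambda>x. - J x) T"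
  by (simp add: dominated_def)

lemma dominated_diff: "dominated J T \<Longrightarrow> dominated J' T \<Longrightarrow> dominated (\<lambda>x. J x - J' x) T"
  using dominated_add[of J T "\<lambda>x. - J' x"] dominated_minus[of J' T] by simp

lemma dominated_left: "bounded_linear A \<Longrightarrow> dominated J T \<Longrightarrow> dominated (\<lambda>x. A (J x)) T"
proof -
  assume A: "bounded_linear A" and "dominated J T"
  then obtain C where C: "\<And>x. norm (J x) \<le> C * norm (T x)" unfolding dominated_def by blast
  obtain B where B: "\<And>x. norm (A x) \<le> norm x * B" "0 \<le> B" using bounded_linear.nonneg_bounded[OF A] by blast
  have "norm (A (J x)) \<le> (C * B) * norm (T x)" for x
    using B(1)[of "J x"] mult_right_mono[OF C[of x] B(2)] by (simp add: mult_ac)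
  then show ?thesis by (rule dominatedI)
qed

lemma dominated_right: "dominated J T \<Longrightarrow> dominated (\<lambda>x. J (S x)) (\<lambda>x. T (S x))"
  unfolding dominated_def by blast

subsection \<open>Geometric bands\<close>

definition band_ratio :: real where "band_ratio = 32 / 33"

text \<open>Rises from \<open>0\<close> to \<open>1\<close> between \<open>M r\<^sup>k\<^sup>+\<^sup>1\<close> and \<open>M r\<^sup>k\<close>, where \<open>r\<close> is the ratio.\<close>

definition ramp :: "real \<Rightarrow> nat \<Rightarrow> real \<Rightarrow> real" where
  "ramp M k t = min 1 (max 0 ((t - M * band_ratio ^ Suc k) / (M * band_ratio ^ k - M * band_ratio ^ Suc k)))"

definition band :: "real \<Rightarrow> nat \<Rightarrow> real \<Rightarrow> real" where
  "band M k t = (case k of 0 \<Rightarrow> ramp M 0 t | Suc j \<Rightarrow> ramp M (Suc j) t - ramp M j t)"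

lemma band_ratio: "0 < band_ratio" "band_ratio < 1"
  by (simp_all add: band_ratio_def)

lemma ramp_gap: "M > 0 \<Longrightarrow> 0 < M * band_ratio ^ k - M * band_ratio ^ Suc k"
  using band_ratio by simp

lemma ramp_bounds: "0 \<le> ramp M k t" "ramp M k t \<le> 1"
  by (auto simp: ramp_def)

lemma ramp_eq_0: "M > 0 \<Longrightarrow> t \<le> M * band_ratio ^ Suc k \<Longrightarrow> ramp M k t = 0"
  using ramp_gap[of M k] by (simp add: ramp_def divide_nonpos_pos max_absorb1)

lemma ramp_eq_1: "M > 0 \<Longrightarrow> M * band_ratio ^ k \<le> t \<Longrightarrow> ramp M k t = 1"
proof -
  assume M: "M > 0" and t: "M * band_ratio ^ k \<le> t"
  have "1 \<le> (t - M * band_ratio ^ Suc k) / (M * band_ratio ^ k - M * band_ratio ^ Suc k)"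
    unfolding le_divide_eq using ramp_gap[OF M, of k] t by simp
  then show ?thesis by (simp add: ramp_def)
qed

lemma ramp_mono: "M > 0 \<Longrightarrow> ramp M k t \<le> ramp M (Suc k) t"
  by (cases "t \<le> M * band_ratio ^ Suc k") (auto simp: ramp_eq_0 ramp_eq_1 ramp_bounds)

lemma continuous_on_ramp: "continuous_on S (ramp M k)" if "M > 0" for S
proof -
  have "M * band_ratio ^ k - M * band_ratio ^ Suc k \<noteq> 0" using ramp_gap[OF that, of k] by linarith
  then show ?thesis unfolding ramp_def by (intro continuous_intros) blast
qed

lemma continuous_on_band: "M > 0 \<Longrightarrow> continuous_on S (band M k)"
  unfolding band_def by (cases k) (auto intro!: continuous_on_diff continuous_on_ramp)

lemma band_bounds: "M > 0 \<Longrightarrow> 0 \<le> band M k t" "M > 0 \<Longrightarrow> band M k t \<le> 1"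
  using ramp_mono[of M "k - 1" t] ramp_bounds[of M k t] ramp_bounds[of M "k - 1" t]
  by (auto simp: band_def split: nat.splits)

lemma band_support:
  assumes M: "M > 0" and t: "t \<le> M" and nz: "band M k t \<noteq> 0"
  shows "band_ratio * (M * band_ratio ^ k) \<le> t" and "band_ratio * t \<le> M * band_ratio ^ k"
proof -
  have "M * band_ratio ^ Suc k < t"
  proof (rule ccontr)
    assume "\<not> ?thesis"
    then have 1: "t \<le> M * band_ratio ^ Suc k" by simp
    moreover have "t \<le> M * band_ratio ^ k" using 1 ramp_gap[OF M, of k] by simp
    ultimately show False using nz M by (cases k) (auto simp: band_def ramp_eq_0 simp del: power_Suc)
  qed
  then show "band_ratio * (M * band_ratio ^ k) \<le> t" by (simp add: mult.left_commute)
  show "band_ratio * t \<le> M * band_ratio ^ k"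
  proof (cases k)
    case 0
    have "band_ratio * t \<le> band_ratio * M" using t band_ratio by (intro mult_left_mono) auto
    also have "\<dots> \<le> M" using band_ratio M mult_right_mono[of band_ratio 1 M] by simp
    finally show ?thesis using 0 by simp
  next
    case (Suc j)
    have "t < M * band_ratio ^ j"
    proof (rule ccontr)
      assume "\<not> ?thesis"
      then have "M * band_ratio ^ j \<le> t" "M * band_ratio ^ Suc j \<le> t" using ramp_gap[OF M, of j] by auto
      then show False using nz M Suc by (auto simp: band_def ramp_eq_1 simp del: power_Suc)
    qed
    then show ?thesis using Suc band_ratio by (simp add: mult.left_commute)
  qed
qed

lemma sum_band: "(\<Sum>k\<le>n. band M k t) = ramp M n t"
  by (induction n) (simp_all add: band_def)

text \<open>On a band, \<open>(\<sigma> - t) / (\<sigma> + t)\<close> is small; this fixes the choice of the ratio.\<close>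

lemma band_cayley_small:
  assumes M: "M > 0" and t: "0 \<le> t" "t \<le> M" and nz: "band M k t \<noteq> 0" and \<sigma>: "\<sigma> = M * band_ratio ^ k"
  shows "\<bar>(\<sigma> - t) / (\<sigma> + t)\<bar> \<le> 1 / 32"
proof -
  have "band_ratio * \<sigma> \<le> t" "band_ratio * t \<le> \<sigma>" using band_support[OF M t(2) nz] \<sigma> by auto
  moreover have "\<sigma> > 0" using M band_ratio by (simp add: \<sigma>)
  ultimately have "32 * \<sigma> \<le> 33 * t" "32 * t \<le> 33 * \<sigma>" "\<sigma> > 0" by (simp_all add: band_ratio_def)
  then have "32 * \<bar>\<sigma> - t\<bar> \<le> \<sigma> + t" by (simp add: abs_if)
  then show ?thesis using \<open>\<sigma> > 0\<close> t by (simp add: abs_divide divide_le_eq)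
qed

context hilbert_module
begin

abbreviation pw :: "real \<Rightarrow> ('e \<Rightarrow> 'e) \<Rightarrow> real \<Rightarrow> 'e \<Rightarrow> 'e" where
  "pw M P r \<equiv> fcal 0 M P (rpow r)"

lemma fcal_bounded_linear: "spectral_bound P l u \<Longrightarrow> continuous_on {l..u} f \<Longrightarrow> bounded_linear (fcal l u P f)"
  by (rule adjoint_bounded_linear[OF fcal_selfadj])

lemma fcal_sum:
  assumes P: "spectral_bound P l u" and f: "\<And>i. i \<in> I \<Longrightarrow> continuous_on {l..u} (f i)"
  shows "fcal l u P (\<lambda>t. \<Sum>i\<in>I. f i t) x = (\<Sum>i\<in>I. fcal l u P (f i) x)"
  using f
proof (induction I rule: infinite_finite_induct)
  case (insert i I)
  then show ?case by (simp add: fcal_add[OF P] continuous_on_sum)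
qed (simp_all add: fcal_const[OF P])

lemma pw_add:
  assumes "spectral_bound P 0 M" "0 \<le> r" "0 \<le> s"
  shows "pw M P (r + s) x = pw M P r (pw M P s x)"
proof -
  have "pw M P (r + s) x = fcal 0 M P (\<lambda>t. rpow r t * rpow s t) x"
    by (rule fcal_cong[OF assms(1)]) (use assms in \<open>auto intro!: continuous_on_rpow rpow_add\<close>)
  then show ?thesis using assms by (simp add: fcal_mult continuous_on_rpow)
qed

lemma pw_1: "spectral_bound P 0 M \<Longrightarrow> pw M P 1 x = P x"
  using fcal_cong[of P 0 M "rpow 1" "\<lambda>t. t" x] by (simp add: continuous_on_rpow rpow_1 fcal_ident)

lemma pw_bounded_linear: "spectral_bound P 0 M \<Longrightarrow> 0 \<le> r \<Longrightarrow> bounded_linear (pw M P r)"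
  by (intro fcal_bounded_linear continuous_on_rpow)

lemma pw_selfadj: "spectral_bound P 0 M \<Longrightarrow> 0 \<le> r \<Longrightarrow> selfadj (pw M P r)"
  by (intro fcal_selfadj continuous_on_rpow)

lemma pw_dominated_mono:
  assumes "spectral_bound P 0 M" "0 \<le> r'" "r' \<le> r"
  shows "dominated (pw M P r) (pw M P r')"
proof -
  have "pw M P r = (\<lambda>x. pw M P (r - r') (pw M P r' x))"
    using pw_add[OF assms(1), of "r - r'" r'] assms by auto
  then show ?thesis
    using dominated_left[OF pw_bounded_linear[OF assms(1), of "r - r'"] dominated_refl] assms by simp
qed

lemma pw_interpolation_le:
  assumes P: "spectral_bound P 0 M" and r: "0 \<le> r" "r \<le> 1" and \<epsilon>: "0 < \<epsilon>"
  shows "norm (pw M P r x) \<le> 4 * (\<epsilon> powr r * norm x + \<epsilon> powr (r - 1) * norm (P x))"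
proof -
  define d where "d t = \<epsilon> powr r + \<epsilon> powr (r - 1) * t" for t
  define m where "m t = rpow r t / d t" for t
  have d: "d t > 0" if "t \<in> {0..M}" for t using that \<epsilon> by (auto simp: d_def intro!: add_pos_nonneg)
  have cd: "continuous_on {0..M} d" unfolding d_def by (intro continuous_intros)
  have cm: "continuous_on {0..M} m" unfolding m_def
    by (intro continuous_on_divide continuous_on_rpow r cd) (use d in force)
  have "pw M P r x = fcal 0 M P (\<lambda>t. m t * d t) x"
    by (rule fcal_cong[OF P]) (use r d in \<open>force intro!: continuous_on_rpow simp: m_def\<close>)+
  also have "\<dots> = fcal 0 M P m (fcal 0 M P d x)" by (rule fcal_mult[OF P cm cd])
  also have "norm \<dots> \<le> 4 * 1 * norm (fcal 0 M P d x)"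
  proof (rule fcal_norm_le[OF P cm])
    fix t assume t: "t \<in> {0..M}"
    then show "\<bar>m t\<bar> \<le> 1"
      using rpow_le_linear[OF r \<epsilon>, of t] d[OF t] rpow_nonneg[of r t] by (simp add: m_def d_def)
  qed
  also have "fcal 0 M P d x = \<epsilon> powr r *\<^sub>R x + \<epsilon> powr (r - 1) *\<^sub>R P x"
    unfolding d_def
    by (subst fcal_add[OF P], intro continuous_intros, intro continuous_intros,
        subst fcal_cmult[OF P], intro continuous_intros, simp add: fcal_const[OF P] fcal_ident[OF P])
  also have "norm \<dots> \<le> \<epsilon> powr r * norm x + \<epsilon> powr (r - 1) * norm (P x)"
    using norm_triangle_ineq[of "\<epsilon> powr r *\<^sub>R x" "\<epsilon> powr (r - 1) *\<^sub>R P x"] by simp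
  finally show ?thesis by simp
qed

lemma band_fcal_le:
  assumes P: "spectral_bound P 0 M" and M: "M > 0" and f: "continuous_on {0..M} f"
    and s: "\<And>t. \<lbrakk>0 \<le> t; t \<le> M; band_ratio * (M * band_ratio ^ k) \<le> t; band_ratio * t \<le> M * band_ratio ^ k\<rbrakk> \<Longrightarrow> \<bar>f t\<bar> \<le> s"
    and "0 \<le> s"
  shows "norm (fcal 0 M P (\<lambda>t. f t * band M k t) x) \<le> 4 * s * norm x"
proof (rule fcal_norm_le[OF P])
  fix t assume t: "t \<in> {0..M}"
  show "\<bar>f t * band M k t\<bar> \<le> s"
  proof (cases "band M k t = 0")
    case False
    have "\<bar>f t\<bar> \<le> s" using t band_support[OF M _ False] by (intro s) auto
    then have "\<bar>f t\<bar> * \<bar>band M k t\<bar> \<le> s * 1"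
      using band_bounds[OF M, of k t] assms(5) by (intro mult_mono) auto
    then show ?thesis by (simp add: abs_mult)
  qed (use assms(5) in simp)
qed (intro continuous_intros f continuous_on_band M)

text \<open>
  An estimate of order \<open>\<sigma>\<^sup>r\<close> on every band is an estimate by \<open>P\<^sup>r\<^sup>'\<close> for each \<open>r' < r\<close>: on a band
  \<open>P\<close> is comparable to \<open>\<sigma>\<close>, and the bounds \<open>\<sigma>\<^sup>r\<^sup>-\<^sup>r\<^sup>'\<close> form a convergent geometric series.
\<close>

lemma band_dominated:
  assumes P: "spectral_bound P 0 M" and M: "M > 0" and dense: "closure (range P) = UNIV"
    and J: "bounded_linear J"
    and bd: "\<And>k x. norm (J (fcal 0 M P (band M k) x)) \<le> C * (M * band_ratio ^ k) powr r * norm x"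
    and r: "0 \<le> r'" "r' < r"
  shows "dominated J (pw M P r')"
proof -
  define \<theta> where "\<theta> = band_ratio"
  have \<theta>: "0 < \<theta>" "\<theta> < 1" using band_ratio by (auto simp: \<theta>_def)
  define \<sigma> where "\<sigma> k = M * \<theta> ^ k" for k
  have \<sigma>: "\<sigma> k > 0" for k using M \<theta> by (simp add: \<sigma>_def)
  define C1 where "C1 = \<bar>C\<bar> * 4 * \<theta> powr (- r') * M powr (r - r')"
  define \<rho> where "\<rho> = \<theta> powr (r - r')"
  have \<rho>: "0 < \<rho>" "\<rho> < 1" using \<theta> r powr01_less_one[of \<theta> "r - r'"] by (auto simp: \<rho>_def)
  have C1: "0 \<le> C1" by (simp add: C1_def)
  have step: "norm (J (fcal 0 M P (band M k) x)) \<le> C1 * \<rho> ^ k * norm (pw M P r' x)" for k x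
  proof -
    (* equals t powr (- r') on the band, and is bounded everywhere *)
    define w where "w t = (max t (\<theta> * \<sigma> k)) powr (- r')" for t
    have mx: "max t (\<theta> * \<sigma> k) > 0" for t using \<theta> \<sigma>[of k] by (simp add: less_max_iff_disj)
    have cw: "continuous_on S w" for S
      unfolding w_def by (intro continuous_intros) (use mx in \<open>auto simp: less_imp_neq[symmetric]\<close>)
    have cb: "continuous_on S (band M k)" for S by (rule continuous_on_band[OF M])
    have cr: "continuous_on {0..M} (rpow r')" by (intro continuous_on_rpow r)
    have "fcal 0 M P (band M k) x = fcal 0 M P (\<lambda>t. band M k t * (w t * rpow r' t)) x"
    proof (rule fcal_cong[OF P cb])
      fix t assume t: "t \<in> {0..M}"
      show "band M k t = band M k t * (w t * rpow r' t)"
      proof (cases "band M k t = 0")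
        case False
        have ge: "\<theta> * \<sigma> k \<le> t" using band_support(1)[OF M _ False] t by (simp add: \<theta>_def \<sigma>_def)
        moreover have "t > 0" using ge \<theta> \<sigma>[of k] mult_pos_pos[of \<theta> "\<sigma> k"] by linarith
        ultimately have "w t * rpow r' t = 1" by (simp add: w_def rpow_pos powr_minus max_absorb1)
        then show ?thesis by simp
      qed simp
    qed
    also have "\<dots> = fcal 0 M P (band M k) (fcal 0 M P w (pw M P r' x))"
      unfolding fcal_mult[OF P cb continuous_on_mult[OF cw cr]] fcal_mult[OF P cw cr] ..
    finally have "norm (J (fcal 0 M P (band M k) x)) \<le> C * \<sigma> k powr r * norm (fcal 0 M P w (pw M P r' x))"
      using bd[of k "fcal 0 M P w (pw M P r' x)"] by (simp add: \<sigma>_def \<theta>_def)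
    also have "\<dots> \<le> (\<bar>C\<bar> * \<sigma> k powr r) * (4 * (\<theta> * \<sigma> k) powr (- r') * norm (pw M P r' x))"
    proof (rule mult_mono)
      show "norm (fcal 0 M P w (pw M P r' x)) \<le> 4 * (\<theta> * \<sigma> k) powr (- r') * norm (pw M P r' x)"
      proof (rule fcal_norm_le[OF P cw])
        fix t
        show "\<bar>w t\<bar> \<le> (\<theta> * \<sigma> k) powr (- r')"
          unfolding w_def using \<theta> \<sigma>[of k] r by (auto intro!: powr_mono2')
      qed
    qed (auto intro!: mult_right_mono)
    also have "\<dots> = (\<bar>C\<bar> * 4 * \<theta> powr (- r')) * (\<sigma> k powr r * \<sigma> k powr (- r')) * norm (pw M P r' x)"
      using \<theta> \<sigma>[of k] by (simp add: powr_mult)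
    also have "\<sigma> k powr r * \<sigma> k powr (- r') = \<sigma> k powr (r - r')" by (simp add: powr_add[symmetric])
    also have "\<dots> = M powr (r - r') * \<rho> ^ k"
      using M \<theta> by (simp add: \<sigma>_def \<rho>_def powr_mult powr_realpow[symmetric] powr_powr mult.commute)
    finally show ?thesis by (simp add: C1_def mult_ac)
  qed
  define C2 where "C2 = C1 / (1 - \<rho>)"
  have ramp: "norm (J (fcal 0 M P (ramp M n) x)) \<le> C2 * norm (pw M P r' x)" for n x
  proof -
    have "fcal 0 M P (ramp M n) x = fcal 0 M P (\<lambda>t. \<Sum>k\<le>n. band M k t) x"
      by (simp add: sum_band[abs_def])
    also have "\<dots> = (\<Sum>k\<le>n. fcal 0 M P (band M k) x)"
      by (intro fcal_sum[OF P] continuous_on_band M)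
    finally have "norm (J (fcal 0 M P (ramp M n) x)) \<le> (\<Sum>k\<le>n. norm (J (fcal 0 M P (band M k) x)))"
      using linear_sum[OF bounded_linear.linear[OF J]] norm_sum by metis
    also have "\<dots> \<le> (\<Sum>k\<le>n. C1 * norm (pw M P r' x) * \<rho> ^ k)"
      by (rule sum_mono) (use step in \<open>simp add: mult_ac\<close>)
    also have "\<dots> = C1 * norm (pw M P r' x) * (\<Sum>k\<le>n. \<rho> ^ k)" by (simp add: sum_distrib_left)
    also have "\<dots> \<le> C1 * norm (pw M P r' x) * (1 / (1 - \<rho>))"
    proof (rule mult_left_mono)
      have "(\<Sum>k\<le>n. \<rho> ^ k) \<le> (\<Sum>k. \<rho> ^ k)"
        using \<rho> by (intro sum_le_suminf summable_geometric) auto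
      then show "(\<Sum>k\<le>n. \<rho> ^ k) \<le> 1 / (1 - \<rho>)" using \<rho> by (simp add: suminf_geometric)
    qed (use C1 in simp)
    finally show ?thesis by (simp add: C2_def mult_ac)
  qed
  have main: "norm (J (P z)) \<le> C2 * norm (pw M P r' (P z))" for z
  proof -
    have cr: "continuous_on {0..M} (ramp M n)" for n by (rule continuous_on_ramp[OF M])
    have "norm (P z - fcal 0 M P (ramp M n) (P z)) \<le> 4 * norm z * \<sigma> n" for n
    proof -
      have c: "continuous_on {0..M} (\<lambda>t. (1 - ramp M n t) * t)" by (intro continuous_intros cr)
      have "fcal 0 M P (\<lambda>t. (1 - ramp M n t) * t) z = fcal 0 M P (\<lambda>t. 1 - ramp M n t) (P z)"
        using fcal_mult[OF P _ continuous_on_id, of "\<lambda>t. 1 - ramp M n t" z] cr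
        by (simp add: fcal_ident[OF P] continuous_on_diff)
      also have "\<dots> = P z - fcal 0 M P (ramp M n) (P z)"
        using fcal_diff[OF P continuous_on_const[of "{0..M}" 1] cr, of n "P z"] by (simp add: fcal_const[OF P])
      finally have "norm (P z - fcal 0 M P (ramp M n) (P z)) = norm (fcal 0 M P (\<lambda>t. (1 - ramp M n t) * t) z)" by simp
      also have "\<dots> \<le> 4 * \<sigma> n * norm z"
      proof (rule fcal_norm_le[OF P c])
        fix t assume t: "t \<in> {0..M}"
        show "\<bar>(1 - ramp M n t) * t\<bar> \<le> \<sigma> n"
        proof (cases "\<sigma> n \<le> t")
          case True
          then have "ramp M n t = 1" by (intro ramp_eq_1[OF M]) (simp add: \<sigma>_def \<theta>_def)
          then show ?thesis using \<sigma>[of n] by simp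
        next
          case False
          have "\<bar>1 - ramp M n t\<bar> * \<bar>t\<bar> \<le> 1 * \<bar>t\<bar>"
            using ramp_bounds[of M n t] by (intro mult_right_mono) auto
          then show ?thesis using False t by (simp add: abs_mult)
        qed
      qed
      finally show ?thesis by (simp add: mult_ac)
    qed
    moreover have "(\<lambda>n. 4 * norm z * \<sigma> n) \<longlonglongrightarrow> 4 * norm z * (M * 0)"
      unfolding \<sigma>_def using \<theta> by (intro tendsto_intros LIMSEQ_realpow_zero) auto
    ultimately have "(\<lambda>n. P z - fcal 0 M P (ramp M n) (P z)) \<longlonglongrightarrow> 0"
      using Lim_null_comparison[of "\<lambda>n. P z - fcal 0 M P (ramp M n) (P z)" "\<lambda>n. 4 * norm z * \<sigma> n" sequentially]
      by simp
    from tendsto_diff[OF tendsto_const[of "P z"] this] have "(\<lambda>n. fcal 0 M P (ramp M n) (P z)) \<longlonglongrightarrow> P z" by simp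
    then have "(\<lambda>n. norm (J (fcal 0 M P (ramp M n) (P z)))) \<longlonglongrightarrow> norm (J (P z))"
      by (intro tendsto_norm bounded_linear.tendsto[OF J])
    then show ?thesis by (rule LIMSEQ_le_const2) (use ramp in auto)
  qed
  have "closed {x. norm (J x) \<le> C2 * norm (pw M P r' x)}"
    using r by (intro closed_Collect_le continuous_intros linear_continuous_on J pw_bounded_linear P)
  then have "closure (range P) \<subseteq> {x. norm (J x) \<le> C2 * norm (pw M P r' x)}"
    by (intro closure_minimal) (use main in auto)
  then have "norm (J x) \<le> C2 * norm (pw M P r' x)" for x using dense by auto
  then show ?thesis by (rule dominatedI)
qed

lemma band_power_le:
  assumes P: "spectral_bound P 0 M" and M: "M > 0"
  shows "norm (P (fcal 0 M P (band M k) x)) \<le> 4 * (M * band_ratio ^ k / band_ratio) * norm x"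
proof -
  have "P (fcal 0 M P (band M k) x) = fcal 0 M P (\<lambda>t. t * band M k t) x"
    unfolding fcal_mult[OF P continuous_on_id continuous_on_band[OF M]] fcal_ident[OF P] ..
  also have "norm \<dots> \<le> 4 * (M * band_ratio ^ k / band_ratio) * norm x"
    by (rule band_fcal_le[OF P M continuous_on_id]) (use M band_ratio in \<open>auto simp: field_simps\<close>)
  finally show ?thesis .
qed

text \<open>
  Heinz-type interpolation with a loss in the exponent: on a band of \<open>P\<close>, where \<open>P\<close> is of size
  \<open>\<sigma>\<close>, the bounds for \<open>T\<close> and \<open>Q T\<close> combine to a bound of size \<open>\<sigma>\<^sup>r\<close> for \<open>Q\<^sup>r T\<close>.
\<close>

theorem dominated_interpolation:
  assumes P: "spectral_bound P 0 M" and M: "M > 0" and dense: "closure (range P) = UNIV"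
    and Q: "spectral_bound Q 0 M'" and T: "bounded_linear T"
    and dom: "dominated (\<lambda>x. Q (T x)) P" and r: "0 \<le> r'" "r' < r" "r \<le> 1"
  shows "dominated (\<lambda>x. pw M' Q r (T x)) (pw M P r')"
proof -
  obtain C where C: "0 \<le> C" "\<And>x. norm (Q (T x)) \<le> C * norm (P x)" using dominatedE[OF dom] by blast
  obtain B where B: "\<And>x. norm (T x) \<le> norm x * B" "0 \<le> B" using bounded_linear.nonneg_bounded[OF T] by blast
  have r0: "0 \<le> r" using r by simp
  show ?thesis
  proof (rule band_dominated[OF P M dense _ _ r(1,2)])
    show "bounded_linear (\<lambda>x. pw M' Q r (T x))"
      using bounded_linear_compose[OF pw_bounded_linear[OF Q r0] T] .
  next
    fix k x
    let ?y = "fcal 0 M P (band M k) x"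
    define \<sigma> where "\<sigma> = M * band_ratio ^ k"
    have \<sigma>: "\<sigma> > 0" using M band_ratio by (simp add: \<sigma>_def)
    have y: "norm ?y \<le> 4 * 1 * norm x"
      by (rule fcal_norm_le[OF P continuous_on_band[OF M]]) (use band_bounds[OF M] in auto)
    have "norm (pw M' Q r (T ?y)) \<le> 4 * (\<sigma> powr r * norm (T ?y) + \<sigma> powr (r - 1) * norm (Q (T ?y)))"
      by (rule pw_interpolation_le[OF Q r0 r(3) \<sigma>])
    also have "\<dots> \<le> 4 * (\<sigma> powr r * (4 * B * norm x) + \<sigma> powr (r - 1) * (C * (4 * (\<sigma> / band_ratio) * norm x)))"
    proof (intro mult_left_mono add_mono)
      show "norm (T ?y) \<le> 4 * B * norm x"
        using B(1)[of ?y] mult_right_mono[OF y B(2)] by (simp add: mult_ac)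
      have "norm (Q (T ?y)) \<le> C * norm (P ?y)" by (rule C)
      also have "\<dots> \<le> C * (4 * (\<sigma> / band_ratio) * norm x)"
        unfolding \<sigma>_def by (intro mult_left_mono band_power_le[OF P M] C)
      finally show "norm (Q (T ?y)) \<le> C * (4 * (\<sigma> / band_ratio) * norm x)" .
    qed auto
    also have "\<dots> = (16 * B + 16 * C / band_ratio) * \<sigma> powr r * norm x"
      using \<sigma> powr_mult_base[of \<sigma> "r - 1"] by (simp add: field_simps powr_diff)
    finally show "norm (pw M' Q r (T ?y)) \<le> (16 * B + 16 * C / band_ratio) * (M * band_ratio ^ k) powr r * norm x"
      by (simp add: \<sigma>_def)
  qed
qed

text \<open>
  Solutions of the Sylvester equation \<open>A Y + Y P = A \<Omega>\<close> inherit the bound on \<open>\<Omega>\<close>. For \<open>A = \<langle>D\<^sub>1\<rangle>\<^sup>-\<^sup>1\<close>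
  and \<open>P\<^sup>-\<^sup>1\<close> in place of \<open>P\<close> it is \<open>\<langle>D\<^sub>1\<rangle> Y + Y P = \<Omega> P\<close>, with both operators unbounded. The equation
  is equivalent to
  \<open>(\<sigma> + A) Y (\<sigma> + P) - (\<sigma> - A) Y (\<sigma> - P) = 2 \<sigma> A \<Omega>\<close>, and on the band of \<open>P\<close> around \<open>\<sigma>\<close> the factor
  \<open>(\<sigma> - P) (\<sigma> + P)\<^sup>-\<^sup>1\<close> is so small that the second term can be absorbed by the first.
\<close>

theorem sylvester_dominated:
  assumes A: "spectral_bound A 0 M'" and P: "spectral_bound P 0 M" and M: "M > 0"
    and dense: "closure (range P) = UNIV"
    and Y: "bounded_linear Y" and eq: "\<And>x. A (Y x) + Y (P x) = A (\<Omega> x)"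
    and dom: "dominated \<Omega> (pw M P r)" and r: "0 \<le> r'" "r' < r"
  shows "dominated Y (pw M P r')"
proof -
  obtain C where C: "0 \<le> C" "\<And>x. norm (\<Omega> x) \<le> C * norm (pw M P r x)" using dominatedE[OF dom] by blast
  note lA = spectral_bound_linear[OF A] and lP = spectral_bound_linear[OF P] and lY = bounded_linear.linear[OF Y]
  have r0: "0 \<le> r" using r by simp
  show ?thesis
  proof (rule band_dominated[OF P M dense Y _ r])
    fix k x
    let ?\<Phi> = "fcal 0 M P" and ?\<Psi> = "fcal 0 M' A"
    define \<sigma> where "\<sigma> = M * band_ratio ^ k"
    have \<sigma>: "\<sigma> > 0" using M band_ratio by (simp add: \<sigma>_def)
    define b where "b = band M k"
    have cb: "continuous_on S b" for S unfolding b_def by (rule continuous_on_band[OF M])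
    define c where "c t = (\<sigma> - t) / (\<sigma> + t)" for t
    (* the truncation agrees with c on the band *)
    define m where "m t = max (- (1/32)) (min (1/32) (c t))" for t
    define q where "q t = 1 / (\<sigma> + t)" for t
    have nz: "\<sigma> + t \<noteq> 0" if "t \<in> {0..u}" for t u using that \<sigma> by auto
    have cc: "continuous_on {0..u} c" "continuous_on {0..u} q" for u
      unfolding c_def q_def by (intro continuous_intros; use nz in blast)+
    have cm: "continuous_on {0..u} m" for u unfolding m_def by (intro continuous_intros cc)
    have Qb: "bounded_linear (\<lambda>x. Y (?\<Phi> b x))"
      using bounded_linear_compose[OF Y fcal_bounded_linear[OF P cb]] .
    define \<kappa> where "\<kappa> = onorm (\<lambda>x. Y (?\<Phi> b x))"
    have \<kappa>: "norm (Y (?\<Phi> b x)) \<le> \<kappa> * norm x" for x unfolding \<kappa>_def by (rule onorm[OF Qb])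
    have \<kappa>0: "0 \<le> \<kappa>" unfolding \<kappa>_def by (rule onorm_pos_le[OF Qb])
    define e where "e = 4 * C * 4 * (\<sigma> / band_ratio) powr r"
    have e0: "0 \<le> e" using C by (simp add: e_def)
    (* 1/2 = 4 * 4 / 32: two norm estimates with factor 4, and the size of c on the band *)
    have est: "norm (Y (?\<Phi> b x)) \<le> (\<kappa> / 2 + 2 * e) * norm x" for x
    proof -
      define z where "z = ?\<Phi> (\<lambda>t. q t * b t) x"
      have cqb: "continuous_on {0..M} (\<lambda>t. q t * b t)" by (intro continuous_intros cc cb)
      have tz: "P z = ?\<Phi> (\<lambda>t. t * (q t * b t)) x"
        unfolding z_def fcal_mult[OF P continuous_on_id cqb] fcal_ident[OF P] ..
      have ctz: "continuous_on {0..M} (\<lambda>t. t * (q t * b t))" by (intro continuous_intros cqb)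
      have plus: "\<sigma> *\<^sub>R z + P z = ?\<Phi> b x"
      proof -
        have "\<sigma> *\<^sub>R z + P z = ?\<Phi> (\<lambda>t. \<sigma> * (q t * b t) + t * (q t * b t)) x"
          unfolding tz fcal_add[OF P continuous_on_mult[OF continuous_on_const cqb] ctz] fcal_cmult[OF P cqb]
          by (simp add: z_def)
        also have "\<dots> = ?\<Phi> b x"
        proof (rule fcal_cong[OF P])
          fix t assume "t \<in> {0..M}"
          then have "(\<sigma> + t) * q t = 1" using nz by (simp add: q_def)
          then show "\<sigma> * (q t * b t) + t * (q t * b t) = b t"
            by (metis distrib_right mult.assoc mult_1)
        qed (intro continuous_intros cqb)
        finally show ?thesis .
      qed
      have minus: "\<sigma> *\<^sub>R z - P z = ?\<Phi> b (?\<Phi> m x)"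
      proof -
        have "\<sigma> *\<^sub>R z - P z = ?\<Phi> (\<lambda>t. \<sigma> * (q t * b t) - t * (q t * b t)) x"
          unfolding tz fcal_diff[OF P continuous_on_mult[OF continuous_on_const cqb] ctz] fcal_cmult[OF P cqb]
          by (simp add: z_def)
        also have "\<dots> = ?\<Phi> (\<lambda>t. b t * m t) x"
        proof (rule fcal_cong[OF P])
          fix t assume t: "t \<in> {0..M}"
          have "b t * m t = b t * c t"
          proof (cases "b t = 0")
            case False
            then have "\<bar>c t\<bar> \<le> 1/32"
              unfolding c_def b_def using t band_cayley_small[OF M _ _ _ \<sigma>_def] by auto
            then have "m t = c t" unfolding m_def by (auto simp: abs_le_iff)
            then show ?thesis by simp
          qed simp
          also have "\<dots> = \<sigma> * (q t * b t) - t * (q t * b t)"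
            by (simp add: c_def q_def diff_divide_distrib algebra_simps)
          finally show "\<sigma> * (q t * b t) - t * (q t * b t) = b t * m t" ..
        qed (intro continuous_intros cqb)
        finally show ?thesis unfolding fcal_mult[OF P cb cm] .
      qed
      let ?u = "Y (?\<Phi> b x)" and ?v = "Y (?\<Phi> b (?\<Phi> m x))"
      have "(\<sigma> *\<^sub>R ?u + A ?u) - (\<sigma> *\<^sub>R ?v - A ?v) = \<sigma> *\<^sub>R (A (Y z) + Y (P z)) + \<sigma> *\<^sub>R (A (Y z) + Y (P z))"
        unfolding plus[symmetric] minus[symmetric]
        by (simp add: linear_add[OF lY] linear_diff[OF lY] linear_scale[OF lY] linear_add[OF lA] linear_diff[OF lA]
            linear_scale[OF lA] algebra_simps)
      then have key: "\<sigma> *\<^sub>R ?u + A ?u = (\<sigma> *\<^sub>R ?v - A ?v) + (\<sigma> *\<^sub>R A (\<Omega> z) + \<sigma> *\<^sub>R A (\<Omega> z))"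
        by (simp add: eq algebra_simps)
      have inv: "?\<Psi> q (\<sigma> *\<^sub>R y + A y) = y" for y
      proof -
        have cp: "continuous_on {0..M'} (\<lambda>t. \<sigma> + t)" by (intro continuous_intros)
        have "\<sigma> *\<^sub>R y + A y = ?\<Psi> (\<lambda>t. \<sigma> + t) y"
          unfolding fcal_add[OF A continuous_on_const continuous_on_id] fcal_const[OF A] fcal_ident[OF A] ..
        then have "?\<Psi> q (\<sigma> *\<^sub>R y + A y) = ?\<Psi> (\<lambda>t. q t * (\<sigma> + t)) y"
          by (simp add: fcal_mult[OF A cc(2) cp])
        also have "\<dots> = ?\<Psi> (\<lambda>t. 1) y"
        proof (rule fcal_cong[OF A continuous_on_mult[OF cc(2) cp]])
          fix t assume "t \<in> {0..M'}"
          then show "q t * (\<sigma> + t) = 1" using nz[of t M'] by (simp add: q_def)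
        qed
        finally show ?thesis by (simp add: fcal_const[OF A])
      qed
      have cay: "norm (?\<Psi> q (\<sigma> *\<^sub>R y - A y)) \<le> 4 * 1 * norm y" for y
      proof -
        have cp: "continuous_on {0..M'} (\<lambda>t. \<sigma> - t)" by (intro continuous_intros)
        have "\<sigma> *\<^sub>R y - A y = ?\<Psi> (\<lambda>t. \<sigma> - t) y"
          unfolding fcal_diff[OF A continuous_on_const continuous_on_id] fcal_const[OF A] fcal_ident[OF A] ..
        then have "?\<Psi> q (\<sigma> *\<^sub>R y - A y) = ?\<Psi> (\<lambda>t. q t * (\<sigma> - t)) y"
          by (simp add: fcal_mult[OF A cc(2) cp])
        also have "norm \<dots> \<le> 4 * 1 * norm y"
          by (rule fcal_norm_le[OF A]) (use \<sigma> in \<open>auto intro!: continuous_intros cc simp: q_def abs_le_iff field_simps\<close>)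
        finally show ?thesis .
      qed
      have res: "norm (?\<Psi> q (A y)) \<le> 4 * 1 * norm y" for y
      proof -
        have "?\<Psi> q (A y) = ?\<Psi> (\<lambda>t. q t * t) y"
          by (simp add: fcal_mult[OF A cc(2) continuous_on_id] fcal_ident[OF A])
        also have "norm \<dots> \<le> 4 * 1 * norm y"
          by (rule fcal_norm_le[OF A]) (use \<sigma> in \<open>auto intro!: continuous_intros cc simp: q_def abs_le_iff field_simps\<close>)
        finally show ?thesis .
      qed
      have lq: "linear (?\<Psi> q)" by (rule fcal_linear[OF A cc(2)])
      have "?u = ?\<Psi> q (\<sigma> *\<^sub>R ?u + A ?u)" by (rule inv[symmetric])
      also have "\<dots> = ?\<Psi> q (\<sigma> *\<^sub>R ?v - A ?v) + (2 * \<sigma>) *\<^sub>R ?\<Psi> q (A (\<Omega> z))"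
        unfolding key linear_add[OF lq] linear_scale[OF lq] by (simp add: scaleR_left_distrib[symmetric])
      finally have "?u = ?\<Psi> q (\<sigma> *\<^sub>R ?v - A ?v) + (2 * \<sigma>) *\<^sub>R ?\<Psi> q (A (\<Omega> z))" .
      then have "norm ?u \<le> norm (?\<Psi> q (\<sigma> *\<^sub>R ?v - A ?v)) + 2 * \<sigma> * norm (?\<Psi> q (A (\<Omega> z)))"
        using norm_triangle_ineq[of "?\<Psi> q (\<sigma> *\<^sub>R ?v - A ?v)" "(2 * \<sigma>) *\<^sub>R ?\<Psi> q (A (\<Omega> z))"] \<sigma> by simp
      also have "\<dots> \<le> 4 * norm ?v + 2 * \<sigma> * (4 * norm (\<Omega> z))"
        using cay[of ?v] res[of "\<Omega> z"] \<sigma> by (intro add_mono mult_left_mono) auto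
      also have "\<dots> \<le> 4 * (\<kappa> * (4 * (1/32) * norm x)) + 2 * \<sigma> * (4 * (C * (4 * ((\<sigma> / band_ratio) powr r / \<sigma>) * norm x)))"
      proof (intro add_mono mult_left_mono)
        have "norm ?v \<le> \<kappa> * norm (?\<Phi> m x)" by (rule \<kappa>)
        also have "\<dots> \<le> \<kappa> * (4 * (1/32) * norm x)"
          by (intro mult_left_mono fcal_norm_le[OF P cm] \<kappa>0) (auto simp: m_def)
        finally show "norm ?v \<le> \<kappa> * (4 * (1/32) * norm x)" .
        have "norm (\<Omega> z) \<le> C * norm (pw M P r z)" by (rule C)
        also have "pw M P r z = ?\<Phi> (\<lambda>t. (rpow r t * q t) * b t) x"
          unfolding z_def fcal_mult[OF P continuous_on_rpow[OF r0] cqb, symmetric] by (simp add: mult.assoc)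
        also have "C * norm \<dots> \<le> C * (4 * ((\<sigma> / band_ratio) powr r / \<sigma>) * norm x)"
        proof (intro mult_left_mono C)
          show "norm (?\<Phi> (\<lambda>t. (rpow r t * q t) * b t) x) \<le> 4 * ((\<sigma> / band_ratio) powr r / \<sigma>) * norm x"
            unfolding b_def
          proof (rule band_fcal_le[OF P M])
            fix t assume t: "0 \<le> t" "band_ratio * t \<le> M * band_ratio ^ k"
            have "rpow r t \<le> rpow r (\<sigma> / band_ratio)"
              using t band_ratio r0 by (intro rpow_mono) (auto simp: \<sigma>_def field_simps)
            also have "\<dots> = (\<sigma> / band_ratio) powr r" using \<sigma> band_ratio by (simp add: rpow_pos)
            finally have "rpow r t / (\<sigma> + t) \<le> (\<sigma> / band_ratio) powr r / \<sigma>"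
              using \<sigma> t rpow_nonneg by (intro frac_le) auto
            then show "\<bar>rpow r t * q t\<bar> \<le> (\<sigma> / band_ratio) powr r / \<sigma>"
              using rpow_nonneg[of r t] \<sigma> t by (simp add: q_def)
          qed (use \<sigma> in \<open>auto intro!: continuous_intros continuous_on_rpow r0 cc\<close>)
        qed
        finally show "norm (\<Omega> z) \<le> C * (4 * ((\<sigma> / band_ratio) powr r / \<sigma>) * norm x)" .
      qed (use \<sigma> in auto)
      also have "\<dots> = (\<kappa> / 2 + 2 * e) * norm x" using \<sigma> by (simp add: e_def field_simps)
      finally show ?thesis .
    qed
    have "\<kappa> \<le> \<kappa> / 2 + 2 * e"
      unfolding \<kappa>_def[of] using \<kappa>0 e0 est by (intro onorm_bound) (auto simp: \<kappa>_def)
    then have "\<kappa> \<le> 4 * e" by simp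
    then have "norm (Y (?\<Phi> b x)) \<le> 4 * e * norm x"
      using \<kappa>[of x] mult_right_mono[of \<kappa> "4 * e" "norm x"] by simp
    also have "e = (16 * C / band_ratio powr r) * \<sigma> powr r"
      using \<sigma> band_ratio by (simp add: e_def powr_divide)
    finally show "norm (Y (?\<Phi> (band M k) x)) \<le> (64 * C / band_ratio powr r) * (M * band_ratio ^ k) powr r * norm x"
      by (simp add: b_def \<sigma>_def)
  qed
qed

end

section \<open>Self-adjoint regular operators and their bounded transforms\<close>

locale symmetric_operator = hilbert_module E
  for E :: "('b::cstar_algebra, 'e::complex_banach) hilbert_structure" +
  fixes D :: "'e \<rightharpoonup> 'e"
  assumes dom_add: "x \<in> dom D \<Longrightarrow> y \<in> dom D \<Longrightarrow> x + y \<in> dom D"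
    and dom_scaleC: "x \<in> dom D \<Longrightarrow> c *\<^sub>C x \<in> dom D"
    and app_add: "x \<in> dom D \<Longrightarrow> y \<in> dom D \<Longrightarrow> the (D (x + y)) = the (D x) + the (D y)"
    and app_scaleC: "x \<in> dom D \<Longrightarrow> the (D (c *\<^sub>C x)) = c *\<^sub>C the (D x)"
    and symmetric: "x \<in> dom D \<Longrightarrow> y \<in> dom D \<Longrightarrow> ip E (the (D x)) y = ip E x (the (D y))"
begin

abbreviation app :: "'e \<Rightarrow> 'e" where "app x \<equiv> the (D x)"

lemma dom_scaleR: "x \<in> dom D \<Longrightarrow> r *\<^sub>R x \<in> dom D"
  using dom_scaleC[of x "complex_of_real r"] by (simp add: scaleC_of_real)

lemma app_scaleR: "x \<in> dom D \<Longrightarrow> app (r *\<^sub>R x) = r *\<^sub>R app x"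
  using app_scaleC[of x "complex_of_real r"] by (simp add: scaleC_of_real)

lemma dom_minus: "x \<in> dom D \<Longrightarrow> - x \<in> dom D"
  using dom_scaleR[of x "-1"] by simp

lemma app_minus: "x \<in> dom D \<Longrightarrow> app (- x) = - app x"
  using app_scaleR[of x "-1"] by simp

lemma dom_diff: "x \<in> dom D \<Longrightarrow> y \<in> dom D \<Longrightarrow> x - y \<in> dom D"
  using dom_add[of x "- y"] dom_minus[of y] by simp

lemma app_diff: "x \<in> dom D \<Longrightarrow> y \<in> dom D \<Longrightarrow> app (x - y) = app x - app y"
  using app_add[of x "- y"] dom_minus[of y] app_minus[of y] by simp

lemma norm_le_one_plus_square:
  assumes x: "x \<in> dom D" "app x \<in> dom D"
  shows "norm x \<le> norm (x + app (app x))" and "norm (app x) \<le> norm (x + app (app x))"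
proof -
  define y where "y = x + \<i> *\<^sub>C app x"
  have y: "y \<in> dom D" unfolding y_def by (intro dom_add dom_scaleC x)
  have 1: "norm x \<le> norm y" "norm (app x) \<le> norm y"
    unfolding y_def using norm_le_norm_add_ii[of x "app x"] symmetric[OF x(1,1)] by auto
  have "norm y \<le> norm (y + \<i> *\<^sub>C (- app y))"
    by (rule norm_le_norm_add_ii(1)) (simp add: ip_minus_left ip_minus_right symmetric y)
  also have "y + \<i> *\<^sub>C (- app y) = x + app (app x)"
    by (simp add: y_def app_add app_scaleC dom_scaleC x scaleC_minus_right scaleC_add_right scaleC_diff_right scaleC_ii_ii)
  finally show "norm x \<le> norm (x + app (app x))" "norm (app x) \<le> norm (x + app (app x))"
    using 1 by auto
qed

end

text \<open>
  For a symmetric operator with dense domain, surjectivity of \<open>1 + D\<^sup>2\<close> is all of self-adjointness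
  and regularity; this form passes easily from \<open>D\<close> to \<open>\<mu> D \<mu>\<^sup>*\<close>.
\<close>

locale regular_symmetric = symmetric_operator E D
  for E :: "('b::cstar_algebra, 'e::complex_banach) hilbert_structure" and D :: "'e \<rightharpoonup> 'e" +
  assumes dense_dom: "closure (dom D) = UNIV"
    and surj_one_plus_square: "\<exists>x\<in>dom D. app x \<in> dom D \<and> x + app (app x) = z"
begin

definition R :: "'e \<Rightarrow> 'e" where "R = inv_one_plus_sq D"

lemma one_plus_square: "one_plus (D \<circ>\<^sub>m D) x = (if x \<in> dom D \<and> app x \<in> dom D then Some (x + app (app x)) else None)"
  by (auto simp: one_plus_def map_comp_def split: option.splits)

lemma inverse_one_plus_square:
  assumes x: "x \<in> dom D" "app x \<in> dom D"
  shows "op_inverse (one_plus (D \<circ>\<^sub>m D)) (x + app (app x)) = Some x"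
proof -
  have "y = x" if y: "y \<in> dom D" "app y \<in> dom D" "y + app (app y) = x + app (app x)" for y
  proof -
    have "norm (y - x) \<le> norm (y - x + app (app (y - x)))"
      by (rule norm_le_one_plus_square(1)) (simp_all add: dom_diff app_diff x y)
    also have "y - x + app (app (y - x)) = 0" using y x by (simp add: app_diff algebra_simps)
    finally show ?thesis by simp
  qed
  then have "(THE y. one_plus (D \<circ>\<^sub>m D) y = Some (x + app (app x))) = x"
    using x by (intro the_equality) (auto simp: one_plus_square split: if_splits)
  moreover have "x + app (app x) \<in> ran (one_plus (D \<circ>\<^sub>m D))"
    using x by (intro ranI[of _ x]) (simp add: one_plus_square)
  ultimately show ?thesis by (simp add: op_inverse_def)
qed

lemma R_unique: "x \<in> dom D \<Longrightarrow> app x \<in> dom D \<Longrightarrow> x + app (app x) = z \<Longrightarrow> R z = x"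
  using inverse_one_plus_square[of x] by (simp add: R_def inv_one_plus_sq_def del: domIff)

lemma R_props: "R z \<in> dom D" "app (R z) \<in> dom D" "R z + app (app (R z)) = z"
proof -
  obtain x where x: "x \<in> dom D" "app x \<in> dom D" "x + app (app x) = z" using surj_one_plus_square by blast
  then have "R z = x" by (rule R_unique)
  with x show "R z \<in> dom D" "app (R z) \<in> dom D" "R z + app (app (R z)) = z" by simp_all
qed

lemma op_inverse_total: "op_inverse (one_plus (D \<circ>\<^sub>m D)) = total_op R"
proof
  fix z
  show "op_inverse (one_plus (D \<circ>\<^sub>m D)) z = total_op R z"
    using inverse_one_plus_square[OF R_props(1,2)] by (simp add: R_props total_op_def)
qed

lemma app_app_R: "app (app (R z)) = z - R z"
  using R_props(3)[of z] by (simp add: algebra_simps)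

lemma R_selfadj: "selfadj R"
  unfolding is_adjoint_def
proof (intro allI)
  fix z w
  have "ip E (R z) w = ip E (R z) (R w + app (app (R w)))" by (simp add: R_props)
  also have "\<dots> = ip E (R z + app (app (R z))) (R w)"
    by (simp only: ip_add_left ip_add_right symmetric[OF R_props(1,2), symmetric] symmetric[OF R_props(2,1)])
  finally show "ip E (R z) w = ip E z (R w)" by (simp add: R_props)
qed

lemma app_R_selfadj: "selfadj (\<lambda>z. app (R z))"
  unfolding is_adjoint_def
proof (intro allI)
  fix z w
  have "ip E (app (R z)) w = ip E (app (R z)) (R w + app (app (R w)))" by (simp add: R_props)
  also have "\<dots> = ip E (R z + app (app (R z))) (app (R w))"
    by (simp only: ip_add_left ip_add_right symmetric[OF R_props(1,1)] symmetric[OF R_props(2,2)])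
  finally show "ip E (app (R z)) w = ip E z (app (R w))" by (simp add: R_props)
qed

lemma R_app: "x \<in> dom D \<Longrightarrow> R (app x) = app (R x)"
  by (rule R_unique)
    (simp_all add: R_props app_app_R dom_diff app_diff)

text \<open>The resolvents \<open>(D \<plusminus> i)\<^sup>-\<^sup>1\<close>.\<close>

definition V :: "'e \<Rightarrow> 'e" where "V z = app (R z) - \<i> *\<^sub>C R z"
definition V' :: "'e \<Rightarrow> 'e" where "V' z = app (R z) + \<i> *\<^sub>C R z"

lemma V_adjoint: "is_adjoint E V V'"
proof -
  have "is_adjoint E V (\<lambda>z. app (R z) - cnj \<i> *\<^sub>C R z)"
    unfolding V_def using adjoint_diff[OF app_R_selfadj adjoint_scaleC_op[OF R_selfadj]] .
  then show ?thesis by (simp add: V'_def[abs_def] scaleC_minus_left)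
qed

lemma V_dom: "V z \<in> dom D" "V' z \<in> dom D"
  by (simp_all add: V_def V'_def dom_add dom_diff dom_scaleC R_props)

lemma app_V: "app (V z) = z - \<i> *\<^sub>C V z" "app (V' z) = z + \<i> *\<^sub>C V' z"
  by (simp_all add: V_def V'_def app_diff app_add app_scaleC dom_scaleC R_props app_app_R
      scaleC_diff_right scaleC_add_right scaleC_ii_ii)

lemma R_linear: "linear R"
  by (rule selfadj_linear[OF R_selfadj])

lemma V_inverse: "x \<in> dom D \<Longrightarrow> V (app x + \<i> *\<^sub>C x) = x" "x \<in> dom D \<Longrightarrow> V' (app x - \<i> *\<^sub>C x) = x"
  by (simp_all add: V_def V'_def linear_add[OF R_linear] linear_diff[OF R_linear] adjoint_scaleC[OF R_selfadj]
      R_app app_add app_diff app_scaleC dom_scaleC R_props app_app_R scaleC_diff_right scaleC_add_right scaleC_ii_ii)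

lemma V_V': "V (V' z) = R z"
  using V_inverse(1)[OF R_props(1)] by (simp add: V'_def)

lemma norm_R_le: "norm (R z) \<le> norm z"
  using norm_le_one_plus_square(1)[OF R_props(1,2), of z] by (simp add: R_props)

lemma onorm_R_le: "onorm R \<le> 1"
  by (rule onorm_bound) (simp_all add: norm_R_le)

lemma R_spectral: "spectral_bound R 0 1"
  using spectral_bound_self_mult_adjoint[OF V_adjoint, of 1] onorm_R_le by (simp add: V_V')

lemma R_spectral_onorm: "spectral_bound R 0 (onorm R)"
proof (cases "onorm R = 0")
  case True
  have "z = 0" for z :: 'e
  proof -
    have "R z = 0" using onorm[OF adjoint_bounded_linear[OF R_selfadj], of z] True by simp
    moreover have "app 0 = 0" using R_props(1)[of 0] app_scaleC[of "R 0" 0] by simp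
    ultimately show ?thesis using R_props(3)[of z] by simp
  qed
  then have "poly_op p R x = 0" "x = 0" for p x by blast+
  then have "norm (poly_op p R x) \<le> 4 * s * norm x" for p s x by (metis mult_zero_right norm_zero order_refl)
  then show ?thesis using R_selfadj by (simp add: spectral_bound_def)
next
  case False
  then have "onorm R > 0" using onorm_pos_le[OF adjoint_bounded_linear[OF R_selfadj]] by simp
  then show ?thesis using spectral_bound_self_mult_adjoint[OF V_adjoint, of "onorm R"] by (simp add: V_V')
qed

lemma app_closed:
  assumes "\<And>n. x n \<in> dom D" "x \<longlonglongrightarrow> a" "(\<lambda>n. app (x n)) \<longlonglongrightarrow> c"
  shows "a \<in> dom D" "app a = c"
proof -
  have "(\<lambda>n. V (app (x n) + \<i> *\<^sub>C x n)) \<longlonglongrightarrow> V (c + \<i> *\<^sub>C a)"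
    by (intro bounded_linear.tendsto[OF adjoint_bounded_linear[OF V_adjoint]] tendsto_add assms
        bounded_linear.tendsto[OF bounded_linear_scaleC])
  then have "x \<longlonglongrightarrow> V (c + \<i> *\<^sub>C a)" using V_inverse(1)[OF assms(1)] by simp
  then have a: "a = V (c + \<i> *\<^sub>C a)" using assms(2) LIMSEQ_unique by blast
  show "a \<in> dom D" by (subst a) (rule V_dom)
  have "app (V (c + \<i> *\<^sub>C a)) = c + \<i> *\<^sub>C a - \<i> *\<^sub>C V (c + \<i> *\<^sub>C a)" by (rule app_V)
  then show "app a = c" using a by simp
qed

text \<open>The maximality that makes a symmetric \<open>D\<close> with \<open>1 + D\<^sup>2\<close> onto self-adjoint.\<close>

lemma adjoint_in_dom:
  assumes "\<And>u. u \<in> dom D \<Longrightarrow> ip E w (app u) = ip E z u"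
  shows "w \<in> dom D" "app w = z"
proof -
  define x where "x = V (z + \<i> *\<^sub>C w)"
  have x: "x \<in> dom D" "app x = z + \<i> *\<^sub>C w - \<i> *\<^sub>C x" by (simp_all add: x_def V_dom app_V)
  have "ip E w y = ip E x y" for y
  proof -
    define u where "u = V' y"
    have u: "u \<in> dom D" "y = app u - \<i> *\<^sub>C u" by (simp_all add: u_def V_dom app_V)
    have "ip E w y = ip E (z + \<i> *\<^sub>C w) u"
      by (simp add: u(2) ip_diff_right ip_scaleC_right ip_add_left ip_scaleC_left assms u(1) scaleC_minus_left)
    also have "z + \<i> *\<^sub>C w = app x + \<i> *\<^sub>C x" by (simp add: x(2))
    also have "ip E \<dots> u = ip E x y"
      by (simp add: u(2) ip_diff_right ip_scaleC_right ip_add_left ip_scaleC_left symmetric u(1) x(1) scaleC_minus_left)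
    finally show ?thesis .
  qed
  then have "w = x" by (rule ip_eqI_left)
  then show "w \<in> dom D" "app w = z" using x by auto
qed

lemma dense_range_R: "closure (range R) = UNIV"
proof -
  have "dom D \<subseteq> closure (range R)"
  proof
    fix x assume x: "x \<in> dom D"
    have "app x + \<i> *\<^sub>C x \<in> closure (dom D)" using dense_dom by simp
    then obtain w where w: "\<And>n. w n \<in> dom D" "w \<longlonglongrightarrow> app x + \<i> *\<^sub>C x" unfolding closure_sequential by blast
    have "(\<lambda>n. V (w n)) \<longlonglongrightarrow> V (app x + \<i> *\<^sub>C x)"
      by (rule bounded_linear.tendsto[OF adjoint_bounded_linear[OF V_adjoint] w(2)])
    then have "(\<lambda>n. V (w n)) \<longlonglongrightarrow> x" by (simp add: V_inverse x)
    moreover have "V (w n) \<in> range R" for n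
      using V_V'[of "app (w n) - \<i> *\<^sub>C w n"] by (intro range_eqI) (simp only: V_inverse(2)[OF w(1)])
    ultimately show "x \<in> closure (range R)"
      unfolding closure_sequential by (intro exI[of _ "\<lambda>n. V (w n)"]) simp
  qed
  then show ?thesis using dense_dom closure_minimal[of "dom D" "closure (range R)"] by auto
qed

text \<open>
  Everything that commutes with \<open>R\<close> and \<open>D R\<close> commutes with \<open>V = (D + i)\<^sup>-\<^sup>1\<close> and so with \<open>D\<close>, whose
  domain is the range of \<open>V\<close>.
\<close>

lemma fcal_R_commute:
  assumes f: "continuous_on {0..1} f" and x: "x \<in> dom D"
  shows "fcal 0 1 R f x \<in> dom D" "app (fcal 0 1 R f x) = fcal 0 1 R f (app x)"
proof -
  let ?T = "fcal 0 1 R f"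
  have VR: "V (R z) = R (V z)" for z
    by (simp add: V_def linear_diff[OF R_linear] adjoint_scaleC[OF R_selfadj] R_app R_props)
  have VT: "V (?T z) = ?T (V z)" for z
    by (rule fcal_intertwine[OF R_spectral R_spectral f adjoint_bounded_linear[OF V_adjoint] VR])
  have x': "x = V (app x + \<i> *\<^sub>C x)" by (simp add: V_inverse x)
  have "?T x = V (?T (app x + \<i> *\<^sub>C x))" using VT x' by simp
  moreover have "?T (app x + \<i> *\<^sub>C x) = ?T (app x) + \<i> *\<^sub>C ?T x"
    using fcal_linear[OF R_spectral f] adjoint_scaleC[OF fcal_selfadj[OF R_spectral f]] by (simp add: linear_add)
  ultimately have T: "?T x = V (?T (app x) + \<i> *\<^sub>C ?T x)" by simp
  show "?T x \<in> dom D" by (subst T) (rule V_dom)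
  have "app (V (?T (app x) + \<i> *\<^sub>C ?T x)) = ?T (app x) + \<i> *\<^sub>C ?T x - \<i> *\<^sub>C V (?T (app x) + \<i> *\<^sub>C ?T x)"
    by (rule app_V)
  then show "app (?T x) = ?T (app x)" using T by simp
qed

text \<open>\<open>h = (1 + D\<^sup>2)\<^sup>-\<^sup>1\<^sup>/\<^sup>2\<close> and \<open>F = D h\<close>.\<close>

definition h :: "'e \<Rightarrow> 'e" where "h = fcal 0 1 R sqrt"
definition F :: "'e \<Rightarrow> 'e" where "F x = app (h x)"

lemma h_h: "h (h x) = R x"
proof -
  have c: "continuous_on {0..1::real} sqrt" by (intro continuous_intros)
  have "h (h x) = fcal 0 1 R (\<lambda>t. sqrt t * sqrt t) x"
    unfolding h_def by (rule fcal_mult[OF R_spectral c c, symmetric])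
  also have "\<dots> = fcal 0 1 R (\<lambda>t. t) x"
    by (rule fcal_cong[OF R_spectral]) (auto intro!: continuous_intros)
  finally show ?thesis by (simp add: fcal_ident[OF R_spectral])
qed

lemma h_spectral: "spectral_bound h 0 1"
  unfolding h_def by (rule spectral_bound_fcal[OF R_spectral]) (auto intro!: continuous_intros)

lemma h_selfadj: "selfadj h"
  by (rule spectral_bound_selfadj[OF h_spectral])

lemma h_bounded_linear: "bounded_linear h"
  by (rule adjoint_bounded_linear[OF h_selfadj])

lemma h_linear: "linear h"
  by (rule selfadj_linear[OF h_selfadj])

lemma dense_range_h: "closure (range h) = UNIV"
proof -
  have "range R \<subseteq> range h" using h_h by (metis image_subset_iff rangeI)
  then show ?thesis using closure_mono[of "range R" "range h"] dense_range_R by auto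
qed

lemma h_injective: "h x = 0 \<Longrightarrow> x = 0"
proof -
  assume "h x = 0"
  then have "R x = 0" using h_h[of x] linear_0[OF h_linear] by simp
  then have "app (R x) = 0" using app_scaleC[OF R_props(1)[of x], of 0] by simp
  then show "x = 0" using R_props(3)[of x] \<open>R x = 0\<close> by simp
qed

lemma norm_app_R_le: "norm (app (R y)) \<le> sqrt 8 * norm (h y)"
proof (rule power2_le_imp_le)
  have "ip E (app (R y)) (app (R y)) = ip E (R y) (y - R y)"
    by (simp only: symmetric[OF R_props(1,2)] app_app_R)
  also have "\<dots> = ip E (h y) (h y - R (h y))"
    using is_adjointD[OF h_selfadj, of "h y" "y - R y"]
    by (simp add: h_h linear_diff[OF h_linear] fcal_commute_base[OF R_spectral, of sqrt, folded h_def] continuous_intros)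
  finally have "(norm (app (R y)))\<^sup>2 \<le> 4 * norm (h y) * norm (h y - R (h y))"
    using norm_ip_le[of "h y" "h y - R (h y)"] norm_ip_self by metis
  also have "\<dots> \<le> 4 * norm (h y) * (2 * norm (h y))"
    using norm_triangle_ineq4[of "h y" "R (h y)"] norm_R_le[of "h y"] by (intro mult_left_mono) auto
  finally show "(norm (app (R y)))\<^sup>2 \<le> (sqrt 8 * norm (h y))\<^sup>2"
    by (simp add: power_mult_distrib) (simp add: power2_eq_square)
qed simp

text \<open>
  On the dense range of \<open>h\<close>, the operator \<open>D h\<close> is bounded by \<open>\<parallel>D R y\<parallel> \<le> \<surd>8 \<parallel>h y\<parallel>\<close>. As \<open>D\<close> is closed,
  \<open>D h\<close> is therefore defined everywhere.
\<close>

lemma h_dom: "h x \<in> dom D" and norm_app_h_le: "norm (app (h x)) \<le> sqrt 8 * norm x"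
proof -
  have "x \<in> closure (range h)" using dense_range_h by simp
  then obtain s where s: "\<And>n. s n \<in> range h" "s \<longlonglongrightarrow> x" unfolding closure_sequential by blast
  then have "\<forall>n. \<exists>y. s n = h y" by blast
  then have "\<exists>y. \<forall>n. s n = h (y n)" by (rule choice)
  then obtain y where y: "\<And>n. s n = h (y n)" by blast
  have hs: "h (s n) = R (y n)" for n by (simp add: y h_h)
  have "app (R (y k)) - app (R (y n)) = app (R (y k - y n))" for k n
    by (simp add: linear_diff[OF R_linear] app_diff R_props)
  then have "norm (app (R (y k)) - app (R (y n))) \<le> sqrt 8 * norm (s k - s n)" for k n
    using norm_app_R_le[of "y k - y n"] by (simp add: linear_diff[OF h_linear] y)
  then have "Cauchy (\<lambda>n. app (R (y n)))" by (rule Cauchy_if_le_Cauchy[OF LIMSEQ_imp_Cauchy[OF s(2)]])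
  then obtain c where c: "(\<lambda>n. app (R (y n))) \<longlonglongrightarrow> c" using Cauchy_convergent convergent_def by blast
  have "(\<lambda>n. h (s n)) \<longlonglongrightarrow> h x" by (rule bounded_linear.tendsto[OF h_bounded_linear s(2)])
  then have hx: "h x \<in> dom D" "app (h x) = c"
    using app_closed[of "\<lambda>n. R (y n)", OF R_props(1) _ c] by (simp_all add: hs)
  then show "h x \<in> dom D" by simp
  have "norm c \<le> sqrt 8 * norm x"
  proof (rule LIMSEQ_le)
    show "(\<lambda>n. norm (app (R (y n)))) \<longlonglongrightarrow> norm c" by (intro tendsto_norm c)
    show "(\<lambda>n. sqrt 8 * norm (s n)) \<longlonglongrightarrow> sqrt 8 * norm x" by (intro tendsto_intros s)
    show "\<exists>N. \<forall>n\<ge>N. norm (app (R (y n))) \<le> sqrt 8 * norm (s n)" using norm_app_R_le by (simp add: y)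
  qed
  then show "norm (app (h x)) \<le> sqrt 8 * norm x" by (simp add: hx)
qed

lemma h_app: "x \<in> dom D \<Longrightarrow> app (h x) = h (app x)"
  using fcal_R_commute(2)[of sqrt x] by (simp add: h_def continuous_intros)

lemma h_F: "h (F x) = app (R x)"
  using h_app[OF h_dom, of x] by (simp add: F_def h_h)

lemma F_h: "F (h x) = app (R x)"
  by (simp add: F_def h_h)

lemma F_h_commute: "F (h x) = h (F x)"
  by (simp add: F_h h_F)

text \<open>
  Since \<open>F h = h F = D R\<close> is self-adjoint, \<open>\<langle>F w, h y\<rangle> = \<langle>w, F h y\<rangle>\<close>; the range of \<open>h\<close> is dense and
  \<open>F\<close> is bounded.
\<close>

lemma F_selfadj: "selfadj F"
proof -
  have key: "ip E (F w) (h y) = ip E w (F (h y))" for w y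
  proof -
    have "ip E (F w) (h y) = ip E (h (F w)) y" by (simp add: is_adjointD[OF h_selfadj])
    also have "\<dots> = ip E w (app (R y))" by (simp add: h_F is_adjointD[OF app_R_selfadj])
    finally show ?thesis by (simp add: F_h)
  qed
  have add: "F (x + y) = F x + F y" for x y by (simp add: F_def linear_add[OF h_linear] app_add h_dom)
  have scale: "F (r *\<^sub>R x) = r *\<^sub>R F x" for r x by (simp add: F_def linear_scale[OF h_linear] app_scaleR h_dom)
  have bF: "bounded_linear F" by (rule bounded_linear_intro[where K="sqrt 8", OF add scale]) (use norm_app_h_le in \<open>simp add: F_def mult.commute\<close>)
  show ?thesis
    unfolding is_adjoint_def
  proof (intro allI)
    fix w x
    have "x \<in> closure (range h)" using dense_range_h by simp
    then obtain s where s: "\<And>n. s n \<in> range h" "s \<longlonglongrightarrow> x" unfolding closure_sequential by blast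
    have "ip E (F w) (s n) = ip E w (F (s n))" for n using s(1)[of n] key by auto
    moreover have "(\<lambda>n. ip E (F w) (s n)) \<longlonglongrightarrow> ip E (F w) x" "(\<lambda>n. ip E w (F (s n))) \<longlonglongrightarrow> ip E w (F x)"
      by (intro tendsto_ip tendsto_const s bounded_linear.tendsto[OF bF])+
    ultimately show "ip E (F w) x = ip E w (F x)" by (simp add: LIMSEQ_unique)
  qed
qed

lemma F_bounded_linear: "bounded_linear F"
  by (rule adjoint_bounded_linear[OF F_selfadj])

lemma F_linear: "linear F"
  by (rule selfadj_linear[OF F_selfadj])

lemma F_F: "F (F x) = x - h (h x)"
  using h_F[of x] by (simp add: F_def[of "F x"] app_app_R h_h)

lemma dom_eq_h: "x \<in> dom D \<Longrightarrow> x = h (F (app x) + h x)"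
  by (simp add: linear_add[OF h_linear] h_F h_h R_app app_app_R)

lemma dom_eq_range: "dom D = range h"
  using dom_eq_h h_dom by blast

lemma app_h: "app (h x) = F x"
  by (simp add: F_def)

lemma F_pw_commute: "0 \<le> r \<Longrightarrow> F (pw 1 h r x) = pw 1 h r (F x)"
  by (rule fcal_intertwine[OF h_spectral h_spectral continuous_on_rpow F_bounded_linear F_h_commute])

text \<open>The powers \<open>\<langle>D\<rangle>\<^sup>s\<close> and the bounded transform in terms of \<open>h\<close> and \<open>F\<close>.\<close>

lemma pw_h:
  assumes "0 \<le> r" shows "pw 1 h r x = fcal 0 1 R (rpow (r / 2)) x"
proof -
  have c: "continuous_on {0..1::real} sqrt" by (intro continuous_intros)
  have "pw 1 h r x = fcal 0 1 R (\<lambda>t. rpow r (sqrt t)) x"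
    unfolding h_def by (rule fcal_fcal[OF R_spectral c _ continuous_on_rpow[OF assms]]) auto
  also have "\<dots> = fcal 0 1 R (rpow (r / 2)) x"
  proof (rule fcal_cong[OF R_spectral])
    show "continuous_on {0..1} (\<lambda>t. rpow r (sqrt t))"
      by (rule continuous_on_compose2[OF continuous_on_rpow[OF assms, of 1] c]) auto
    fix t :: real assume t: "t \<in> {0..1}"
    then show "rpow r (sqrt t) = rpow (r / 2) t"
      by (simp add: rpow_def powr_half_sqrt[symmetric] powr_powr)
  qed
  finally show ?thesis .
qed

lemma pw_h_injective: "0 \<le> r \<Longrightarrow> r \<le> 1 \<Longrightarrow> pw 1 h r x = 0 \<Longrightarrow> x = 0"
proof -
  assume r: "0 \<le> r" "r \<le> 1" and z: "pw 1 h r x = 0"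
  have "h x = pw 1 h (1 - r) (pw 1 h r x)"
    using pw_add[OF h_spectral, of "1 - r" r x] r by (simp add: pw_1[OF h_spectral])
  also have "\<dots> = 0" using r z by (simp add: linear_0 bounded_linear.linear pw_bounded_linear[OF h_spectral])
  finally show "x = 0" by (rule h_injective)
qed

text \<open>
  The definition of \<open>fun_calc\<close> asks for convergence along all polynomials that converge on
  \<open>[0, \<parallel>R\<parallel>]\<close>, which follows from the spectral bound of \<open>R\<close> on this interval.
\<close>

lemma fun_calc_R:
  assumes f: "continuous_on {0..1} f"
  shows "fun_calc E f R = fcal 0 1 R f"
proof -
  let ?M = "onorm R"
  have sub: "{0..?M} \<subseteq> {0..1}" using onorm_R_le by auto
  have fM: "continuous_on {0..?M} f" by (rule continuous_on_subset[OF f sub])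
  have eq: "fcal 0 1 R f = fcal 0 ?M R f"
    using fcal_interval[OF R_spectral_onorm, of 0 1 f] onorm_R_le f by (auto simp: fun_eq_iff)
  let ?S = "fcal 0 ?M R f"
  have S: "selfadj ?S" by (rule fcal_selfadj[OF R_spectral_onorm fM])
  have conv: "(\<lambda>n. onorm (\<lambda>x. poly_op (p n) R x - ?S x)) \<longlonglongrightarrow> 0"
    if p: "uniform_limit {0..?M} (\<lambda>n. poly (p n)) f sequentially" for p
  proof (rule LIMSEQ_I)
    fix e :: real assume e: "e > 0"
    have "e / 8 > 0" using e by simp
    then obtain N where N: "\<And>n t. n \<ge> N \<Longrightarrow> t \<in> {0..?M} \<Longrightarrow> dist (poly (p n) t) (f t) < e / 8"
      using uniform_limitD[OF p] unfolding eventually_sequentially by blast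
    have "norm (onorm (\<lambda>x. poly_op (p n) R x - ?S x)) < e" if n: "n \<ge> N" for n
    proof -
      have c: "continuous_on {0..?M} (poly (p n))" by (intro continuous_intros)
      have "onorm (\<lambda>x. poly_op (p n) R x - ?S x) \<le> 4 * (e / 8)"
      proof (rule onorm_bound)
        fix x
        have "poly_op (p n) R x - ?S x = fcal 0 ?M R (\<lambda>t. poly (p n) t - f t) x"
          by (simp add: fcal_diff[OF R_spectral_onorm c fM] fcal_poly[OF R_spectral_onorm])
        also have "norm \<dots> \<le> 4 * (e / 8) * norm x"
          using N[OF n] by (intro fcal_norm_le[OF R_spectral_onorm] continuous_intros fM)
            (auto simp: dist_real_def intro: less_imp_le)
        finally show "norm (poly_op (p n) R x - ?S x) \<le> 4 * (e / 8) * norm x" .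
      qed (use e in simp)
      moreover have "0 \<le> onorm (\<lambda>x. poly_op (p n) R x - ?S x)"
        by (rule onorm_pos_le[OF adjoint_bounded_linear[OF adjoint_diff[OF selfadj_poly_op[OF R_selfadj] S]]])
      ultimately show ?thesis using e by simp
    qed
    then show "\<exists>N. \<forall>n\<ge>N. norm (onorm (\<lambda>x. poly_op (p n) R x - ?S x) - 0) < e" by auto
  qed
  have "fun_calc E f R = ?S"
    unfolding fun_calc_def
  proof (rule the_equality)
    show "adjointable E ?S \<and> (\<forall>p. uniform_limit {0..?M} (\<lambda>n. poly (p n)) f sequentially \<longrightarrow>
        (\<lambda>n. onorm (\<lambda>x. poly_op (p n) R x - ?S x)) \<longlonglongrightarrow> 0)"
      using conv adjointableI[OF S] by blast
  next
    fix T assume T: "adjointable E T \<and> (\<forall>p. uniform_limit {0..?M} (\<lambda>n. poly (p n)) f sequentially \<longrightarrow>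
        (\<lambda>n. onorm (\<lambda>x. poly_op (p n) R x - T x)) \<longlonglongrightarrow> 0)"
    let ?p = "poly_approx 0 ?M f"
    have lim: "(\<lambda>n. onorm (\<lambda>x. poly_op (?p n) R x - T x)) \<longlonglongrightarrow> 0" using T poly_approx[OF fM] by blast
    have bl: "bounded_linear (\<lambda>x. poly_op (?p n) R x - T x)" for n
      using adjoint_bounded_linear[OF adjoint_diff[OF selfadj_poly_op[OF R_selfadj] adjoint_adj]] T by blast
    show "T = ?S"
    proof
      fix x
      have "(\<lambda>n. poly_op (?p n) R x - T x) \<longlonglongrightarrow> 0"
      proof (rule Lim_null_comparison)
        show "\<forall>\<^sub>F n in sequentially. norm (poly_op (?p n) R x - T x) \<le> onorm (\<lambda>x. poly_op (?p n) R x - T x) * norm x"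
          using onorm[OF bl] by simp
        show "(\<lambda>n. onorm (\<lambda>x. poly_op (?p n) R x - T x) * norm x) \<longlonglongrightarrow> 0"
          using tendsto_mult_left_zero[OF lim] .
      qed
      then have "(\<lambda>n. poly_op (?p n) R x) \<longlonglongrightarrow> T x" by (simp add: LIM_zero_iff)
      then show "T x = ?S x" using fcal_tendsto_approx[OF R_spectral_onorm fM] LIMSEQ_unique by blast
    qed
  qed
  then show ?thesis by (simp add: eq)
qed

lemma bracket_power_nonpos: "s \<le> 0 \<Longrightarrow> bracket_power E D s = total_op (pw 1 h (- s))"
  using pw_h[of "- s"] fun_calc_R[OF continuous_on_rpow, of "- s / 2"]
  by (auto simp: bracket_power_def R_def[symmetric] fun_eq_iff total_op_def)

lemma bracket_power_pos: "0 < s \<Longrightarrow> bracket_power E D s = op_inverse (total_op (pw 1 h s))"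
  using pw_h[of s] fun_calc_R[OF continuous_on_rpow, of "s / 2"]
  by (auto simp: bracket_power_def R_def[symmetric] fun_eq_iff total_op_def intro!: arg_cong[of _ _ op_inverse])

lemma bounded_transform_eq: "bounded_transform E D = total_op F"
proof
  fix x
  have "bracket_power E D (- 1) = total_op h"
    using bracket_power_nonpos[of "-1"] pw_1[OF h_spectral] by (auto simp: total_op_def)
  then show "bounded_transform E D x = total_op F x"
    using h_dom[of x] by (auto simp: bounded_transform_def total_op_def F_def)
qed

end

text \<open>
  Regularity gives only dense range of \<open>1 + D\<^sup>2\<close>. The range is closed because \<open>\<parallel>x\<parallel>\<close> and \<open>\<parallel>D x\<parallel>\<close>
  are bounded by \<open>\<parallel>(1 + D\<^sup>2) x\<parallel>\<close> and \<open>D\<close> is closed.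
\<close>

lemma (in hilbert_module) selfadjoint_regular_imp_regular_symmetric:
  assumes D: "selfadjoint_regular E D"
  shows "regular_symmetric E D"
proof -
  have mod: "module_operator E D" and dense: "closure (dom D) = UNIV"
    and cl: "closed {(x, y). D x = Some y}" and adj: "op_adjoint E D = D"
    and rng: "closure (ran (one_plus (D \<circ>\<^sub>m D))) = UNIV"
    using D by (auto simp: selfadjoint_regular_def regular_operator_def densely_defined_def)
  let ?a = "\<lambda>x. the (D x)"
  have sym: "ip E (?a x) y = ip E x (?a y)" if x: "x \<in> dom D" and y: "y \<in> dom D" for x y
  proof -
    let ?P = "\<lambda>z. \<forall>x\<in>dom D. ip E (?a x) y = ip E x z"
    obtain w where w: "D y = Some w" using y by blast
    then have "op_adjoint E D y = Some w" using adj by simp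
    then have ex: "\<exists>z. ?P z" and w': "w = (THE z. ?P z)" by (auto simp: op_adjoint_def split: if_splits)
    have "?P (THE z. ?P z)"
    proof (rule theI')
      show "\<exists>!z. ?P z" using ex ip_dense_eqI[OF dense] by (metis (no_types, lifting))
    qed
    then show ?thesis using w w' x by simp
  qed
  interpret symmetric_operator E D
    using mod sym by unfold_locales (auto simp: module_operator_def submodule_def simp del: domIff)
  show ?thesis
  proof unfold_locales
    show "closure (dom D) = UNIV" by (rule dense)
    fix z
    have op: "one_plus (D \<circ>\<^sub>m D) x = (if x \<in> dom D \<and> ?a x \<in> dom D then Some (x + ?a (?a x)) else None)" for x
      by (auto simp: one_plus_def map_comp_def split: option.splits)
    have "z \<in> closure (ran (one_plus (D \<circ>\<^sub>m D)))" using rng by simp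
    then obtain s where s: "\<And>n. s n \<in> ran (one_plus (D \<circ>\<^sub>m D))" "s \<longlonglongrightarrow> z"
      unfolding closure_sequential by blast
    have "\<exists>x. x \<in> dom D \<and> ?a x \<in> dom D \<and> x + ?a (?a x) = s n" for n
      using s(1)[of n] unfolding ran_def op by (auto split: if_splits simp del: domIff)
    then have "\<exists>x. \<forall>n. x n \<in> dom D \<and> ?a (x n) \<in> dom D \<and> x n + ?a (?a (x n)) = s n" by (intro choice allI)
    then obtain x where x: "\<And>n. x n \<in> dom D" "\<And>n. ?a (x n) \<in> dom D" "\<And>n. x n + ?a (?a (x n)) = s n" by blast
    have diff: "norm (x m - x n) \<le> norm (s m - s n)" "norm (?a (x m) - ?a (x n)) \<le> norm (s m - s n)" for m n
    proof -
      have "s m - s n = (x m + ?a (?a (x m))) - (x n + ?a (?a (x n)))" unfolding x(3) ..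
      also have "\<dots> = (x m - x n) + ?a (?a (x m - x n))"
        unfolding app_diff[OF x(1) x(1)] app_diff[OF x(2) x(2)] by simp
      finally have e: "s m - s n = (x m - x n) + ?a (?a (x m - x n))" .
      have d: "x m - x n \<in> dom D" by (rule dom_diff[OF x(1) x(1)])
      have a: "?a (x m - x n) = ?a (x m) - ?a (x n)" by (rule app_diff[OF x(1) x(1)])
      have d': "?a (x m - x n) \<in> dom D" unfolding a by (rule dom_diff[OF x(2) x(2)])
      show "norm (x m - x n) \<le> norm (s m - s n)" "norm (?a (x m) - ?a (x n)) \<le> norm (s m - s n)"
        unfolding e using norm_le_one_plus_square[OF d d'] a by auto
    qed
    have cauchy: "Cauchy f" if "\<And>m n. norm (f m - f n) \<le> norm (s m - s n)" for f :: "nat \<Rightarrow> 'e"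
      using Cauchy_if_le_Cauchy[OF LIMSEQ_imp_Cauchy[OF s(2)], of f 1] that by simp
    obtain u where u: "x \<longlonglongrightarrow> u" using cauchy[OF diff(1)] Cauchy_convergent convergent_def by blast
    obtain v where v: "(\<lambda>n. ?a (x n)) \<longlonglongrightarrow> v"
      using cauchy[of "\<lambda>n. ?a (x n)", OF diff(2)] Cauchy_convergent convergent_def by blast
    have closed: "D a = Some c" if "\<And>n. y n \<in> dom D" "y \<longlonglongrightarrow> a" "(\<lambda>n. ?a (y n)) \<longlonglongrightarrow> c" for y a c
    proof -
      have 1: "(\<lambda>n. (y n, ?a (y n))) \<longlonglongrightarrow> (a, c)" by (intro tendsto_Pair that)
      have 2: "(y n, ?a (y n)) \<in> {(x, y). D x = Some y}" for n using that(1)[of n] by auto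
      have "(a, c) \<in> {(x, y). D x = Some y}" by (rule closed_sequentially[OF cl 2 1])
      then show ?thesis by simp
    qed
    have "D u = Some v" using closed[OF x(1) u v] .
    moreover have "(\<lambda>n. ?a (?a (x n))) \<longlonglongrightarrow> z - u"
    proof -
      have "?a (?a (x n)) = s n - x n" for n using x(3)[of n] by (simp add: algebra_simps)
      then show ?thesis using tendsto_diff[OF s(2) u] by simp
    qed
    then have "D v = Some (z - u)" using closed[OF x(2) v] by blast
    ultimately show "\<exists>x\<in>dom D. ?a x \<in> dom D \<and> x + ?a (?a x) = z" by (intro bexI[of _ u]) auto
  qed
qed

section \<open>Conformal perturbations are self-adjoint and regular\<close>

text \<open>\<open>m\<close>, \<open>m'\<close>, \<open>n\<close>, \<open>n'\<close> stand for \<open>\<mu>\<close>, \<open>\<mu>\<^sup>*\<close>, \<open>\<mu>\<^sup>-\<^sup>1\<close>, \<open>\<mu>\<^sup>-\<^sup>1\<^sup>*\<close>.\<close>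

locale invertible_pair = hilbert_module E
  for E :: "('b::cstar_algebra, 'e::complex_banach) hilbert_structure" +
  fixes m m' n n' :: "'e \<Rightarrow> 'e"
  assumes m_adjoint: "is_adjoint E m m'" and n_adjoint: "is_adjoint E n n'"
    and m_n: "m (n x) = x" and n_m: "n (m x) = x"
begin

lemma m'_adjoint: "is_adjoint E m' m" and n'_adjoint: "is_adjoint E n' n"
  by (rule is_adjoint_sym, rule m_adjoint n_adjoint)+

lemma m'_n': "m' (n' x) = x"
  by (rule ip_eqI) (simp add: is_adjointD[OF m_adjoint, symmetric] is_adjointD[OF n_adjoint, symmetric] n_m)

lemma n'_m': "n' (m' x) = x"
  by (rule ip_eqI) (simp add: is_adjointD[OF m_adjoint, symmetric] is_adjointD[OF n_adjoint, symmetric] m_n)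

lemmas m_bounded_linear = adjoint_bounded_linear[OF m_adjoint]
  and m'_bounded_linear = adjoint_bounded_linear[OF m'_adjoint]
  and n_bounded_linear = adjoint_bounded_linear[OF n_adjoint]
  and n'_bounded_linear = adjoint_bounded_linear[OF n'_adjoint]

lemmas m_linear = bounded_linear.linear[OF m_bounded_linear]
  and m'_linear = bounded_linear.linear[OF m'_bounded_linear]
  and n_linear = bounded_linear.linear[OF n_bounded_linear]
  and n'_linear = bounded_linear.linear[OF n'_bounded_linear]

end

locale conformal_pair = regular_symmetric E D + invertible_pair E m m' n n'
  for E :: "('b::cstar_algebra, 'e::complex_banach) hilbert_structure" and D :: "'e \<rightharpoonup> 'e"
    and m m' n n' :: "'e \<Rightarrow> 'e"
begin

definition D1 :: "'e \<rightharpoonup> 'e" where "D1 = total_op m \<circ>\<^sub>m D \<circ>\<^sub>m total_op m'"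

lemma D1_dom: "x \<in> dom D1 \<longleftrightarrow> m' x \<in> dom D"
  by (auto simp: D1_def total_op_def map_comp_def dom_def split: option.splits)

lemma D1_app: "m' x \<in> dom D \<Longrightarrow> the (D1 x) = m (app (m' x))"
  by (auto simp: D1_def total_op_def map_comp_def)

lemma D1_symmetric_operator: "symmetric_operator E D1"
proof unfold_locales
  fix x y c
  assume x: "x \<in> dom D1"
  then have x': "m' x \<in> dom D" by (simp add: D1_dom del: domIff)
  show "c *\<^sub>C x \<in> dom D1" using x' by (simp add: D1_dom adjoint_scaleC[OF m'_adjoint] dom_scaleC del: domIff)
  show "the (D1 (c *\<^sub>C x)) = c *\<^sub>C the (D1 x)"
    using x' by (simp add: D1_app adjoint_scaleC[OF m'_adjoint] adjoint_scaleC[OF m_adjoint] dom_scaleC app_scaleC del: domIff)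
  assume "y \<in> dom D1"
  then have y': "m' y \<in> dom D" by (simp add: D1_dom del: domIff)
  show "x + y \<in> dom D1" using x' y' by (simp add: D1_dom linear_add[OF m'_linear] dom_add del: domIff)
  show "the (D1 (x + y)) = the (D1 x) + the (D1 y)"
    using x' y' by (simp add: D1_app linear_add[OF m'_linear] linear_add[OF m_linear] dom_add app_add del: domIff)
  show "ip E (the (D1 x)) y = ip E x (the (D1 y))"
    using x' y' by (simp add: D1_app is_adjointD[OF m_adjoint] symmetric is_adjointD[OF m'_adjoint] del: domIff)
qed

text \<open>
  The point is the surjectivity of \<open>1 + D\<^sub>1\<^sup>2\<close>.
  Solving \<open>(1 + D\<^sub>1\<^sup>2) y = z\<close> weakly for \<open>y = \<mu>\<^sup>-\<^sup>1\<^sup>* h \<eta>\<close> leads to the bounded equation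
  \<open>H \<eta> = h \<mu>\<^sup>-\<^sup>1 z\<close> with \<open>H = h (\<mu>\<^sup>* \<mu>)\<^sup>-\<^sup>1 h + F \<mu>\<^sup>* \<mu> F\<close>. This \<open>H\<close> is bounded below because
  \<open>\<langle>\<eta>, H \<eta>\<rangle> = \<langle>(D\<^sub>1 + i) y, (D\<^sub>1 + i) y\<rangle>\<close>.
\<close>

theorem D1_regular_symmetric: "regular_symmetric E D1"
proof -
  interpret D1: symmetric_operator E D1 by (rule D1_symmetric_operator)
  note lm = m_linear and lm' = m'_linear and ln = n_linear and ln' = n'_linear
  define H where "H x = h (n (n' (h x))) + F (m' (m (F x)))" for x
  have H: "selfadj H"
    unfolding H_def
    using adjoint_add[OF adjoint_comp[OF h_selfadj adjoint_comp[OF adjoint_comp[OF n_adjoint n'_adjoint] h_selfadj]]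
        adjoint_comp[OF F_selfadj adjoint_comp[OF adjoint_comp[OF m'_adjoint m_adjoint] F_selfadj]]] .
  obtain B1 where B1: "\<And>y. norm (h (m' y)) \<le> norm y * B1" "0 \<le> B1"
    using bounded_linear.nonneg_bounded[OF bounded_linear_compose[OF h_bounded_linear m'_bounded_linear]] by blast
  obtain B2 where B2: "\<And>y. norm (F (n y)) \<le> norm y * B2" "0 \<le> B2"
    using bounded_linear.nonneg_bounded[OF bounded_linear_compose[OF F_bounded_linear n_bounded_linear]] by blast
  define C where "C = 4 * (B1 + B2)\<^sup>2 + 1"
  have C: "C > 0" by (simp add: C_def add_nonneg_pos)
  have below: "inverse C * norm x \<le> norm (H x)" for x
  proof -
    define y where "y = n' (h x)"
    have y: "m' y = h x" by (simp add: y_def m'_n')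
    have yd: "y \<in> dom D1" using h_dom by (simp add: D1_dom y del: domIff)
    have D1y: "the (D1 y) = m (F x)" using h_dom by (simp add: D1_app y F_def del: domIff)
    let ?w = "y + \<i> *\<^sub>C m (F x)"
    have s: "ip E y (m (F x)) = ip E (m (F x)) y" using D1.symmetric[OF yd yd] by (simp add: D1y)
    have "ip E x (H x) = ip E y y + ip E (m (F x)) (m (F x))"
      by (simp add: H_def ip_add_right y_def is_adjointD[OF h_selfadj, symmetric] is_adjointD[OF n'_adjoint]
          is_adjointD[OF F_selfadj, symmetric] is_adjointD[OF m_adjoint])
    then have "ip E ?w ?w = ip E x (H x)" using norm_add_ii_eq(2)[OF s] by simp
    then have w: "(norm ?w)\<^sup>2 \<le> 4 * norm x * norm (H x)" using norm_ip_le[of x "H x"] norm_ip_self by metis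
    have "x = F (n (m (F x))) + h (m' y)" by (simp add: n_m y F_F)
    then have "norm x \<le> norm (m (F x)) * B2 + norm y * B1"
      using norm_triangle_mono[OF B2(1)[of "m (F x)"] B1(1)[of y]] by simp
    also have "\<dots> \<le> norm ?w * B2 + norm ?w * B1"
      by (intro add_mono mult_right_mono norm_le_norm_add_ii[OF s] B1 B2)
    finally have "norm x \<le> (B1 + B2) * norm ?w" by (simp add: algebra_simps)
    then have "(norm x)\<^sup>2 \<le> (B1 + B2)\<^sup>2 * (norm ?w)\<^sup>2"
      by (metis norm_ge_zero power_mono power_mult_distrib)
    also have "\<dots> \<le> (B1 + B2)\<^sup>2 * (4 * norm x * norm (H x))" by (intro mult_left_mono w) simp
    finally have "norm x * norm x \<le> norm x * (4 * (B1 + B2)\<^sup>2 * norm (H x))" by (simp add: power2_eq_square mult_ac)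
    then have "norm x \<le> 4 * (B1 + B2)\<^sup>2 * norm (H x)"
      by (cases "norm x = 0") (simp_all add: mult_le_cancel_left)
    also have "\<dots> \<le> C * norm (H x)" by (intro mult_right_mono) (auto simp: C_def)
    finally show ?thesis using C by (simp add: field_simps)
  qed
  obtain G where G: "\<And>x. H (G x) = x"
    using selfadj_bounded_below_inverse[OF H below] C by (metis inverse_positive_iff_positive)
  show ?thesis
  proof unfold_locales
    show "closure (dom D1) = UNIV"
    proof -
      have "x \<in> closure (dom D1)" for x
      proof -
        have "m' x \<in> closure (dom D)" using dense_dom by simp
        then obtain u where u: "\<And>k. u k \<in> dom D" "u \<longlonglongrightarrow> m' x" unfolding closure_sequential by blast
        have "(\<lambda>k. n' (u k)) \<longlonglongrightarrow> x"
          using bounded_linear.tendsto[OF n'_bounded_linear u(2)] by (simp add: n'_m')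
        moreover have "n' (u k) \<in> dom D1" for k using u(1)[of k] by (simp add: D1_dom m'_n' del: domIff)
        ultimately show ?thesis unfolding closure_sequential by (intro exI[of _ "\<lambda>k. n' (u k)"]) simp
      qed
      then show ?thesis by blast
    qed
    fix z
    define \<eta> where "\<eta> = G (h (n z))"
    define y where "y = n' (h \<eta>)"
    define w where "w = m (F \<eta>)"
    have y: "m' y = h \<eta>" by (simp add: y_def m'_n')
    have yd: "y \<in> dom D1" using h_dom by (simp add: D1_dom y del: domIff)
    have D1y: "the (D1 y) = w" using h_dom by (simp add: D1_app y F_def w_def del: domIff)
    have weak: "ip E (m' w) (app u) = ip E (n (z - y)) u" if u: "u \<in> dom D" for u
    proof -
      obtain \<xi> where \<xi>: "u = h \<xi>" using u dom_eq_range by blast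
      have "ip E (m' w) (app u) = ip E (F (m' (m (F \<eta>)))) \<xi>"
        by (simp add: \<xi> app_h w_def is_adjointD[OF F_selfadj])
      also have "F (m' (m (F \<eta>))) = h (n (z - y))"
        using G[of "h (n z)"] by (simp add: H_def \<eta>_def[symmetric] y_def linear_diff[OF ln] linear_diff[OF h_linear] eq_diff_eq add.commute)
      finally show ?thesis by (simp add: \<xi> is_adjointD[OF h_selfadj])
    qed
    have wd: "m' w \<in> dom D" "app (m' w) = n (z - y)" by (rule adjoint_in_dom[OF weak], assumption)+
    then have "w \<in> dom D1" "the (D1 w) = z - y" by (simp_all add: D1_dom D1_app m_n del: domIff)
    then show "\<exists>x\<in>dom D1. the (D1 x) \<in> dom D1 \<and> x + the (D1 (the (D1 x))) = z"
      using yd D1y by (intro bexI[of _ y]) simp_all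
  qed
qed

end

section \<open>Limits of adjointable and of compact operators\<close>

context hilbert_module
begin

lemma adjoint_norm_le:
  assumes T: "is_adjoint E T T'" and c: "\<And>x. norm (T x) \<le> c * norm x"
  shows "norm (T' y) \<le> 4 * c * norm y"
proof -
  have "(norm (T' y))\<^sup>2 \<le> 4 * norm y * norm (T (T' y))" by (rule norm_sq_le_adjoint[OF is_adjoint_sym[OF T]])
  also have "\<dots> \<le> 4 * norm y * (c * norm (T' y))" by (intro mult_left_mono c) auto
  finally have "norm (T' y) * norm (T' y) \<le> norm (T' y) * (4 * c * norm y)" by (simp add: power2_eq_square mult_ac)
  then show ?thesis
    using order_trans[OF norm_ge_zero c[of y]] by (cases "norm (T' y) = 0") (simp_all add: mult_le_cancel_left)
qed

lemma uniform_Cauchy_pointwise_limit: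
  fixes T :: "nat \<Rightarrow> 'e \<Rightarrow> 'e"
  assumes "\<And>e. e > 0 \<Longrightarrow> \<exists>N. \<forall>k\<ge>N. \<forall>l\<ge>N. \<forall>x. norm (T k x - T l x) \<le> e * norm x"
  shows "\<exists>S. \<forall>x. (\<lambda>k. T k x) \<longlonglongrightarrow> S x"
proof -
  have "convergent (\<lambda>k. T k x)" for x
    by (rule Cauchy_convergent, rule Cauchy_if_le_mult) (use assms in blast)
  then have "(\<lambda>k. T k x) \<longlonglongrightarrow> lim (\<lambda>k. T k x)" for x by (simp add: convergent_LIMSEQ_iff)
  then show ?thesis by (intro exI[of _ "\<lambda>x. lim (\<lambda>k. T k x)"]) blast
qed

lemma adjointable_uniform_limit:
  assumes T: "\<And>k. is_adjoint E (T k) (T' k)"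
    and C: "\<And>e. e > 0 \<Longrightarrow> \<exists>N. \<forall>k\<ge>N. \<forall>l\<ge>N. \<forall>x. norm (T k x - T l x) \<le> e * norm x"
  shows "\<exists>S. adjointable E S \<and> (\<forall>x. (\<lambda>k. T k x) \<longlonglongrightarrow> S x)"
proof -
  obtain S where S: "\<And>x. (\<lambda>k. T k x) \<longlonglongrightarrow> S x" using uniform_Cauchy_pointwise_limit[OF C] by blast
  have "\<exists>N. \<forall>k\<ge>N. \<forall>l\<ge>N. \<forall>x. norm (T' k x - T' l x) \<le> e * norm x" if e: "e > 0" for e
  proof -
    have "e / 4 > 0" using e by simp
    then obtain N where N: "\<And>k l x. k \<ge> N \<Longrightarrow> l \<ge> N \<Longrightarrow> norm (T k x - T l x) \<le> e / 4 * norm x"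
      using C by meson
    have "norm (T' k x - T' l x) \<le> e * norm x" if "k \<ge> N" "l \<ge> N" for k l x
      using adjoint_norm_le[OF adjoint_diff[OF T[of k] T[of l]] N[OF that], of x] by simp
    then show ?thesis by blast
  qed
  then obtain S' where S': "\<And>x. (\<lambda>k. T' k x) \<longlonglongrightarrow> S' x" using uniform_Cauchy_pointwise_limit[of T'] by blast
  have "is_adjoint E S S'" by (rule adjoint_limit[OF T S S'])
  then show ?thesis using S adjointableI by blast
qed

lemma compact_operator_left:
  assumes K: "compact_operator E K" and S: "is_adjoint E S S'"
  shows "compact_operator E (\<lambda>x. S (K x))"
  unfolding compact_operator_def
proof (intro conjI allI impI)
  obtain K' where K': "is_adjoint E K K'" using K by (auto simp: compact_operator_def adjointable_def)
  show "adjointable E (\<lambda>x. S (K x))" by (rule adjointableI[OF adjoint_comp[OF S K']])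
  note bS = adjoint_bounded_linear[OF S]
  obtain B where B: "\<And>x. norm (S x) \<le> norm x * B" "B > 0" using bounded_linear.pos_bounded[OF bS] by blast
  fix \<epsilon> :: real assume \<epsilon>: "\<epsilon> > 0"
  then have "\<epsilon> / B > 0" using B by simp
  then obtain n :: nat and x y where a: "\<And>z. norm (K z - (\<Sum>i<n. act E (x i) (ip E (y i) z))) \<le> \<epsilon> / B * norm z"
    using K unfolding compact_operator_def by meson
  have "norm (S (K z) - (\<Sum>i<n. act E (S (x i)) (ip E (y i) z))) \<le> \<epsilon> * norm z" for z
  proof -
    have "S (K z) - (\<Sum>i<n. act E (S (x i)) (ip E (y i) z)) = S (K z - (\<Sum>i<n. act E (x i) (ip E (y i) z)))"
      using bounded_linear.linear[OF bS] by (simp add: linear_diff linear_sum adjoint_act[OF S])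
    also have "norm \<dots> \<le> (\<epsilon> / B * norm z) * B" using B a by (meson mult_right_mono less_imp_le order_trans)
    finally show ?thesis using B by simp
  qed
  then show "\<exists>(n::nat) x y. \<forall>z. norm (S (K z) - (\<Sum>i<n. act E (x i) (ip E (y i) z))) \<le> \<epsilon> * norm z"
    by (intro exI[of _ n] exI[of _ "\<lambda>i. S (x i)"] exI[of _ y]) blast
qed

lemma compact_operator_limit:
  assumes K: "adjointable E K"
    and lim: "\<And>e. e > 0 \<Longrightarrow> \<exists>K'. compact_operator E K' \<and> (\<forall>x. norm (K x - K' x) \<le> e * norm x)"
  shows "compact_operator E K"
  unfolding compact_operator_def
proof (intro conjI allI impI K)
  fix \<epsilon> :: real assume "\<epsilon> > 0"
  then have h: "\<epsilon> / 2 > 0" by simp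
  obtain K' where K': "compact_operator E K'" "\<And>x. norm (K x - K' x) \<le> \<epsilon> / 2 * norm x" using lim[OF h] by blast
  obtain n :: nat and x y where a: "\<And>z. norm (K' z - (\<Sum>i<n. act E (x i) (ip E (y i) z))) \<le> \<epsilon> / 2 * norm z"
    using K'(1) h unfolding compact_operator_def by meson
  have "norm (K z - (\<Sum>i<n. act E (x i) (ip E (y i) z))) \<le> \<epsilon> * norm z" for z
    using norm_triangle_ineq[of "K z - K' z" "K' z - (\<Sum>i<n. act E (x i) (ip E (y i) z))"] K'(2)[of z] a[of z]
    by (simp add: field_simps)
  then show "\<exists>(n::nat) x y. \<forall>z. norm (K z - (\<Sum>i<n. act E (x i) (ip E (y i) z))) \<le> \<epsilon> * norm z" by blast
qed

end

context regular_symmetric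
begin

text \<open>
  If \<open>J \<langle>D\<rangle>\<^sup>s\<close> is bounded for some \<open>s > r\<close>, then \<open>J \<langle>D\<rangle>\<^sup>r\<close> is the norm limit of its cut-offs to
  \<open>\<langle>D\<rangle> \<le> k\<close>. That is how adjointability of the extension is obtained from norm bounds alone.
\<close>

lemma dominated_imp_adjointable_factor:
  assumes J: "is_adjoint E J J'" and dom: "dominated J (pw 1 h s)" and r: "0 \<le> r" "r < s"
  shows "\<exists>S. adjointable E S \<and> (\<forall>x. S (pw 1 h r x) = J x)"
proof -
  obtain C where C: "0 \<le> C" "\<And>x. norm (J x) \<le> C * norm (pw 1 h s x)" using dominatedE[OF dom] by blast
  note P = h_spectral
  define \<theta> where "\<theta> = band_ratio"
  have \<theta>: "0 < \<theta>" "\<theta> < 1" using band_ratio by (auto simp: \<theta>_def)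
  have M: "(1::real) > 0" by simp
  (* g k is t powr (- r), cut off near t = 0 *)
  define w where "w k t = (max t (\<theta> ^ Suc k)) powr (- r)" for k t
  have mx: "max t (\<theta> ^ Suc k) > 0" for t k using \<theta> by (simp add: less_max_iff_disj)
  have cw: "continuous_on S (w k)" for S k
    unfolding w_def by (intro continuous_intros) (use mx in \<open>auto simp: less_imp_neq[symmetric]\<close>)
  have cr: "continuous_on S (ramp 1 k)" for S k by (rule continuous_on_ramp[OF M])
  define g where "g k t = ramp 1 k t * w k t" for k t
  have cg: "continuous_on S (g k)" for S k unfolding g_def by (intro continuous_intros cr cw)
  have gw: "g k t * rpow q t = ramp 1 k t * rpow (q - r) t" if t: "t \<in> {0..1}" and q: "r \<le> q" for k t q
  proof (cases "ramp 1 k t = 0")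
    case False
    then have "\<theta> ^ Suc k < t" using ramp_eq_0[OF M, of t k] by (force simp: \<theta>_def simp del: power_Suc)
    moreover have "\<theta> ^ Suc k > 0" using \<theta> by simp
    ultimately have "w k t = t powr (- r)" "t > 0" by (simp_all add: w_def max_absorb1 del: power_Suc)
    then show ?thesis by (simp add: g_def rpow_pos powr_diff powr_minus divide_inverse)
  qed (simp add: g_def)
  have ramp_small: "\<bar>ramp 1 k t - ramp 1 l t\<bar> * rpow q t \<le> rpow q (\<theta> ^ N)"
    if t: "t \<in> {0..1}" and kl: "k \<ge> N" "l \<ge> N" and q: "0 \<le> q" for k l N t q
  proof (cases "t \<ge> \<theta> ^ N")
    case True
    have "\<theta> ^ k \<le> \<theta> ^ N" "\<theta> ^ l \<le> \<theta> ^ N" using \<theta> kl by (auto intro: power_decreasing)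
    then have "ramp 1 k t = 1" "ramp 1 l t = 1" using True by (auto intro!: ramp_eq_1 simp: \<theta>_def)
    then show ?thesis by (simp add: rpow_nonneg)
  next
    case False
    have "\<bar>ramp 1 k t - ramp 1 l t\<bar> \<le> 1" using ramp_bounds[of 1 k t] ramp_bounds[of 1 l t] by (simp add: abs_le_iff)
    then have "\<bar>ramp 1 k t - ramp 1 l t\<bar> * rpow q t \<le> 1 * rpow q t" by (intro mult_right_mono rpow_nonneg)
    also have "\<dots> \<le> rpow q (\<theta> ^ N)" using False t q by (auto intro: rpow_mono)
    finally show ?thesis .
  qed
  have small: "\<exists>N. rpow q (\<theta> ^ N) \<le> e" if q: "q > 0" and e: "e > 0" for q e
  proof -
    have "\<theta> powr q < 1" "\<theta> powr q > 0" using \<theta> q powr01_less_one[of \<theta> q] by auto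
    then obtain N where "(\<theta> powr q) ^ N < e" using real_arch_pow_inv[OF e] by blast
    moreover have "rpow q (\<theta> ^ N) = (\<theta> powr q) ^ N"
      using \<theta> by (simp add: rpow_pos powr_realpow[symmetric] powr_powr mult.commute)
    ultimately show ?thesis by (intro exI[of _ N]) simp
  qed
  let ?\<Phi> = "fcal 0 1 h"
  define T where "T k x = J (?\<Phi> (g k) x)" for k x
  define T' where "T' k x = ?\<Phi> (g k) (J' x)" for k x
  have T: "is_adjoint E (T k) (T' k)" for k
    unfolding T_def T'_def by (rule adjoint_comp[OF J fcal_selfadj[OF P cg]])
  note lJ = bounded_linear.linear[OF adjoint_bounded_linear[OF J]]
  have crp: "continuous_on {0..1} (rpow q)" if "0 \<le> q" for q using continuous_on_rpow[OF that] .
  have "\<exists>S. adjointable E S \<and> (\<forall>x. (\<lambda>k. T k x) \<longlonglongrightarrow> S x)"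
  proof (rule adjointable_uniform_limit[OF T])
    fix e :: real assume e: "e > 0"
    have q: "s - r > 0" using r by simp
    have "e / (4 * (C + 1)) > 0" using e C by simp
    then obtain N where N: "rpow (s - r) (\<theta> ^ N) \<le> e / (4 * (C + 1))" using small[OF q] by blast
    have "norm (T k x - T l x) \<le> e * norm x" if kl: "k \<ge> N" "l \<ge> N" for k l x
    proof -
      have cd: "continuous_on {0..1} (\<lambda>t. g k t - g l t)" by (intro continuous_intros cg)
      have s0: "0 \<le> s" using r by simp
      have "T k x - T l x = J (?\<Phi> (\<lambda>t. g k t - g l t) x)"
        unfolding T_def fcal_diff[OF P cg cg] linear_diff[OF lJ] ..
      also have "norm \<dots> \<le> C * norm (pw 1 h s (?\<Phi> (\<lambda>t. g k t - g l t) x))" by (rule C)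
      also have "pw 1 h s (?\<Phi> (\<lambda>t. g k t - g l t) x) = ?\<Phi> (\<lambda>t. rpow s t * (g k t - g l t)) x"
        by (rule fcal_mult[OF P crp[OF s0] cd, symmetric])
      also have "C * norm \<dots> \<le> C * (4 * (e / (4 * (C + 1))) * norm x)"
      proof (intro mult_left_mono C fcal_norm_le[OF P] continuous_on_mult crp s0 cd)
        fix t :: real assume t: "t \<in> {0..1}"
        have "rpow s t * (g k t - g l t) = (ramp 1 k t - ramp 1 l t) * rpow (s - r) t"
          using gw[OF t, of s k] gw[OF t, of s l] r by (simp add: algebra_simps)
        then show "\<bar>rpow s t * (g k t - g l t)\<bar> \<le> e / (4 * (C + 1))"
          using ramp_small[OF t kl, of "s - r"] q N by (simp add: abs_mult rpow_nonneg)
      qed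
      also have "\<dots> \<le> e * norm x"
      proof -
        have "C * (4 * (e / (4 * (C + 1)))) \<le> e" using C e by (simp add: field_simps)
        from mult_right_mono[OF this, of "norm x"] show ?thesis by (simp add: mult_ac)
      qed
      finally show ?thesis .
    qed
    then show "\<exists>N. \<forall>k\<ge>N. \<forall>l\<ge>N. \<forall>x. norm (T k x - T l x) \<le> e * norm x" by blast
  qed
  then obtain S where S: "adjointable E S" "\<And>x. (\<lambda>k. T k x) \<longlonglongrightarrow> S x" by blast
  have "S (pw 1 h r x) = J x" for x
  proof -
    have s0: "s > 0" using r by simp
    have Tr: "T k (pw 1 h r x) = J (?\<Phi> (ramp 1 k) x)" for k
    proof -
      have "?\<Phi> (g k) (pw 1 h r x) = ?\<Phi> (\<lambda>t. g k t * rpow r t) x"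
        by (rule fcal_mult[OF P cg crp[OF r(1)], symmetric])
      also have "\<dots> = ?\<Phi> (ramp 1 k) x"
        by (rule fcal_cong[OF P continuous_on_mult[OF cg crp[OF r(1)]]]) (use gw in simp)
      finally show ?thesis by (simp add: T_def)
    qed
    have "(\<lambda>k. T k (pw 1 h r x)) \<longlonglongrightarrow> J x"
    proof (rule tendsto_if_le_mult[of _ _ "4 * C * norm x"])
      fix e :: real assume e: "e > 0"
      then obtain N where N: "rpow s (\<theta> ^ N) \<le> e" using small[OF s0] by blast
      have "norm (T k (pw 1 h r x) - J x) \<le> e * (4 * C * norm x)" if k: "k \<ge> N" for k
      proof -
        have cd: "continuous_on {0..1} (\<lambda>t. ramp 1 k t - 1)" by (intro continuous_intros cr)
        have "T k (pw 1 h r x) - J x = J (?\<Phi> (\<lambda>t. ramp 1 k t - 1) x)"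
          unfolding Tr fcal_diff[OF P cr continuous_on_const] fcal_const[OF P] linear_diff[OF lJ] by simp
        also have "norm \<dots> \<le> C * norm (pw 1 h s (?\<Phi> (\<lambda>t. ramp 1 k t - 1) x))" by (rule C)
        also have "pw 1 h s (?\<Phi> (\<lambda>t. ramp 1 k t - 1) x) = ?\<Phi> (\<lambda>t. rpow s t * (ramp 1 k t - 1)) x"
          by (rule fcal_mult[OF P crp[OF less_imp_le[OF s0]] cd, symmetric])
        also have "C * norm \<dots> \<le> C * (4 * e * norm x)"
        proof (intro mult_left_mono C fcal_norm_le[OF P] continuous_on_mult crp cd less_imp_le[OF s0])
          fix t :: real assume t: "t \<in> {0..1}"
          show "\<bar>rpow s t * (ramp 1 k t - 1)\<bar> \<le> e"
          proof (cases "t \<ge> \<theta> ^ N")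
            case True
            have "\<theta> ^ k \<le> \<theta> ^ N" using \<theta> k by (auto intro: power_decreasing)
            then have "ramp 1 k t = 1" using True by (auto intro!: ramp_eq_1 simp: \<theta>_def)
            then show ?thesis using e by simp
          next
            case False
            have "\<bar>ramp 1 k t - 1\<bar> \<le> 1" using ramp_bounds[of 1 k t] by (simp add: abs_le_iff)
            then have "rpow s t * \<bar>ramp 1 k t - 1\<bar> \<le> rpow s t * 1" by (intro mult_left_mono rpow_nonneg)
            also have "\<dots> \<le> rpow s (\<theta> ^ N)" using False t s0 by (auto intro: rpow_mono)
            finally show ?thesis using N by (simp add: abs_mult rpow_nonneg)
          qed
        qed
        finally show ?thesis by (simp add: mult_ac)
      qed
      then show "\<exists>N. \<forall>k\<ge>N. norm (T k (pw 1 h r x) - J x) \<le> e * (4 * C * norm x)" by blast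
    qed
    then show ?thesis using S(2) LIMSEQ_unique by blast
  qed
  then show ?thesis using S(1) by blast
qed

lemma compact_pw_h:
  assumes K: "compact_operator E (\<lambda>x. R (d x))" and d: "is_adjoint E d d'" and r: "0 < r"
  shows "compact_operator E (\<lambda>x. pw 1 h r (d x))"
proof (rule compact_operator_limit)
  note bd = adjoint_bounded_linear[OF d]
  obtain B where B: "\<And>x. norm (d x) \<le> norm x * B" "B > 0" using bounded_linear.pos_bounded[OF bd] by blast
  show "adjointable E (\<lambda>x. pw 1 h r (d x))"
    using adjointableI[OF adjoint_comp[OF pw_selfadj[OF h_spectral] d]] r by simp
  fix e :: real assume e: "e > 0"
  define f where "f = rpow (r / 2)"
  have cf: "continuous_on {0..1} f" unfolding f_def using r by (intro continuous_on_rpow) simp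
  have f0: "f 0 = 0" using r by (simp add: f_def rpow_def)
  define \<delta> where "\<delta> = e / (8 * B)"
  have \<delta>: "\<delta> > 0" using e B by (simp add: \<delta>_def)
  have "\<forall>\<^sub>F n in sequentially. \<forall>t\<in>{0..1}. dist (poly (poly_approx 0 1 f n) t) (f t) < \<delta>"
    by (rule uniform_limitD[OF poly_approx[OF cf] \<delta>])
  then obtain n where "\<forall>t\<in>{0..1}. dist (poly (poly_approx 0 1 f n) t) (f t) < \<delta>"
    using eventually_happens'[OF sequentially_bot] by blast
  then obtain p :: "real poly" where p: "\<And>t. t \<in> {0..1} \<Longrightarrow> dist (poly p t) (f t) < \<delta>" by blast
  (* f vanishes at 0, so a polynomial approximation may be taken to have the factor t. *)
  define p0 where "p0 = p - [:poly p 0:]"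
  obtain c q where "p0 = pCons c q" using pCons_cases[of p0] by metis
  moreover have "poly p0 0 = 0" by (simp add: p0_def)
  ultimately have q: "p0 = pCons 0 q" by simp
  have p0: "\<bar>f t - poly p0 t\<bar> \<le> 2 * \<delta>" if "t \<in> {0..1}" for t
    using p[OF that] p[of 0] f0 by (simp add: p0_def dist_real_def)
  have op: "poly_op p0 R x = poly_op q R (R x)" for x
    unfolding q poly_op_pCons[OF R_linear] using poly_op_commute[of R R R q x] R_linear by simp
  show "\<exists>K'. compact_operator E K' \<and> (\<forall>x. norm (pw 1 h r (d x) - K' x) \<le> e * norm x)"
  proof (intro exI conjI allI)
    show "compact_operator E (\<lambda>x. poly_op q R (R (d x)))"
      by (rule compact_operator_left[OF K selfadj_poly_op[OF R_selfadj]])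
    fix x
    have "pw 1 h r (d x) - poly_op q R (R (d x)) = fcal 0 1 R (\<lambda>t. f t - poly p0 t) (d x)"
      using r by (simp add: pw_h f_def[symmetric] op[symmetric] fcal_diff[OF R_spectral cf] fcal_poly[OF R_spectral]
          continuous_on_poly)
    also have "norm \<dots> \<le> 4 * (2 * \<delta>) * norm (d x)"
      by (rule fcal_norm_le[OF R_spectral]) (use p0 in \<open>auto intro!: continuous_intros cf\<close>)
    also have "\<dots> \<le> 4 * (2 * \<delta>) * (norm x * B)" using \<delta> by (intro mult_left_mono B) auto
    also have "\<dots> = e * norm x" using B by (simp add: \<delta>_def)
    finally show "norm (pw 1 h r (d x) - poly_op q R (R (d x))) \<le> e * norm x" .
  qed
qed

section \<open>Commutators with the bounded transform\<close>

text \<open>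
  The identity \<open>F T h - h T F = h C h\<^sup>1\<^sup>-\<^sup>\<alpha>\<close> is the bounded form of \<open>[D, T] = C \<langle>D\<rangle>\<^sup>\<alpha>\<close>. It makes
  \<open>[F, T]\<close> a solution of a Sylvester equation with a right-hand side of the right size.
\<close>

lemma commutator_dominated:
  assumes T: "bounded_linear T" and C: "bounded_linear C" and \<alpha>: "0 \<le> \<alpha>" "\<alpha> < 1"
    and eq: "\<And>x. F (T (h x)) - h (T (F x)) = h (C (pw 1 h (1 - \<alpha>) x))"
    and r: "0 \<le> r" "r < 1 - \<alpha>"
  shows "dominated (\<lambda>x. F (T x) - T (F x)) (pw 1 h r)"
proof (rule sylvester_dominated[OF h_spectral h_spectral _ dense_range_h _ _ _ r])
  let ?k = "pw 1 h (1 - \<alpha>)"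
  note lT = bounded_linear.linear[OF T]
  have a0: "0 \<le> 1 - \<alpha>" using \<alpha> by simp
  have kF: "?k (F x) = F (?k x)" for x using F_pw_commute[OF a0] by simp
  have kh: "?k (h x) = h (?k x)" for x by (rule fcal_commute_base[OF h_spectral continuous_on_rpow[OF a0]])
  define \<Omega> where "\<Omega> x = C (?k x) - F (C (F (?k x))) + h (C (h (?k x)))" for x
  show "bounded_linear (\<lambda>x. F (T x) - T (F x))"
    using bounded_linear_sub[OF bounded_linear_compose[OF F_bounded_linear T] bounded_linear_compose[OF T F_bounded_linear]] .
  show "h (F (T x) - T (F x)) + (F (T (h x)) - T (F (h x))) = h (\<Omega> x)" for x
  proof -
    have 1: "h (C (?k x)) = F (T (h x)) - h (T (F x))" by (simp add: eq)
    have "h (F (C (F (?k x)))) = F (F (T (h (F x))) - h (T (F (F x))))"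
      unfolding eq F_h_commute kF ..
    also have "\<dots> = T (h (F x)) - h (h (T (h (F x)))) - h (F (T x)) + h (F (T (h (h x))))"
      by (simp add: linear_diff[OF F_linear] F_F F_h_commute linear_diff[OF lT] linear_diff[OF h_linear])
    finally have 2: "h (F (C (F (?k x)))) = \<dots>" .
    have "h (h (C (h (?k x)))) = h (F (T (h (h x))) - h (T (F (h x))))"
      unfolding eq kh ..
    then have 3: "h (h (C (h (?k x)))) = h (F (T (h (h x)))) - h (h (T (h (F x))))"
      by (simp add: linear_diff[OF h_linear] F_h_commute)
    show ?thesis
      unfolding \<Omega>_def linear_diff[OF h_linear] linear_add[OF h_linear] 1 2 3 by (simp add: F_h_commute)
  qed
  have "dominated (\<lambda>x. C (?k x)) ?k" by (rule dominated_left[OF C dominated_refl])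
  moreover have "dominated (\<lambda>x. F (C (F (?k x)))) ?k"
    by (rule dominated_left[OF F_bounded_linear dominated_left[OF C dominated_left[OF F_bounded_linear dominated_refl]]])
  moreover have "dominated (\<lambda>x. h (C (h (?k x)))) ?k"
    by (rule dominated_left[OF h_bounded_linear dominated_left[OF C dominated_left[OF h_bounded_linear dominated_refl]]])
  ultimately show "dominated \<Omega> ?k"
    unfolding \<Omega>_def[abs_def] by (intro dominated_add dominated_diff)
qed simp

text \<open>
  Such a \<open>T\<close> need not satisfy \<open>h T = O(h)\<close>, but \<open>T + C h\<^sup>1\<^sup>-\<^sup>\<alpha> F\<close> does, so the interpolation
  theorem applies up to an error of order \<open>1 - \<alpha>\<close>.
\<close>

lemma power_dominated:
  assumes T: "bounded_linear T" and C: "bounded_linear C" and \<alpha>: "0 \<le> \<alpha>" "\<alpha> < 1"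
    and eq: "\<And>x. F (T (h x)) - h (T (F x)) = h (C (pw 1 h (1 - \<alpha>) x))"
    and r: "0 \<le> r'" "r' < r" "r \<le> 1 - \<alpha>"
  shows "dominated (\<lambda>x. pw 1 h r (T x)) (pw 1 h r')"
proof -
  let ?k = "pw 1 h (1 - \<alpha>)"
  have a0: "0 \<le> 1 - \<alpha>" using \<alpha> by simp
  have r0: "0 \<le> r" using r by simp
  note lT = bounded_linear.linear[OF T]
  have kF: "?k (F x) = F (?k x)" for x using F_pw_commute[OF a0] by simp
  define T' where "T' x = T x + C (?k (F x))" for x
  have bT': "bounded_linear T'"
    unfolding T'_def
    using bounded_linear_add[OF T bounded_linear_compose[OF C bounded_linear_compose[OF pw_bounded_linear[OF h_spectral a0] F_bounded_linear]]] .
  have hT': "h (T' x) = F (T (F (h x))) + h (T (h (h x)))" for x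
  proof -
    have "h (T' x) = h (T x) + (F (T (h (F x))) - h (T (F (F x))))"
      by (simp add: T'_def linear_add[OF h_linear] eq)
    then show ?thesis by (simp add: F_F F_h_commute linear_diff[OF lT] linear_diff[OF h_linear])
  qed
  have "dominated (\<lambda>x. h (T' x)) h"
    unfolding hT'
    by (rule dominated_add[OF
        dominated_left[OF F_bounded_linear dominated_left[OF T dominated_left[OF F_bounded_linear dominated_refl]]]
        dominated_left[OF h_bounded_linear dominated_left[OF T dominated_left[OF h_bounded_linear dominated_refl]]]])
  then have 1: "dominated (\<lambda>x. pw 1 h r (T' x)) (pw 1 h r')"
    using r \<alpha> by (intro dominated_interpolation[OF h_spectral _ dense_range_h h_spectral bT']) auto
  have "dominated (\<lambda>x. pw 1 h r (C (?k (F x)))) ?k"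
    unfolding kF
    by (rule dominated_left[OF pw_bounded_linear[OF h_spectral r0] dominated_left[OF C dominated_left[OF F_bounded_linear dominated_refl]]])
  then have 2: "dominated (\<lambda>x. pw 1 h r (C (?k (F x)))) (pw 1 h r')"
    using dominated_trans pw_dominated_mono[OF h_spectral r(1), of "1 - \<alpha>"] r by auto
  have "pw 1 h r (T x) = pw 1 h r (T' x) - pw 1 h r (C (?k (F x)))" for x
    using bounded_linear.linear[OF pw_bounded_linear[OF h_spectral r0]] by (simp add: T'_def linear_add)
  then show ?thesis using dominated_diff[OF 1 2] by simp
qed

text \<open>
  If \<open>g\<close> preserves \<open>dom D = ran h\<close>, then \<open>g h = h k\<close> for some \<open>k\<close>, formally \<open>\<langle>D\<rangle> g \<langle>D\<rangle>\<^sup>-\<^sup>1\<close>. Taking adjoints,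
  \<open>h g\<^sup>* = k\<^sup>* h\<close>, which uniform boundedness turns into \<open>\<parallel>h g\<^sup>* x\<parallel> \<le> C \<parallel>h x\<parallel>\<close>.
\<close>

lemma domain_preserving_adjoint_dominated:
  assumes g: "is_adjoint E g g'" and pres: "g ` dom D \<subseteq> dom D" and r: "0 \<le> r'" "r' < r" "r \<le> 1"
  shows "dominated (\<lambda>x. pw 1 h r (g' x)) (pw 1 h r')"
proof -
  have "\<exists>C. \<forall>v\<in>{h (g' x) | x. norm (h x) \<le> 1}. norm v \<le> C"
  proof (rule weakly_bounded_imp_bounded)
    fix w
    have "g (h w) \<in> dom D" using pres h_dom by blast
    then obtain y where y: "g (h w) = h y" using dom_eq_range by blast
    have "norm (ip E (h (g' x)) w) \<le> 4 * norm y" if "norm (h x) \<le> 1" for x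
    proof -
      have "ip E (h (g' x)) w = ip E x (g (h w))"
        by (simp add: is_adjointD[OF h_selfadj] is_adjointD[OF is_adjoint_sym[OF g]])
      also have "\<dots> = ip E (h x) y" by (simp add: y is_adjointD[OF h_selfadj])
      finally show ?thesis
        using norm_ip_le[of "h x" y] mult_right_mono[OF that, of "4 * norm y"] by simp
    qed
    then show "\<exists>K. \<forall>v\<in>{h (g' x) | x. norm (h x) \<le> 1}. norm (ip E v w) \<le> K" by blast
  qed
  then obtain C where C: "\<And>x. norm (h x) \<le> 1 \<Longrightarrow> norm (h (g' x)) \<le> C" by blast
  note lg' = bounded_linear.linear[OF adjoint_bounded_linear[OF is_adjoint_sym[OF g]]]
  have "norm (h (g' x)) \<le> C * norm (h x)" for x
  proof (cases "h x = 0")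
    case True
    then have "x = 0" by (rule h_injective)
    then show ?thesis by (simp add: linear_0[OF lg'] linear_0[OF h_linear])
  next
    case False
    let ?c = "inverse (norm (h x))"
    have "norm (h (g' (?c *\<^sub>R x))) \<le> C" using False by (intro C) (simp add: linear_scale[OF h_linear])
    then show ?thesis using False by (simp add: linear_scale[OF lg'] linear_scale[OF h_linear] field_simps)
  qed
  then have "dominated (\<lambda>x. h (g' x)) h" by (rule dominatedI)
  then show ?thesis
    using r by (intro dominated_interpolation[OF h_spectral _ dense_range_h h_spectral adjoint_bounded_linear[OF is_adjoint_sym[OF g]]]) auto
qed

end

section \<open>Comparison of the bounded transforms of \<open>D\<close> and \<open>\<mu> D \<mu>\<^sup>*\<close>\<close>

context conformal_pair
begin

sublocale D1: regular_symmetric E D1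
  by (rule D1_regular_symmetric)

text \<open>\<open>H\<close> is the inverse of \<open>\<mu> \<langle>D\<rangle> \<mu>\<^sup>*\<close>, and \<open>S\<close>, \<open>S'\<close> are the two conjugates of \<open>F\<close> with which
  the bounded transform of \<open>\<mu> D \<mu>\<^sup>*\<close> is compared.\<close>

definition H :: "'e \<Rightarrow> 'e" where "H x = n' (h (n x))"
definition S :: "'e \<Rightarrow> 'e" where "S x = m (F (n x))"
definition S' :: "'e \<Rightarrow> 'e" where "S' x = n' (F (m' x))"
definition MH :: real where "MH = onorm H + 1"

lemma H_selfadj: "selfadj H"
  unfolding H_def using adjoint_comp[OF adjoint_comp[OF n'_adjoint h_selfadj] n_adjoint] .

lemma H_bounded_linear: "bounded_linear H"
  by (rule adjoint_bounded_linear[OF H_selfadj])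

lemma H_linear: "linear H"
  by (rule selfadj_linear[OF H_selfadj])

lemma MH_pos: "MH > 0"
  using onorm_pos_le[OF H_bounded_linear] by (simp add: MH_def)

lemma H_spectral: "spectral_bound H 0 MH"
proof -
  let ?k = "pw 1 h (1/2)"
  have k: "selfadj ?k" by (rule pw_selfadj[OF h_spectral]) simp
  have kk: "?k (?k x) = h x" for x
    using pw_add[OF h_spectral, of "1/2" "1/2" x] by (simp add: pw_1[OF h_spectral])
  have V: "is_adjoint E (\<lambda>x. n' (?k x)) (\<lambda>x. ?k (n x))" by (rule adjoint_comp[OF n'_adjoint k])
  have "(\<lambda>x. n' (?k (?k (n x)))) = H" by (auto simp: kk H_def)
  then show ?thesis using spectral_bound_self_mult_adjoint[OF V, of MH] MH_pos by (simp add: MH_def)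
qed

lemma dense_range_H: "closure (range H) = UNIV"
proof -
  have "x \<in> closure (range H)" for x
  proof -
    have "m' x \<in> closure (range h)" using dense_range_h by simp
    then obtain u where u: "\<And>k. u k \<in> range h" "u \<longlonglongrightarrow> m' x" unfolding closure_sequential by blast
    have "n' (u k) \<in> range H" for k
    proof -
      obtain y where "u k = h y" using u(1) by blast
      then have "n' (u k) = H (m y)" by (simp add: H_def n_m)
      then show ?thesis by blast
    qed
    moreover have "(\<lambda>k. n' (u k)) \<longlonglongrightarrow> x"
      using bounded_linear.tendsto[OF n'_bounded_linear u(2)] by (simp add: n'_m')
    ultimately show ?thesis unfolding closure_sequential by (intro exI[of _ "\<lambda>k. n' (u k)"]) simp
  qed
  then show ?thesis by blast
qed

lemma S_bounded_linear: "bounded_linear S"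
  unfolding S_def using bounded_linear_compose[OF m_bounded_linear bounded_linear_compose[OF F_bounded_linear n_bounded_linear]] .

lemma S'_bounded_linear: "bounded_linear S'"
  unfolding S'_def using bounded_linear_compose[OF n'_bounded_linear bounded_linear_compose[OF F_bounded_linear m'_bounded_linear]] .

lemma h_n_dominated:
  assumes "0 \<le> r'" "r' < r" "r \<le> 1"
  shows "dominated (\<lambda>x. pw 1 h r (n x)) (pw MH H r')"
proof (rule dominated_interpolation[OF H_spectral MH_pos dense_range_H h_spectral n_bounded_linear _ assms])
  have "h (n x) = m' (H x)" for x by (simp add: H_def m'_n')
  then show "dominated (\<lambda>x. h (n x)) H" using dominated_left[OF m'_bounded_linear dominated_refl] by simp
qed

lemma H_m_dominated:
  assumes "0 \<le> r'" "r' < r" "r \<le> 1"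
  shows "dominated (\<lambda>x. pw MH H r (m x)) (pw 1 h r')"
proof (rule dominated_interpolation[OF h_spectral _ dense_range_h H_spectral m_bounded_linear _ assms])
  have "H (m x) = n' (h x)" for x by (simp add: H_def n_m)
  then show "dominated (\<lambda>x. H (m x)) h" using dominated_left[OF n'_bounded_linear dominated_refl] by simp
qed simp

lemma H_dom: "H x \<in> dom D1" "the (D1 (H x)) = S x"
  by (simp_all add: D1_dom D1_app H_def m'_n' h_dom S_def app_h del: domIff)

lemma D1_dom_eq_H:
  assumes "v \<in> dom D1"
  shows "v = H (S (the (D1 v)) + m (h (m' v)))"
proof -
  have v: "m' v \<in> dom D" using assms by (simp add: D1_dom del: domIff)
  have nv: "n (the (D1 v)) = app (m' v)" using v by (simp add: D1_app n_m)
  have "v = n' (h (F (app (m' v)) + h (m' v)))" using dom_eq_h[OF v] n'_m'[of v] by simp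
  also have "\<dots> = H (m (F (app (m' v)) + h (m' v)))" by (simp add: H_def n_m)
  also have "\<dots> = H (S (the (D1 v)) + m (h (m' v)))" by (simp add: S_def nv linear_add[OF m_linear])
  finally show ?thesis .
qed

lemma h1_S: "D1.h (S x) = D1.F (H x)"
  using D1.h_app[OF H_dom(1), of x] by (simp add: H_dom D1.F_def)

definition K :: "'e \<Rightarrow> 'e" where "K x = D1.F (m (h (m' x))) - D1.h (S' x)"

lemma K_bounded_linear: "bounded_linear K"
  unfolding K_def
  using bounded_linear_sub[OF bounded_linear_compose[OF D1.F_bounded_linear
      bounded_linear_compose[OF m_bounded_linear bounded_linear_compose[OF h_bounded_linear m'_bounded_linear]]]
      bounded_linear_compose[OF D1.h_bounded_linear S'_bounded_linear]] .

lemma h1_F1_diff: "D1.h (D1.F x) - S' (H x) = D1.h (K (H x))"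
proof -
  let ?y = "S' (H x)"
  have y: "?y = n' (h (F (n x)))" by (simp add: S'_def H_def m'_n' F_h_commute)
  have yd: "?y \<in> dom D1" by (simp add: D1_dom y m'_n' h_dom del: domIff)
  have "the (D1 ?y) = m (n x - h (h (n x)))" by (simp add: D1_app y m'_n' h_dom app_h F_F)
  then have D1y: "the (D1 ?y) = x - m (h (m' (H x)))" by (simp add: linear_diff[OF m_linear] m_n H_def m'_n')
  have "D1.F ?y = D1.h (x - m (h (m' (H x))))"
    using D1.h_app[OF yd] by (simp add: D1.F_def D1y)
  then have "D1.F (D1.F ?y) = D1.h (D1.F x) - D1.h (D1.F (m (h (m' (H x)))))"
    by (simp add: linear_diff[OF D1.F_linear] D1.F_h_commute linear_diff[OF D1.h_linear])
  then show ?thesis by (simp add: D1.F_F K_def linear_diff[OF D1.h_linear] algebra_simps)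
qed

definition G :: "'e \<Rightarrow> 'e" where "G x = D1.F x - S' x"

lemma G_bounded_linear: "bounded_linear G"
  unfolding G_def using bounded_linear_sub[OF D1.F_bounded_linear S'_bounded_linear] .

text \<open>With \<open>\<langle>D\<^sub>1\<rangle> S' \<approx> F\<^sub>1 \<mu> \<langle>D\<rangle> \<mu>\<^sup>*\<close>, this is the bounded form of
  \<open>\<langle>D\<^sub>1\<rangle> G + G \<mu> \<langle>D\<rangle> \<mu>\<^sup>* \<approx> (S - S') \<mu> \<langle>D\<rangle> \<mu>\<^sup>*\<close>: both operators on the left are positive.\<close>

lemma G_sylvester: "D1.h (G x) + G (H x) = D1.h (S x - S' x + K (H x))"
  using h1_F1_diff[of x]
  by (simp add: G_def linear_diff[OF D1.h_linear] linear_add[OF D1.h_linear] h1_S algebra_simps)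

end

text \<open>
  The operators \<open>C1\<close> to \<open>C5\<close> stand for \<open>[D, T] \<langle>D\<rangle>\<^sup>-\<^sup>\<alpha>\<close> with \<open>T = \<mu>\<^sup>* a\<^sup>*\<close>, \<open>\<mu>\<^sup>-\<^sup>1 a\<^sup>*\<close>, \<open>a\<^sup>*\<close>, \<open>b \<mu>\<close>, and for
  \<open>[D\<^sub>1, a\<^sup>* b] \<mu>\<^sup>-\<^sup>1\<^sup>* \<langle>D\<rangle>\<^sup>-\<^sup>\<alpha>\<close>.
\<close>

locale conformal_commutators = conformal_pair E D m m' n n'
  for E :: "('b::cstar_algebra, 'e::complex_banach) hilbert_structure" and D :: "'e \<rightharpoonup> 'e"
    and m m' n n' :: "'e \<Rightarrow> 'e" +
  fixes a' b C1 C2 C3 C4 C5 :: "'e \<Rightarrow> 'e" and \<alpha> :: real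
  assumes a': "bounded_linear a'" and b: "bounded_linear b" and \<alpha>: "0 \<le> \<alpha>" "\<alpha> < 1"
    and C: "bounded_linear C1" "bounded_linear C2" "bounded_linear C3" "bounded_linear C4" "bounded_linear C5"
    and comm_m: "\<And>x. F (m' (a' (h x))) - h (m' (a' (F x))) = h (C1 (pw 1 h (1 - \<alpha>) x))"
    and comm_n: "\<And>x. F (n (a' (h x))) - h (n (a' (F x))) = h (C2 (pw 1 h (1 - \<alpha>) x))"
    and comm_a: "\<And>x. F (a' (h x)) - h (a' (F x)) = h (C3 (pw 1 h (1 - \<alpha>) x))"
    and comm_b: "\<And>x. F (b (m (h x))) - h (b (m (F x))) = h (C4 (pw 1 h (1 - \<alpha>) x))"
    and ab_dom: "\<And>y. y \<in> dom D1 \<Longrightarrow> a' (b y) \<in> dom D1"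
    and comm_ab: "\<And>y. the (D1 (a' (b (n' (h y))))) - a' (b (m (F y))) = C5 (pw 1 h (1 - \<alpha>) y)"
begin

definition L :: "'e \<Rightarrow> 'e" where "L x = b (m x)"
definition X :: "'e \<Rightarrow> 'e" where "X x = a' (b x)"
definition comm :: "('e \<Rightarrow> 'e) \<Rightarrow> 'e \<Rightarrow> 'e" where "comm T x = F (T x) - T (F x)"

lemma L_bounded_linear: "bounded_linear L"
  unfolding L_def using bounded_linear_compose[OF b m_bounded_linear] .

lemma X_bounded_linear: "bounded_linear X"
  unfolding X_def using bounded_linear_compose[OF a' b] .

lemmas L_linear = bounded_linear.linear[OF L_bounded_linear]
  and a'_linear = bounded_linear.linear[OF a']

definition ma :: "'e \<Rightarrow> 'e" where "ma x = m' (a' x)"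
definition na :: "'e \<Rightarrow> 'e" where "na x = n (a' x)"

lemma comm_dominated:
  assumes r: "0 \<le> r" "r < 1 - \<alpha>"
  shows "dominated (comm ma) (pw 1 h r)" and "dominated (comm na) (pw 1 h r)"
    and "dominated (comm a') (pw 1 h r)" and "dominated (comm L) (pw 1 h r)"
  unfolding comm_def[abs_def] ma_def[abs_def] na_def[abs_def] L_def[abs_def]
  by (rule commutator_dominated[OF bounded_linear_compose[OF m'_bounded_linear a'] C(1) \<alpha> comm_m r]
      commutator_dominated[OF bounded_linear_compose[OF n_bounded_linear a'] C(2) \<alpha> comm_n r]
      commutator_dominated[OF a' C(3) \<alpha> comm_a r]
      commutator_dominated[OF bounded_linear_compose[OF b m_bounded_linear] C(4) \<alpha> comm_b r])+

lemma pw_L_dominated: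
  assumes "0 \<le> r'" "r' < r" "r \<le> 1 - \<alpha>"
  shows "dominated (\<lambda>x. pw 1 h r (L x)) (pw 1 h r')"
  unfolding L_def[abs_def]
  by (rule power_dominated[OF bounded_linear_compose[OF b m_bounded_linear] C(4) \<alpha> comm_b assms])

lemma dominated_L:
  assumes J: "dominated J (pw 1 h r)" and r: "0 \<le> r'" "r' < r" "r \<le> 1 - \<alpha>"
  shows "dominated (\<lambda>x. J (L x)) (pw 1 h r')"
  using dominated_trans[OF dominated_right[OF J, of L] pw_L_dominated[OF r]] .

lemma dominated_n:
  assumes J: "dominated J (pw 1 h r)" and r: "0 \<le> r'" "r' < r" "r \<le> 1 - \<alpha>"
  shows "dominated (\<lambda>x. J (n x)) (pw MH H r')"
  using dominated_trans[OF dominated_right[OF J, of n] h_n_dominated[OF r(1,2)]] r \<alpha> by simp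

lemma dominated_F:
  assumes J: "dominated J (pw 1 h r)" and r: "0 \<le> r"
  shows "dominated (\<lambda>x. J (F x)) (pw 1 h r)"
proof -
  have "dominated (\<lambda>x. pw 1 h r (F x)) (pw 1 h r)"
    using dominated_left[OF F_bounded_linear dominated_refl[of "pw 1 h r"]] by (simp add: F_pw_commute[OF r])
  then show ?thesis using dominated_trans[OF dominated_right[OF J, of F]] by blast
qed

lemma H_dominated: "0 \<le> r \<Longrightarrow> r \<le> 1 \<Longrightarrow> dominated H (pw MH H r)"
  using pw_dominated_mono[OF H_spectral, of r 1] by (simp add: pw_1[OF H_spectral, abs_def])

text \<open>Both \<open>S a\<^sup>*\<close> and \<open>S' a\<^sup>*\<close> are close to \<open>a\<^sup>* F\<close>.\<close>

lemma S_S'_X: "S (X x) - S' (X x) = m (comm na (L (n x))) - n' (comm ma (L (n x)))"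
proof -
  have "L (n x) = b x" by (simp add: L_def m_n)
  then show ?thesis
    by (simp add: S_def S'_def X_def comm_def na_def ma_def linear_diff[OF m_linear] linear_diff[OF n'_linear] m_n n'_m')
qed

lemma S_S'_X_dominated:
  assumes r: "0 \<le> r" "r < 1 - \<alpha>"
  shows "dominated (\<lambda>x. S (X x) - S' (X x)) (pw MH H r)"
proof -
  define \<epsilon> where "\<epsilon> = (1 - \<alpha> - r) / 4"
  have \<epsilon>: "\<epsilon> > 0" "r + 3 * \<epsilon> < 1 - \<alpha>" using r by (auto simp: \<epsilon>_def field_simps)
  have chain: "dominated (\<lambda>x. J (L (n x))) (pw MH H r)" if "dominated J (pw 1 h (r + 2 * \<epsilon>))" for J :: "'e \<Rightarrow> 'e"
    using r \<epsilon> by (intro dominated_n[OF dominated_L[OF that, of "r + \<epsilon>"]]) auto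
  show ?thesis
    unfolding S_S'_X using r \<epsilon>
    by (intro dominated_diff dominated_left[OF m_bounded_linear] dominated_left[OF n'_bounded_linear]
        chain comm_dominated) auto
qed

text \<open>\<open>\<Lambda>\<close> is the commutator of \<open>\<mu> \<langle>D\<rangle> \<mu>\<^sup>*\<close> with \<open>X\<close>, multiplied by \<open>H\<close> from the right.\<close>

definition \<Lambda> :: "'e \<Rightarrow> 'e" where
  "\<Lambda> x = S (C5 (pw 1 h (1 - \<alpha>) (n x))) + m (comm na (L (F (n x)))) + a' (comm L (F (n x)))
     + (m (h (m' (X (H x)))) - X (m (h (m' (H x)))))"

lemma X_H_commutator: "X (H x) - H (X x) = H (\<Lambda> x)"
proof -
  define v where "v = X (H x)"
  have vd: "v \<in> dom D1" unfolding v_def X_def by (rule ab_dom[OF H_dom(1)])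
  let ?c = "C5 (pw 1 h (1 - \<alpha>) (n x))"
  have D1v: "the (D1 v) = ?c + X (S x)"
    using comm_ab[of "n x"] by (simp add: v_def X_def H_def S_def algebra_simps)
  let ?y = "F (n x)"
  have "S (X (S x)) = m (F (na (L ?y)))" by (simp add: S_def X_def L_def na_def)
  also have "\<dots> = m (comm na (L ?y)) + a' (F (L ?y))"
    by (simp add: comm_def linear_diff[OF m_linear] na_def m_n)
  also have "a' (F (L ?y)) = a' (comm L ?y) + a' (L (F ?y))"
    by (simp add: comm_def linear_diff[OF a'_linear])
  also have "a' (L (F ?y)) = X x - X (m (h (m' (H x))))"
    by (simp add: F_F linear_diff[OF L_linear] linear_diff[OF a'_linear]) (simp add: L_def X_def m_n H_def m'_n')
  finally have "S (X (S x)) + (m (h (m' v)) - X x)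
      = m (comm na (L ?y)) + a' (comm L ?y) + (m (h (m' v)) - X (m (h (m' (H x)))))"
    by (simp add: algebra_simps)
  then have "S (the (D1 v)) + m (h (m' v)) - X x = \<Lambda> x"
    by (simp add: D1v linear_add[OF bounded_linear.linear[OF S_bounded_linear]] \<Lambda>_def v_def[symmetric] algebra_simps)
  moreover have "v - H (X x) = H (S (the (D1 v)) + m (h (m' v)) - X x)"
    unfolding linear_diff[OF H_linear] using D1_dom_eq_H[OF vd] by simp
  ultimately show ?thesis by (simp add: v_def)
qed

lemma \<Lambda>_dominated:
  assumes r: "0 \<le> r" "r < 1 - \<alpha>"
  shows "dominated \<Lambda> (pw MH H r)"
proof -
  define \<epsilon> where "\<epsilon> = (1 - \<alpha> - r) / 4"
  have \<epsilon>: "\<epsilon> > 0" "r + 3 * \<epsilon> < 1 - \<alpha>" using r by (auto simp: \<epsilon>_def field_simps)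
  have 1: "dominated (\<lambda>x. S (C5 (pw 1 h (1 - \<alpha>) (n x)))) (pw MH H r)"
    by (rule dominated_left[OF S_bounded_linear dominated_left[OF C(5) h_n_dominated]]) (use r \<alpha> in auto)
  have 2: "dominated (\<lambda>x. m (comm na (L (F (n x))))) (pw MH H r)"
  proof (rule dominated_left[OF m_bounded_linear])
    have "dominated (\<lambda>x. comm na (L x)) (pw 1 h (r + \<epsilon>))"
      using r \<epsilon> by (intro dominated_L[OF comm_dominated(2)[of "r + 2 * \<epsilon>"]]) auto
    then show "dominated (\<lambda>x. comm na (L (F (n x)))) (pw MH H r)"
      using r \<epsilon> by (intro dominated_n[OF dominated_F[of "\<lambda>x. comm na (L x)" "r + \<epsilon>"]]) auto
  qed
  have 3: "dominated (\<lambda>x. a' (comm L (F (n x)))) (pw MH H r)"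
    using r \<epsilon> by (intro dominated_left[OF a'] dominated_n[OF dominated_F[OF comm_dominated(4)[of "r + \<epsilon>"]]]) auto
  have H: "dominated H (pw MH H r)" using r \<alpha> by (intro H_dominated) auto
  have A: "bounded_linear (\<lambda>x. m (h (m' (X x))) - X (m (h (m' x))))"
    using bounded_linear_sub[OF
        bounded_linear_compose[OF m_bounded_linear bounded_linear_compose[OF h_bounded_linear bounded_linear_compose[OF m'_bounded_linear X_bounded_linear]]]
        bounded_linear_compose[OF X_bounded_linear bounded_linear_compose[OF m_bounded_linear bounded_linear_compose[OF h_bounded_linear m'_bounded_linear]]]] .
  have 4: "dominated (\<lambda>x. m (h (m' (X (H x)))) - X (m (h (m' (H x))))) (pw MH H r)"
    using dominated_left[OF A H] .
  show ?thesis
    unfolding \<Lambda>_def[abs_def] by (rule dominated_add[OF dominated_add[OF dominated_add[OF 1 2] 3] 4])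
qed

text \<open>
  Every occurrence of \<open>G H\<close> equals \<open>h\<^sub>1 \<Gamma>\<close> by the equation for \<open>G\<close>. So the commutator of \<open>X\<close> with \<open>H\<close>
  contributes \<open>G H \<Lambda> = h\<^sub>1 \<Gamma> \<Lambda>\<close> to the equation for \<open>G X\<close>, again with a factor \<open>h\<^sub>1\<close> on the left.
\<close>

theorem G_X_dominated:
  assumes r: "0 \<le> r" "r < 1 - \<alpha>"
  shows "dominated (\<lambda>x. G (X x)) (pw MH H r)"
proof -
  (* room for the loss in the exponent *)
  define q where "q = (r + (1 - \<alpha>)) / 2"
  have q: "0 \<le> q" "r < q" "q < 1 - \<alpha>" using r by (auto simp: q_def)
  define \<Gamma> where "\<Gamma> z = S z - S' z + K (H z) - G z" for z
  define \<Omega> where "\<Omega> x = (S (X x) - S' (X x)) + K (H (X x)) + \<Gamma> (\<Lambda> x)" for x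
  have b\<Gamma>: "bounded_linear \<Gamma>"
    unfolding \<Gamma>_def
    using bounded_linear_sub[OF bounded_linear_add[OF bounded_linear_sub[OF S_bounded_linear S'_bounded_linear]
          bounded_linear_compose[OF K_bounded_linear H_bounded_linear]] G_bounded_linear] .
  have GH: "G (H z) = D1.h (\<Gamma> z)" for z
    unfolding \<Gamma>_def linear_diff[OF D1.h_linear, of _ "G z"] eq_diff_eq
    using G_sylvester[of z] by (simp only: add.commute)
  have \<Lambda>: "dominated \<Lambda> (pw MH H q)" by (rule \<Lambda>_dominated[OF q(1,3)])
  have H: "dominated H (pw MH H q)" using q \<alpha> by (intro H_dominated) auto
  have HX: "dominated (\<lambda>x. H (X x)) (pw MH H q)"
  proof -
    have "H (X x) = X (H x) - H (\<Lambda> x)" for x using X_H_commutator[of x] by (simp add: algebra_simps)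
    then show ?thesis
      using dominated_diff[OF dominated_left[OF X_bounded_linear H] dominated_left[OF H_bounded_linear \<Lambda>]] by simp
  qed
  show ?thesis
  proof (rule sylvester_dominated[OF D1.h_spectral H_spectral MH_pos dense_range_H _ _ _ r(1) q(2)])
    show "bounded_linear (\<lambda>x. G (X x))" using bounded_linear_compose[OF G_bounded_linear X_bounded_linear] .
    show "D1.h (G (X x)) + G (X (H x)) = D1.h (\<Omega> x)" for x
    proof -
      have "X (H x) = H (X x) + H (\<Lambda> x)" using X_H_commutator[of x] by (simp add: algebra_simps)
      then have "D1.h (G (X x)) + G (X (H x)) = (D1.h (G (X x)) + G (H (X x))) + G (H (\<Lambda> x))"
        by (simp add: linear_add[OF bounded_linear.linear[OF G_bounded_linear]])
      also have "\<dots> = D1.h (\<Omega> x)"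
        unfolding G_sylvester unfolding GH \<Omega>_def linear_add[OF D1.h_linear] ..
      finally show ?thesis .
    qed
    show "dominated \<Omega> (pw MH H q)"
      unfolding \<Omega>_def[abs_def]
      by (rule dominated_add[OF dominated_add[OF S_S'_X_dominated[OF q(1,3)] dominated_left[OF K_bounded_linear HX]]
            dominated_left[OF b\<Gamma> \<Lambda>]])
  qed
qed

text \<open>\<open>F\<^sub>1 a\<^sup>* b \<mu> - F a\<^sup>* b \<mu> = G a\<^sup>* b \<mu> + (S' a\<^sup>* - a\<^sup>* F) b \<mu> - (F a\<^sup>* - a\<^sup>* F) b \<mu>\<close>.\<close>

theorem bounded_transform_difference_dominated:
  assumes r: "0 \<le> r" "r < 1 - \<alpha>"
  shows "dominated (\<lambda>x. D1.F (a' (b (m x))) - F (a' (b (m x)))) (pw 1 h r)"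
proof -
  define \<epsilon> where "\<epsilon> = (1 - \<alpha> - r) / 2"
  have \<epsilon>: "\<epsilon> > 0" "r + \<epsilon> < 1 - \<alpha>" using r by (auto simp: \<epsilon>_def field_simps)
  have "dominated (\<lambda>x. G (X (m x))) (pw 1 h r)"
    using dominated_trans[OF dominated_right[OF G_X_dominated[of "r + \<epsilon>"], of m] H_m_dominated[of r "r + \<epsilon>"]] r \<epsilon> \<alpha>
    by simp
  moreover have "dominated (\<lambda>x. n' (comm ma (L x))) (pw 1 h r)" "dominated (\<lambda>x. comm a' (L x)) (pw 1 h r)"
    using r \<epsilon> by (intro dominated_left[OF n'_bounded_linear] dominated_L[OF comm_dominated(1)[of "r + \<epsilon>"]]
        dominated_L[OF comm_dominated(3)[of "r + \<epsilon>"]]; simp)+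
  ultimately have "dominated (\<lambda>x. G (X (m x)) + n' (comm ma (L x)) - comm a' (L x)) (pw 1 h r)"
    by (intro dominated_add dominated_diff)
  moreover have "G (X (m x)) + n' (comm ma (L x)) - comm a' (L x) = D1.F (a' (b (m x))) - F (a' (b (m x)))" for x
    by (simp add: G_def X_def L_def S'_def comm_def ma_def linear_diff[OF n'_linear] n'_m')
  ultimately show ?thesis by simp
qed

end

section \<open>Translation to partially defined operators\<close>

lemma total_op_map_comp [simp]: "total_op f \<circ>\<^sub>m total_op g = total_op (\<lambda>x. f (g x))"
  by (auto simp: total_op_def map_comp_def)

lemma total_op_diff: "total_op f -\<^sub>m total_op g = total_op (\<lambda>x. f x - g x)"
  by (auto simp: total_op_def op_diff_def fun_eq_iff dom_def)

lemma total_op_inject: "total_op f = total_op g \<Longrightarrow> f = g"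
  by (auto simp: total_op_def fun_eq_iff)

lemma dom_total_op [simp]: "dom (total_op f) = UNIV"
  by (auto simp: total_op_def)

lemma bounded_operatorE:
  fixes T :: "'e::topological_space \<rightharpoonup> 'e"
  assumes "bounded_operator E T"
  obtains S where "adjointable E S" "\<And>x. x \<in> dom T \<Longrightarrow> the (T x) = S x" "dom T \<noteq> {}"
proof -
  obtain S where S: "closure (dom T) = UNIV" "adjointable E S" "T \<subseteq>\<^sub>m total_op S"
    using assms by (auto simp: bounded_operator_def densely_defined_def)
  have "the (T x) = S x" if "x \<in> dom T" for x
    using S(3) that unfolding map_le_def total_op_def by (metis option.sel)
  moreover have "dom T \<noteq> {}" using S(1) by auto
  ultimately show ?thesis using that S(2) by blast
qed

lemma commutator_eq:
  assumes "T ` dom D \<subseteq> dom D" and x: "x \<in> dom D"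
  shows "commutator D T x = Some (the (D (T x)) - T (the (D x)))"
proof -
  have "T x \<in> dom D" using assms by blast
  then show ?thesis using assms x by (auto simp: commutator_def op_diff_def map_comp_def total_op_def)
qed

lemma map_comp_dom_imp_nonempty: "dom (f \<circ>\<^sub>m g) \<noteq> {} \<Longrightarrow> f \<noteq> Map.empty \<and> g \<noteq> Map.empty"
  by (auto simp: map_comp_def dom_def split: option.splits)

lemma commutator_preserves_dom: "commutator D T \<noteq> Map.empty \<Longrightarrow> T ` dom D \<subseteq> dom D"
  by (auto simp: commutator_def split: if_splits)

context regular_symmetric
begin

text \<open>A bound on \<open>\<langle>D\<rangle>\<^sup>-\<^sup>\<alpha> [D, T]\<close> is, after taking adjoints, a bound on \<open>[D, T\<^sup>*] \<langle>D\<rangle>\<^sup>-\<^sup>\<alpha>\<close> in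
  the bounded form in which it is used, although \<open>T\<^sup>*\<close> need not preserve the domain of \<open>D\<close>.\<close>

lemma left_commutator_bound:
  assumes T: "is_adjoint E T T'" and \<alpha>: "0 \<le> \<alpha>" "\<alpha> < 1"
    and bd: "bounded_operator E (bracket_power E D (- \<alpha>) \<circ>\<^sub>m commutator D T)"
  shows "\<exists>C. bounded_linear C \<and> (\<forall>x. F (T' (h x)) - h (T' (F x)) = h (C (pw 1 h (1 - \<alpha>) x)))"
proof -
  let ?k = "pw 1 h \<alpha>" and ?k' = "pw 1 h (1 - \<alpha>)"
  have br: "bracket_power E D (- \<alpha>) = total_op ?k" using bracket_power_nonpos[of "- \<alpha>"] \<alpha> by simp
  obtain B where B: "adjointable E B"
    "\<And>x. x \<in> dom (total_op ?k \<circ>\<^sub>m commutator D T) \<Longrightarrow> the ((total_op ?k \<circ>\<^sub>m commutator D T) x) = B x"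
    "dom (total_op ?k \<circ>\<^sub>m commutator D T) \<noteq> {}"
    using bounded_operatorE[OF bd[unfolded br]] by blast
  have pres: "T ` dom D \<subseteq> dom D" using commutator_preserves_dom map_comp_dom_imp_nonempty[OF B(3)] by blast
  have Bh: "B (h y) = ?k (app (T (h y)) - T (F y))" for y
  proof -
    have "commutator D T (h y) = Some (app (T (h y)) - T (F y))"
      using commutator_eq[OF pres h_dom] by (simp add: app_h)
    then have "(total_op ?k \<circ>\<^sub>m commutator D T) (h y) = Some (?k (app (T (h y)) - T (F y)))"
      by (simp add: total_op_def)
    then show ?thesis using B(2)[of "h y"] by (simp add: dom_def)
  qed
  have key: "F (T (h y)) - h (T (F y)) = ?k' (B (h y))" for y
  proof -
    have "T (h y) \<in> dom D" using pres h_dom by blast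
    then have 1: "h (app (T (h y))) = F (T (h y))" by (simp add: h_app[symmetric] F_def)
    have "?k' (B (h y)) = h (app (T (h y)) - T (F y))"
      unfolding Bh using pw_add[OF h_spectral, of "1 - \<alpha>" \<alpha> "app (T (h y)) - T (F y)"] \<alpha> by (simp add: pw_1[OF h_spectral])
    then show ?thesis by (simp add: linear_diff[OF h_linear] 1)
  qed
  obtain B' where B': "is_adjoint E B B'" using B(1) by (auto simp: adjointable_def)
  have k': "selfadj ?k'" by (rule pw_selfadj[OF h_spectral]) (use \<alpha> in simp)
  have a1: "is_adjoint E (\<lambda>x. F (T (h x)) - h (T (F x))) (\<lambda>x. h (T' (F x)) - F (T' (h x)))"
    by (rule adjoint_diff[OF adjoint_comp[OF adjoint_comp[OF F_selfadj T] h_selfadj] adjoint_comp[OF adjoint_comp[OF h_selfadj T] F_selfadj]])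
  have a2: "is_adjoint E (\<lambda>x. ?k' (B (h x))) (\<lambda>x. h (B' (?k' x)))"
    by (rule adjoint_comp[OF adjoint_comp[OF k' B'] h_selfadj])
  have eq: "h (T' (F x)) - F (T' (h x)) = h (B' (?k' x))" for x
    using is_adjoint_unique[OF a1[unfolded key] a2] by (rule fun_cong)
  have "F (T' (h x)) - h (T' (F x)) = h (- B' (?k' x))" for x
    using eq[of x] by (simp add: linear_neg[OF h_linear]) (metis minus_diff_eq)
  moreover have "bounded_linear (\<lambda>x. - B' x)"
    using adjoint_bounded_linear[OF adjoint_minus[OF is_adjoint_sym[OF B']]] .
  ultimately show ?thesis by (intro exI[of _ "\<lambda>x. - B' x"]) blast
qed

lemma right_commutator_bound:
  assumes \<alpha>: "0 \<le> \<alpha>" "\<alpha> < 1"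
    and bd: "bounded_operator E (commutator D T \<circ>\<^sub>m bracket_power E D (- \<alpha>))"
  shows "\<exists>C. bounded_linear C \<and> (\<forall>x. F (T (h x)) - h (T (F x)) = h (C (pw 1 h (1 - \<alpha>) x)))"
proof -
  let ?k = "pw 1 h \<alpha>" and ?k' = "pw 1 h (1 - \<alpha>)"
  have br: "bracket_power E D (- \<alpha>) = total_op ?k" using bracket_power_nonpos[of "- \<alpha>"] \<alpha> by simp
  obtain B where B: "adjointable E B"
    "\<And>x. x \<in> dom (commutator D T \<circ>\<^sub>m total_op ?k) \<Longrightarrow> the ((commutator D T \<circ>\<^sub>m total_op ?k) x) = B x"
    "dom (commutator D T \<circ>\<^sub>m total_op ?k) \<noteq> {}"
    using bounded_operatorE[OF bd[unfolded br]] by blast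
  have pres: "T ` dom D \<subseteq> dom D" using commutator_preserves_dom map_comp_dom_imp_nonempty[OF B(3)] by blast
  have "F (T (h x)) - h (T (F x)) = h (B (?k' x))" for x
  proof -
    have kk: "?k (?k' x) = h x"
      using pw_add[OF h_spectral, of \<alpha> "1 - \<alpha>" x] \<alpha> by (simp add: pw_1[OF h_spectral])
    have "(commutator D T \<circ>\<^sub>m total_op ?k) (?k' x) = Some (app (T (h x)) - T (F x))"
      using commutator_eq[OF pres h_dom] by (simp add: app_h kk total_op_def)
    then have "B (?k' x) = app (T (h x)) - T (F x)" using B(2)[of "?k' x"] by (simp add: dom_def)
    moreover have "T (h x) \<in> dom D" using pres h_dom by blast
    ultimately show ?thesis by (simp add: linear_diff[OF h_linear] h_app[symmetric] F_def)
  qed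
  then show ?thesis using adjointable_bounded_linear[OF B(1)] by blast
qed

text \<open>
  Here \<open>\<langle>D\<rangle>\<^sup>\<beta>\<close> is densely defined since its domain contains \<open>ran h\<close>, and the adjointable factor of \<open>J\<close>
  through \<open>h\<^sup>\<beta>\<close> is the extension.
\<close>

lemma dominated_imp_bounded_operator:
  assumes J: "is_adjoint E J J'" and dom: "\<And>r. 0 \<le> r \<Longrightarrow> r < s \<Longrightarrow> dominated J (pw 1 h r)"
    and s: "s \<le> 1" and \<beta>: "\<beta> < s"
  shows "bounded_operator E (total_op J \<circ>\<^sub>m bracket_power E D \<beta>)"
proof (cases "\<beta> \<le> 0")
  case True
  have "adjointable E (\<lambda>x. J (pw 1 h (- \<beta>) x))"
    using adjointableI[OF adjoint_comp[OF J pw_selfadj[OF h_spectral]]] True by simp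
  then show ?thesis
    using True by (auto simp: bracket_power_nonpos bounded_operator_def densely_defined_def)
next
  case False
  then have \<beta>0: "0 < \<beta>" by simp
  let ?k = "pw 1 h \<beta>"
  obtain S where S: "adjointable E S" "\<And>x. S (?k x) = J x"
    using dominated_imp_adjointable_factor[OF J dom[of "(\<beta> + s) / 2"], of \<beta>] \<beta> \<beta>0 by (auto simp: field_simps)
  have lk: "linear ?k" using \<beta>0 by (intro bounded_linear.linear pw_bounded_linear[OF h_spectral]) simp
  have inj: "x = y" if "?k x = ?k y" for x y
    using pw_h_injective[of \<beta> "x - y"] that \<beta> \<beta>0 s by (simp add: linear_diff[OF lk])
  have inv: "op_inverse (total_op ?k) (?k x) = Some x" for x
  proof -
    have "?k x \<in> ran (total_op ?k)" by (auto simp: ran_def total_op_def)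
    moreover have "(THE y. total_op ?k y = Some (?k x)) = x" using inj by (auto simp: total_op_def)
    ultimately show ?thesis by (simp add: op_inverse_def)
  qed
  have d: "dom (op_inverse (total_op ?k)) = range ?k"
    by (auto simp: op_inverse_def ran_def total_op_def dom_def split: if_splits)
  have d': "dom (total_op J \<circ>\<^sub>m op_inverse (total_op ?k)) = range ?k"
    using d by (auto simp: map_comp_def total_op_def dom_def split: option.splits)
  have "range h \<subseteq> range ?k"
    using pw_add[OF h_spectral, of \<beta> "1 - \<beta>"] \<beta>0 \<beta> s by (auto simp: pw_1[OF h_spectral])
  then have "closure (range ?k) = UNIV" using closure_mono[of "range h" "range ?k"] dense_range_h by auto
  moreover have "(total_op J \<circ>\<^sub>m op_inverse (total_op ?k)) (?k x) = total_op S (?k x)" for x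
    by (simp add: map_comp_def inv) (simp add: total_op_def S(2))
  then have "total_op J \<circ>\<^sub>m op_inverse (total_op ?k) \<subseteq>\<^sub>m total_op S"
    unfolding map_le_def d' by blast
  ultimately show ?thesis
    using S(1) d' by (auto simp: bracket_power_pos[OF \<beta>0] bounded_operator_def densely_defined_def)
qed

lemma dominated_imp_compact:
  assumes J: "is_adjoint E J J'" and dom: "dominated J (pw 1 h s)" and s: "0 < s"
    and d: "adjointable E d" and K: "is_compact E (op_inverse (one_plus (D \<circ>\<^sub>m D)) \<circ>\<^sub>m total_op d)"
  shows "is_compact E (total_op (\<lambda>x. J (d x)))"
proof -
  obtain d' where d': "is_adjoint E d d'" using d by (auto simp: adjointable_def)
  have "compact_operator E (\<lambda>x. R (d x))"
    using K by (auto simp: is_compact_def op_inverse_total dest!: total_op_inject)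
  then have k: "compact_operator E (\<lambda>x. pw 1 h (s / 2) (d x))" using compact_pw_h[OF _ d'] s by simp
  obtain S S' where S: "is_adjoint E S S'" "\<And>x. S (pw 1 h (s / 2) x) = J x"
    using dominated_imp_adjointable_factor[OF J dom, of "s / 2"] s by (auto simp: adjointable_def)
  show ?thesis
    using compact_operator_left[OF k S(1)] by (auto simp: is_compact_def S(2))
qed

end

theorem theorem2p44:
  fixes E :: "('b::cstar_algebra, 'e::complex_banach) hilbert_structure"
    and D D\<^sub>1 :: "'e \<rightharpoonup> 'e"
    and \<mu> a b :: "'e \<Rightarrow> 'e"
    and \<alpha> :: real
  assumes "hilbert_module E" and "countably_generated E"
    and "selfadjoint_regular E D"
    and "invertible_adjointable E \<mu>"
    and "adjointable E a" and "adjointable E b"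
    and "\<And>X. X \<in> {adj E \<mu> \<circ> a, inv \<mu> \<circ> a, a, b \<circ> \<mu>, b \<circ> adj E (inv \<mu>)} \<Longrightarrow> X ` dom D \<subseteq> dom D"
    and "0 \<le> \<alpha>" and "\<alpha> < 1"
    and "D\<^sub>1 = conformal E \<mu> D"
    and "bounded_operator E (bracket_power E D (-\<alpha>) \<circ>\<^sub>m commutator D (a \<circ> \<mu>))"
    and "bounded_operator E (bracket_power E D (-\<alpha>) \<circ>\<^sub>m commutator D (a \<circ> adj E (inv \<mu>)))"
    and "bounded_operator E (bracket_power E D (-\<alpha>) \<circ>\<^sub>m commutator D a)"
    and "bounded_operator E (commutator D (b \<circ> \<mu>) \<circ>\<^sub>m bracket_power E D (-\<alpha>))"
    and "bounded_operator E
           (commutator D\<^sub>1 (adj E a \<circ> b) \<circ>\<^sub>m total_op (adj E (inv \<mu>)) \<circ>\<^sub>m bracket_power E D (-\<alpha>))"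
  shows "(\<forall>\<beta> < 1 - \<alpha>. bounded_operator E
            ((bounded_transform E D\<^sub>1 -\<^sub>m bounded_transform E D)
               \<circ>\<^sub>m total_op (adj E a \<circ> b \<circ> \<mu>) \<circ>\<^sub>m bracket_power E D \<beta>)) \<and>
         (\<forall>c. adjointable E c \<and> (c \<circ> adj E (inv \<mu>)) ` dom D \<subseteq> dom D \<longrightarrow>
            (\<forall>\<beta> < 1 - \<alpha>. bounded_operator E
               ((bounded_transform E D\<^sub>1 -\<^sub>m bounded_transform E D)
                  \<circ>\<^sub>m total_op (adj E a \<circ> b \<circ> adj E c) \<circ>\<^sub>m bracket_power E D \<beta>)) \<and>
            (\<forall>d. adjointable E d \<and>
                 is_compact E (op_inverse (one_plus (D \<circ>\<^sub>m D)) \<circ>\<^sub>m total_op d) \<longrightarrow>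
               is_compact E
                 ((bounded_transform E D\<^sub>1 -\<^sub>m bounded_transform E D)
                    \<circ>\<^sub>m total_op (adj E a \<circ> b \<circ> adj E c \<circ> d))))"
proof -
  interpret hilbert_module E by fact
  note \<alpha> = assms(8,9)
  define m' n n' a' where "m' = adj E \<mu>" and "n = inv \<mu>" and "n' = adj E (inv \<mu>)" and "a' = adj E a"
  have \<mu>: "adjointable E \<mu>" "bij \<mu>" "adjointable E (inv \<mu>)"
    using assms(4) by (auto simp: invertible_adjointable_def)
  interpret D: regular_symmetric E D by (rule selfadjoint_regular_imp_regular_symmetric[OF assms(3)])
  interpret P: conformal_pair E D \<mu> m' n n'
  proof unfold_locales
    show "is_adjoint E \<mu> m'" "is_adjoint E n n'"
      unfolding m'_def n_def n'_def by (rule adjoint_adj, rule \<mu>)+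
    show "\<mu> (n x) = x" "n (\<mu> x) = x" for x
      unfolding n_def using \<mu>(2) by (simp_all add: bij_is_surj surj_f_inv_f bij_is_inj)
  qed
  have D1: "D\<^sub>1 = P.D1" unfolding assms(10) conformal_def m'_def[symmetric] P.D1_def ..
  have a: "is_adjoint E a a'" unfolding a'_def by (rule adjoint_adj[OF assms(5)])
  obtain b' where b: "is_adjoint E b b'" using assms(6) by (auto simp: adjointable_def)
  let ?k = "pw 1 D.h (1 - \<alpha>)" and ?l = "pw 1 D.h \<alpha>"
  have "\<exists>C. bounded_linear C \<and> (\<forall>x. D.F (m' (a' (D.h x))) - D.h (m' (a' (D.F x))) = D.h (C (?k x)))"
    by (rule D.left_commutator_bound[OF adjoint_comp[OF a P.m_adjoint] \<alpha>])
      (use assms(11) in \<open>simp add: comp_def\<close>)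
  then obtain C1 where C1: "bounded_linear C1"
    "\<And>x. D.F (m' (a' (D.h x))) - D.h (m' (a' (D.F x))) = D.h (C1 (?k x))" by blast
  have "\<exists>C. bounded_linear C \<and> (\<forall>x. D.F (n (a' (D.h x))) - D.h (n (a' (D.F x))) = D.h (C (?k x)))"
    by (rule D.left_commutator_bound[OF adjoint_comp[OF a P.n'_adjoint] \<alpha>])
      (use assms(12) in \<open>simp add: comp_def n'_def\<close>)
  then obtain C2 where C2: "bounded_linear C2"
    "\<And>x. D.F (n (a' (D.h x))) - D.h (n (a' (D.F x))) = D.h (C2 (?k x))" by blast
  obtain C3 where C3: "bounded_linear C3"
    "\<And>x. D.F (a' (D.h x)) - D.h (a' (D.F x)) = D.h (C3 (?k x))"
    using D.left_commutator_bound[OF a \<alpha> assms(13)] by blast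
  obtain C4 where C4: "bounded_linear C4"
    "\<And>x. D.F (b (\<mu> (D.h x))) - D.h (b (\<mu> (D.F x))) = D.h (C4 (?k x))"
    using D.right_commutator_bound[OF \<alpha> assms(14)] by (auto simp: comp_def)
  have br: "bracket_power E D (- \<alpha>) = total_op ?l" using D.bracket_power_nonpos[of "- \<alpha>"] \<alpha> by simp
  let ?T = "commutator P.D1 (a' \<circ> b) \<circ>\<^sub>m total_op n' \<circ>\<^sub>m total_op ?l"
  obtain C5 where C5: "adjointable E C5" "\<And>x. x \<in> dom ?T \<Longrightarrow> the (?T x) = C5 x" "dom ?T \<noteq> {}"
    using bounded_operatorE[OF assms(15)[unfolded D1 br, folded a'_def n'_def]] by blast
  have pres: "(a' \<circ> b) ` dom P.D1 \<subseteq> dom P.D1"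
    using commutator_preserves_dom map_comp_dom_imp_nonempty[OF C5(3)]
      map_comp_dom_imp_nonempty[of "commutator P.D1 (a' \<circ> b)" "total_op n'"] by (metis dom_eq_empty_conv)
  have comm5: "the (P.D1 (a' (b (n' (D.h y))))) - a' (b (\<mu> (D.F y))) = C5 (?k y)" for y
  proof -
    have kk: "?l (?k y) = D.h y"
      using pw_add[OF D.h_spectral, of \<alpha> "1 - \<alpha>" y] \<alpha> by (simp add: pw_1[OF D.h_spectral])
    have d: "n' (D.h y) \<in> dom P.D1" by (simp add: P.D1_dom P.m'_n' D.h_dom del: domIff)
    have "the (P.D1 (n' (D.h y))) = \<mu> (D.F y)" by (simp add: P.D1_app P.m'_n' D.h_dom D.app_h)
    then have "?T (?k y) = Some (the (P.D1 (a' (b (n' (D.h y))))) - a' (b (\<mu> (D.F y))))"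
      using commutator_eq[OF pres d] by (simp add: kk total_op_def)
    then show ?thesis using C5(2)[of "?k y"] by (simp add: dom_def)
  qed
  interpret Q: conformal_commutators E D \<mu> m' n n' a' b C1 C2 C3 C4 C5 \<alpha>
  proof (intro conformal_commutators.intro conformal_commutators_axioms.intro)
    show "bounded_linear a'" "bounded_linear b" "bounded_linear C5"
      by (rule adjoint_bounded_linear[OF is_adjoint_sym[OF a]] adjoint_bounded_linear[OF b] adjointable_bounded_linear[OF C5(1)])+
    show "a' (b y) \<in> dom P.D1" if "y \<in> dom P.D1" for y using pres that by auto
  qed (fact P.conformal_pair_axioms \<alpha> C1 C2 C3 C4 comm5)+
  have bt: "bounded_transform E D\<^sub>1 -\<^sub>m bounded_transform E D = total_op (\<lambda>x. P.D1.F x - D.F x)"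
    unfolding D1 P.D1.bounded_transform_eq D.bounded_transform_eq total_op_diff ..
  define J where "J x = P.D1.F (a' (b (\<mu> x))) - D.F (a' (b (\<mu> x)))" for x
  have J_adj: "\<exists>J'. is_adjoint E J J'"
    unfolding J_def
    using adjoint_comp[OF adjoint_comp[OF adjoint_comp[OF adjoint_diff[OF P.D1.F_selfadj D.F_selfadj] is_adjoint_sym[OF a]] b] P.m_adjoint]
    by blast
  then obtain J' where J: "is_adjoint E J J'" by blast
  have Jdom: "dominated J (pw 1 D.h r)" if "0 \<le> r" "r < 1 - \<alpha>" for r
    unfolding J_def[abs_def] by (rule Q.bounded_transform_difference_dominated[OF that])
  have s1: "1 - \<alpha> \<le> 1" using \<alpha> by simp
  have part1: "bounded_operator E (total_op (\<lambda>x. P.D1.F x - D.F x) \<circ>\<^sub>m total_op (a' \<circ> b \<circ> \<mu>) \<circ>\<^sub>m bracket_power E D \<beta>)"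
    if "\<beta> < 1 - \<alpha>" for \<beta>
    using D.dominated_imp_bounded_operator[OF J Jdom s1 that] by (simp add: J_def[abs_def])
  have part2: "(\<forall>\<beta> < 1 - \<alpha>. bounded_operator E
        (total_op (\<lambda>x. P.D1.F x - D.F x) \<circ>\<^sub>m total_op (a' \<circ> b \<circ> adj E c) \<circ>\<^sub>m bracket_power E D \<beta>)) \<and>
      (\<forall>d. adjointable E d \<and> is_compact E (op_inverse (one_plus (D \<circ>\<^sub>m D)) \<circ>\<^sub>m total_op d) \<longrightarrow>
        is_compact E (total_op (\<lambda>x. P.D1.F x - D.F x) \<circ>\<^sub>m total_op (a' \<circ> b \<circ> adj E c \<circ> d)))"
    if c: "adjointable E c" and cpres: "(c \<circ> n') ` dom D \<subseteq> dom D" for c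
  proof -
    define c' where "c' = adj E c"
    have g: "is_adjoint E (\<lambda>x. c (n' x)) (\<lambda>x. n (c' x))"
      unfolding c'_def by (rule adjoint_comp[OF adjoint_adj[OF c] P.n'_adjoint])
    define Jc where "Jc x = J (n (c' x))" for x
    have Jc: "is_adjoint E Jc (\<lambda>x. c (n' (J' x)))"
      unfolding Jc_def by (rule adjoint_comp[OF J is_adjoint_sym[OF g]])
    have Jc_eq: "Jc x = P.D1.F (a' (b (c' x))) - D.F (a' (b (c' x)))" for x
      by (simp add: Jc_def J_def P.m_n)
    have Jcdom: "dominated Jc (pw 1 D.h r)" if r: "0 \<le> r" "r < 1 - \<alpha>" for r
    proof -
      define q where "q = (r + (1 - \<alpha>)) / 2"
      have q: "0 \<le> q" "r < q" "q < 1 - \<alpha>" using r by (auto simp: q_def)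
      have "dominated (\<lambda>x. pw 1 D.h q (n (c' x))) (pw 1 D.h r)"
        by (rule D.domain_preserving_adjoint_dominated[OF g])
          (use cpres q r \<alpha> in \<open>auto simp: comp_def simp del: domIff\<close>)
      with dominated_right[OF Jdom[OF q(1,3)]] show ?thesis
        unfolding Jc_def[abs_def] by (rule dominated_trans)
    qed
    have s2: "0 \<le> (1 - \<alpha>) / 2" "(1 - \<alpha>) / 2 < 1 - \<alpha>" "0 < (1 - \<alpha>) / 2" using \<alpha> by auto
    show ?thesis
      using D.dominated_imp_bounded_operator[OF Jc Jcdom s1]
        D.dominated_imp_compact[OF Jc Jcdom[OF s2(1,2)] s2(3)]
      by (simp add: Jc_eq[abs_def] c'_def[symmetric])
  qed
  show ?thesis
    unfolding bt a'_def[symmetric] n'_def[symmetric] using part1 part2 by blast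
qed

end
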